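(* Let $\theta\in(0,1)$ and $tol\in[0,1)$. The algorithm C-ADFOUR$(\theta,tol)$ satisfies: (i) The number of iterations of each inner loop is finite and bounded independently of $n$. (ii) The sequences of residuals $r_n$ and errors $u-u_n$ generated for $n\ge0$ by the algorithm satisfy $$\|r_{n+1}\|\le\rho\,\|r_n\|\qquad\text{and}\qquad |||u-u_{n+1}|||\le\rho\,|||u-u_n|||$$ for $\rho=3\,\frac{\alpha^*}{\alpha_*}\sqrt{1-\theta^2}$. In particular, if $\theta$ is chosen in such a way that $\rho<1$, then for any $tol>0$ the algorithm terminates in a finite number of iterations, whereas for $tol=0$ the sequence $u_n$ converges to $u$ in $H^1_p(\Omega)$ as $n\to\infty$.
   Context: Let $d\ge1$, $\Omega=(0,2\pi)^d$, $\phi_k(x)=(2\pi)^{-d/2}e^{ik\cdot x}$ for $k\in\mathbb Z^d$, $\hat v_k=(v,\phi_k)_{L^2(\Omega)}$. $V=H^1_p(\Omega)$: $H^1$ functions $2\pi$-periodic in each direction, norm $\|v\|^2=\sum_k(1+|k|^2)|\hat v_k|^2$ ($|k|$ Euclidean). $H^{-1}_p(\Omega)$ is its (anti)dual, $\hat f_k=\langle f,\phi_k\rangle$, $\|f\|^2=\sum_k(1+|k|^2)^{-1}|\hat f_k|^2$ (same symbol for both norms). For $\Lambda\subset\mathbb Z^d$, $P_\Lambda$ keeps only the Fourier coefficients with index in $\Lambda$; $V_\Lambda=\mathrm{span}\{\phi_k:k\in\Lambda\}$. $Lu=-\nabla\cdot(\nu\nabla u)+\sigma u$ with sufficiently smooth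 real ($2\pi$-periodic) coefficients, $0<\nu_*\le\nu\le\nu^*<\infty$, $0<\sigma_*\le\sigma\le\sigma^*<\infty$; $\alpha_*=\min(\nu_*,\sigma_* )$, $\alpha^*=\max(\nu^*,\sigma^* )$; $a(u,v)=\int_\Omega\nu\nabla u\cdot\nabla\bar v+\int_\Omega\sigma u\bar v$; $|||v|||=\sqrt{a(v,v)}$; $f\in H^{-1}_p(\Omega)$; $u\in V$ solves $a(u,v)=\langle f,v\rangle$ for all $v\in V$. For finite $\Lambda$, $u_\Lambda\in V_\Lambda$ solves $a(u_\Lambda,v)=\langle f,v\rangle$ for all $v\in V_\Lambda$. Residual: $r(w)=f-Lw$. DÖRFLER$(r,\theta)$ returns a finite set $\Lambda^*\subset\mathbb Z^d$ of minimal cardinality with $\|P_{\Lambda^*}r\|\ge\theta\|r\|$. COARSE$(w,\epsilon)$, for $w\in V_{\Lambda^*}$ with $\Lambda^*$ finite and $\|u-w\|\le\epsilon$, returns a set $\Lambda\subseteq\Lambda^*$ of minimal cardinality such that $\|w-P_\Lambda w\|\le2\epsilon$. Algorithm C-ADFOUR$(\theta,tol)$: set $\Lambda_0=\emptyset$, $u_0=0$, $r_0=f$. For $n=0,1,2,\dots$ (outer loop): set $\Lambda_{n,0}=\Lambda_n$, $r_{n,0}=r_n$; inner loop, for $k=0,1,\dots$: $\partial\Lambda_{n,k}=$ DÖRFLER$(r_{n,k},\theta)$, $\Lambda_{n,k+1}=\Lambda_{n,k}\cup\partial\Lambda_{n,k}$, $u_{n,k+1}=u_{\Lambda_{n,k+1}}$,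 $r_{n,k+1}=r(u_{n,k+1})$, repeating while $\|r_{n,k+1}\|>\sqrt{1-\theta^2}\,\|r_n\|$. At the exit of the inner loop: $\Lambda_{n+1}=$ COARSE$\big(u_{n,k+1},\frac1{\alpha_*}\|r_{n,k+1}\|\big)$, $u_{n+1}=u_{\Lambda_{n+1}}$, $r_{n+1}=r(u_{n+1})$; continue the outer loop while $\|r_{n+1}\|>tol$. *)

theory Defs
  imports "HOL-Analysis.Analysis"
begin

type_synonym 'd fn = "real^'d \<Rightarrow> complex"
type_synonym 'd dual = "'d fn \<Rightarrow> complex"
type_synonym 'd idx = "int^'d"

section \<open>Periodic functions and Fourier coefficients\<close>

text \<open>
  The dimension is \<open>CARD('d)\<close>.  Functions on the torus are represented by their periodic
  extensions to the whole space.  An element of \<open>L\<^sup>2\<close> or \<open>H\<^sup>1\<close> is represented by a Borel function;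
  functions that agree almost everywhere represent the same element, and all the quantities
  below (coefficients, norms, the form \<open>a\<close>, bounded functionals) do not distinguish them.
\<close>

definition Omega :: "(real^'d::finite) set" where
  "Omega = box 0 (\<chi> i. 2 * pi)"

definition periodic :: "(real^'d::finite \<Rightarrow> 'b) \<Rightarrow> bool" where
  "periodic v \<longleftrightarrow> (\<forall>x i. v (x + axis i (2 * pi)) = v x)"

definition L2p :: "'d::finite fn set" where
  "L2p = {v. periodic v \<and> v \<in> borel_measurable borel \<and>
             set_integrable lborel Omega (\<lambda>x. (cmod (v x))\<^sup>2)}"

definition rvec :: "'d::finite idx \<Rightarrow> real^'d" where
  "rvec k = (\<chi> i. real_of_int (k $ i))"

definition phi :: "'d::finite idx \<Rightarrow> 'd fn" where
  "phi k = (\<lambda>x. complex_of_real ((2 * pi) powr (- (real CARD('d) / 2)))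
                  * exp (\<i> * complex_of_real (rvec k \<bullet> x)))"

definition fcoef :: "'d::finite fn \<Rightarrow> 'd idx \<Rightarrow> complex" where
  "fcoef v k = (LINT x:Omega|lborel. v x * cnj (phi k x))"

section \<open>The space of periodic \<open>H\<^sup>1\<close> functions\<close>

definition partial_deriv :: "'d::finite \<Rightarrow> (real^'d \<Rightarrow> 'b::real_normed_vector) \<Rightarrow> real^'d \<Rightarrow> 'b" where
  "partial_deriv i g x = frechet_derivative g (at x) (axis i 1)"

definition C1 :: "(real^'d::finite \<Rightarrow> 'b::real_normed_vector) \<Rightarrow> bool" where
  "C1 g \<longleftrightarrow> (\<forall>x. g differentiable (at x)) \<and> (\<forall>i. continuous_on UNIV (partial_deriv i g))"

text \<open>
  Weak first-order derivatives on the whole space, tested against compactly supported \<open>C\<^sup>1\<close>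
  functions (for first-order derivatives this is equivalent to testing against smooth ones).
  As \<open>v\<close> is periodic, the weak derivative is periodic up to a null set, so that asking for a
  periodic representative is no restriction.  Testing on the whole space, and not only inside
  \<open>Omega\<close>, is what makes the traces of \<open>v\<close> on opposite faces agree.
\<close>

definition weak_partial :: "'d::finite \<Rightarrow> 'd fn \<Rightarrow> 'd fn \<Rightarrow> bool" where
  "weak_partial i v g \<longleftrightarrow> g \<in> L2p \<and>
     (\<forall>\<psi> :: 'd fn. C1 \<psi> \<and> bounded {x. \<psi> x \<noteq> 0} \<longrightarrow>
        (LINT x|lborel. v x * partial_deriv i \<psi> x) = - (LINT x|lborel. g x * \<psi> x))"

definition H1p :: "'d::finite fn set" where
  "H1p = {v \<in> L2p. \<forall>i. \<exists>g. weak_partial i v g}"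

text \<open>A representative of the weak partial derivative, which is unique up to null sets.\<close>

definition wderiv :: "'d::finite \<Rightarrow> 'd fn \<Rightarrow> 'd fn" where
  "wderiv i v = (SOME g. weak_partial i v g)"

definition H1norm :: "'d::finite fn \<Rightarrow> real" where
  "H1norm v = sqrt (\<Sum>\<^sub>\<infinity>k. (1 + (norm (rvec k))\<^sup>2) * (cmod (fcoef v k))\<^sup>2)"

section \<open>The antidual space\<close>

definition Hm1p :: "'d::finite dual set" where
  "Hm1p = {F. (\<forall>v\<in>H1p. \<forall>w\<in>H1p. F (\<lambda>x. v x + w x) = F v + F w) \<and>
              (\<forall>c. \<forall>v\<in>H1p. F (\<lambda>x. c * v x) = cnj c * F v) \<and>
              (\<exists>B. \<forall>v\<in>H1p. cmod (F v) \<le> B * H1norm v)}"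

definition Hm1norm :: "'d::finite dual \<Rightarrow> real" where
  "Hm1norm F = sqrt (\<Sum>\<^sub>\<infinity>k. (cmod (F (phi k)))\<^sup>2 / (1 + (norm (rvec k))\<^sup>2))"

section \<open>Trigonometric polynomials and projections\<close>

definition Vspan :: "'d::finite idx set \<Rightarrow> 'd fn set" where
  "Vspan \<Lambda> = {w. \<exists>S c. finite S \<and> S \<subseteq> \<Lambda> \<and> w = (\<lambda>x. \<Sum>k\<in>S. c k * phi k x)}"

text \<open>Both projections are only meant for finite index sets.\<close>

definition proj :: "'d::finite idx set \<Rightarrow> 'd fn \<Rightarrow> 'd fn" where
  "proj \<Lambda> v = (\<lambda>x. \<Sum>k\<in>\<Lambda>. fcoef v k * phi k x)"

text \<open>
  The functional \<open>projd \<Lambda> F\<close> has the coefficient \<open>F (phi k)\<close> at \<open>k \<in> \<Lambda>\<close>, and 0 elsewhere.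
\<close>

definition projd :: "'d::finite idx set \<Rightarrow> 'd dual \<Rightarrow> 'd dual" where
  "projd \<Lambda> F = (\<lambda>v. \<Sum>k\<in>\<Lambda>. F (phi k) * cnj (fcoef v k))"

section \<open>The elliptic problem\<close>

definition bform :: "(real^'d::finite \<Rightarrow> real) \<Rightarrow> (real^'d \<Rightarrow> real) \<Rightarrow> 'd fn \<Rightarrow> 'd fn \<Rightarrow> complex" where
  "bform \<nu> \<sigma> u v =
     (LINT x:Omega|lborel. complex_of_real (\<nu> x) * (\<Sum>i\<in>UNIV. wderiv i u x * cnj (wderiv i v x)))
   + (LINT x:Omega|lborel. complex_of_real (\<sigma> x) * u x * cnj (v x))"

definition energy_norm :: "(real^'d::finite \<Rightarrow> real) \<Rightarrow> (real^'d \<Rightarrow> real) \<Rightarrow> 'd fn \<Rightarrow> real" where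
  "energy_norm \<nu> \<sigma> v = sqrt (Re (bform \<nu> \<sigma> v v))"

text \<open>
  The differential operator with values in the antidual space, that is, in the distributional
  sense: \<open>\<langle>L u, v\<rangle> = a(u, v)\<close>.
\<close>

definition Lop :: "(real^'d::finite \<Rightarrow> real) \<Rightarrow> (real^'d \<Rightarrow> real) \<Rightarrow> 'd fn \<Rightarrow> 'd dual" where
  "Lop \<nu> \<sigma> u = (\<lambda>v. bform \<nu> \<sigma> u v)"

definition residual ::
  "(real^'d::finite \<Rightarrow> real) \<Rightarrow> (real^'d \<Rightarrow> real) \<Rightarrow> 'd dual \<Rightarrow> 'd fn \<Rightarrow> 'd dual" where
  "residual \<nu> \<sigma> f w = (\<lambda>v. f v - Lop \<nu> \<sigma> w v)"

definition galerkin_solution ::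
  "(real^'d::finite \<Rightarrow> real) \<Rightarrow> (real^'d \<Rightarrow> real) \<Rightarrow> 'd dual \<Rightarrow> 'd idx set \<Rightarrow> 'd fn \<Rightarrow> bool" where
  "galerkin_solution \<nu> \<sigma> f \<Lambda> w \<longleftrightarrow> w \<in> Vspan \<Lambda> \<and> (\<forall>v\<in>Vspan \<Lambda>. bform \<nu> \<sigma> w v = f v)"

section \<open>Specifications of the procedures\<close>

text \<open>
  Sets of minimal cardinality need not be unique; a procedure is any function that makes an
  admissible choice.
\<close>

definition min_card :: "('a set \<Rightarrow> bool) \<Rightarrow> 'a set \<Rightarrow> bool" where
  "min_card P \<Lambda> \<longleftrightarrow> P \<Lambda> \<and> (\<forall>\<Lambda>'. P \<Lambda>' \<longrightarrow> card \<Lambda> \<le> card \<Lambda>')"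

definition is_doerfler :: "real \<Rightarrow> ('d::finite dual \<Rightarrow> 'd idx set) \<Rightarrow> bool" where
  "is_doerfler \<theta> doerfler \<longleftrightarrow> (\<forall>r\<in>Hm1p.
     min_card (\<lambda>\<Lambda>. finite \<Lambda> \<and> Hm1norm (projd \<Lambda> r) \<ge> \<theta> * Hm1norm r) (doerfler r))"

text \<open>The first argument of \<open>coarse\<close> is the finite index set that supports the second one.\<close>

definition is_coarse ::
  "'d::finite fn \<Rightarrow> ('d idx set \<Rightarrow> 'd fn \<Rightarrow> real \<Rightarrow> 'd idx set) \<Rightarrow> bool" where
  "is_coarse u coarse \<longleftrightarrow> (\<forall>\<Lambda>s w \<epsilon>.
     finite \<Lambda>s \<and> w \<in> Vspan \<Lambda>s \<and> H1norm (\<lambda>x. u x - w x) \<le> \<epsilon> \<longrightarrow>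
       min_card (\<lambda>\<Lambda>. \<Lambda> \<subseteq> \<Lambda>s \<and> H1norm (\<lambda>x. w x - proj \<Lambda> w x) \<le> 2 * \<epsilon>) (coarse \<Lambda>s w \<epsilon>))"

section \<open>The algorithm\<close>

text \<open>
  A state \<open>(\<Lambda>, w, r)\<close> consists of an index set, the approximation, and its residual.
  The parameter \<open>res\<close> is the map \<open>w \<mapsto> f - L w\<close>, and \<open>gal\<close> maps \<open>\<Lambda>\<close> to the Galerkin solution.
\<close>

type_synonym 'd state = "'d idx set \<times> 'd fn \<times> 'd dual"

definition state_res :: "'d::finite state \<Rightarrow> 'd dual" where
  "state_res s = snd (snd s)"

definition inner_step ::
  "('d::finite fn \<Rightarrow> 'd dual) \<Rightarrow> ('d idx set \<Rightarrow> 'd fn) \<Rightarrow> ('d dual \<Rightarrow> 'd idx set)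
     \<Rightarrow> 'd state \<Rightarrow> 'd state" where
  "inner_step res gal doerfler s =
     (case s of (\<Lambda>, w, r) \<Rightarrow>
        let \<Lambda>' = \<Lambda> \<union> doerfler r; w' = gal \<Lambda>' in (\<Lambda>', w', res w'))"

text \<open>
  \<open>inner_state \<dots> s k\<close> is the state after \<open>k\<close> inner iterations started in the outer state \<open>s\<close>.
  The exit test comes after the loop body, so at least one iteration is performed.
\<close>

definition inner_state ::
  "('d::finite fn \<Rightarrow> 'd dual) \<Rightarrow> ('d idx set \<Rightarrow> 'd fn) \<Rightarrow> ('d dual \<Rightarrow> 'd idx set)
     \<Rightarrow> 'd state \<Rightarrow> nat \<Rightarrow> 'd state" where
  "inner_state res gal doerfler s k = (inner_step res gal doerfler ^^ k) s"

definition inner_exit ::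
  "('d::finite fn \<Rightarrow> 'd dual) \<Rightarrow> ('d idx set \<Rightarrow> 'd fn) \<Rightarrow> ('d dual \<Rightarrow> 'd idx set)
     \<Rightarrow> real \<Rightarrow> 'd state \<Rightarrow> nat \<Rightarrow> bool" where
  "inner_exit res gal doerfler \<theta> s k \<longleftrightarrow> 1 \<le> k \<and>
     Hm1norm (state_res (inner_state res gal doerfler s k))
       \<le> sqrt (1 - \<theta>\<^sup>2) * Hm1norm (state_res s)"

definition inner_terminates ::
  "('d::finite fn \<Rightarrow> 'd dual) \<Rightarrow> ('d idx set \<Rightarrow> 'd fn) \<Rightarrow> ('d dual \<Rightarrow> 'd idx set)
     \<Rightarrow> real \<Rightarrow> 'd state \<Rightarrow> bool" where
  "inner_terminates res gal doerfler \<theta> s \<longleftrightarrow> (\<exists>k. inner_exit res gal doerfler \<theta> s k)"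

text \<open>The number of inner iterations; unspecified if the inner loop does not terminate.\<close>

definition inner_iterations ::
  "('d::finite fn \<Rightarrow> 'd dual) \<Rightarrow> ('d idx set \<Rightarrow> 'd fn) \<Rightarrow> ('d dual \<Rightarrow> 'd idx set)
     \<Rightarrow> real \<Rightarrow> 'd state \<Rightarrow> nat" where
  "inner_iterations res gal doerfler \<theta> s = (LEAST k. inner_exit res gal doerfler \<theta> s k)"

definition outer_step ::
  "('d::finite fn \<Rightarrow> 'd dual) \<Rightarrow> ('d idx set \<Rightarrow> 'd fn) \<Rightarrow> ('d dual \<Rightarrow> 'd idx set)
     \<Rightarrow> ('d idx set \<Rightarrow> 'd fn \<Rightarrow> real \<Rightarrow> 'd idx set) \<Rightarrow> real \<Rightarrow> real \<Rightarrow> 'd state \<Rightarrow> 'd state" where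
  "outer_step res gal doerfler coarse \<alpha>lo \<theta> s =
     (case inner_state res gal doerfler s (inner_iterations res gal doerfler \<theta> s) of (\<Lambda>, w, r) \<Rightarrow>
        let \<Lambda>' = coarse \<Lambda> w (1 / \<alpha>lo * Hm1norm r); w' = gal \<Lambda>' in (\<Lambda>', w', res w'))"

text \<open>
  The outer iteration of index \<open>n\<close> (the one that computes the state of index \<open>n + 1\<close>) is performed
  for \<open>n = 0\<close>, and for \<open>n > 0\<close> as long as the stopping test has failed.  After termination the
  sequence of states is continued by its last element.
\<close>

definition iterates_at :: "real \<Rightarrow> nat \<Rightarrow> 'd::finite state \<Rightarrow> bool" where
  "iterates_at tol n s \<longleftrightarrow> n = 0 \<or> Hm1norm (state_res s) > tol"

primrec cadfour ::
  "'d::finite dual \<Rightarrow> ('d fn \<Rightarrow> 'd dual) \<Rightarrow> ('d idx set \<Rightarrow> 'd fn) \<Rightarrow> ('d dual \<Rightarrow> 'd idx set)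
     \<Rightarrow> ('d idx set \<Rightarrow> 'd fn \<Rightarrow> real \<Rightarrow> 'd idx set) \<Rightarrow> real \<Rightarrow> real \<Rightarrow> real \<Rightarrow> nat \<Rightarrow> 'd state" where
  "cadfour f res gal doerfler coarse \<alpha>lo \<theta> tol 0 = ({}, (\<lambda>x. 0), f)"
| "cadfour f res gal doerfler coarse \<alpha>lo \<theta> tol (Suc n) =
     (let s = cadfour f res gal doerfler coarse \<alpha>lo \<theta> tol n in
      if iterates_at tol n s then outer_step res gal doerfler coarse \<alpha>lo \<theta> s else s)"

end

theory Submission
  imports Defs
begin

text \<open>
  Every step of the algorithm is controlled by the error \<open>u - w\<close> of the current approximation \<open>w\<close>.
  The residual of \<open>w\<close> is the functional \<open>a(u - w, \<cdot>)\<close>, so that coercivity and continuity of the form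
  give, with \<open>\<alpha>lo\<close> and \<open>\<alpha>hi\<close> the bounds of the coefficients,
  \<open>sqrt \<alpha>lo * energy (u - w) \<le> dual norm of the residual \<le> sqrt \<alpha>hi * energy (u - w)\<close>
  (\<open>represents_norm\<close>).
  
  Inner loop.  The set chosen by the marking carries a fraction \<open>\<theta>\<close> of the residual, and on this
  set the residual agrees with the functional of the update \<open>w' - w\<close>, since the new residual vanishes
  there.  The update is therefore at least a fixed fraction of the error, and as \<open>u - w'\<close> and
  \<open>w' - w\<close> are orthogonal, the squared energy error shrinks by the factor
  \<open>1 - \<theta>\<^sup>2 * \<alpha>lo / \<alpha>hi\<close> (\<open>inner_step_contraction\<close>).  The number of steps needed to gain a fixed
  factor does not depend on where the loop starts (\<open>inner_loop_bounded\<close>).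
  
  Outer loop.  At the exit, with \<open>\<epsilon>\<close> the dual norm of the residual divided by \<open>\<alpha>lo\<close>, the error is
  at most \<open>\<epsilon>\<close>, so the coarsened approximation is within \<open>3 * \<epsilon>\<close> of \<open>u\<close>; the Galerkin solution
  on the coarsened set is a best approximation in the energy norm.  This accounts for the factor 3
  and for one quotient \<open>\<alpha>hi / \<alpha>lo\<close> in the contraction factor (\<open>coarse_error\<close>,
  \<open>outer_step_contraction\<close>).  Termination and convergence are geometric decay.
  
  All of this rests on one analytic fact: the norms of \<open>H\<^sup>1\<close> and of its antidual are defined by Fourier
  coefficients, whereas the form consists of integrals of weak derivatives.  The bridge is Parseval's
  identity for a function and for its weak derivatives (\<open>H1_Parseval\<close>).  It needs two ingredients.
  Trigonometric polynomials are dense in \<open>L\<^sup>2\<close> of the period cell (\<open>trig_dense\<close>): the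
  Stone-Weierstrass theorem on the torus yields the continuous functions of the torus, and bounded
  pointwise limits then yield all indicators, hence everything.  And the Fourier coefficients of a weak
  derivative are those of the function times \<open>\<i> k\<close> (\<open>fcoef_weak_partial\<close>): a weak derivative is
  tested on the whole space with compactly supported functions, so the exponential is multiplied by a
  cutoff whose translates sum to 1, and the integrals over the space fold back to the cell.
\<close>

section \<open>Hermitian forms and orthogonal families\<close>

text \<open>
  The form taken by the discriminant criterion in the proof of the Cauchy-Schwarz inequality.
\<close>

lemma quadratic_discriminant:
  fixes b p q :: real
  assumes quad: "\<And>t. 0 \<le> p + t\<^sup>2 * b * q - 2 * t * b" and nn: "0 \<le> b" "0 \<le> q"
  shows "b \<le> p * q"
proof (cases "q = 0")
  case True
  show ?thesis
  proof (rule ccontr)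
    assume "\<not> ?thesis"
    then have "b \<noteq> 0" using True by simp
    then have "2 * ((p + 1) / (2 * b)) * b = p + 1" by simp
    with quad[of "(p + 1) / (2 * b)"] show False unfolding True by linarith
  qed
next
  case False
  then have q: "0 < q" using nn by simp
  have "(1 / q)\<^sup>2 * b * q = b / q" using False by (simp add: power2_eq_square)
  with quad[of "1 / q"] have "b / q \<le> p" by simp
  then show ?thesis using q by (simp add: pos_divide_le_eq)
qed

text \<open>
  Positive semidefinite sesquilinear forms on a space of functions.  Functions that agree almost
  everywhere are not identified, so definiteness cannot be expected.  The inner product of \<open>L\<^sup>2\<close> and the
  energy forms on \<open>H\<^sup>1\<close> are both instances.
\<close>

locale hermitian_form =
  fixes V :: "('x \<Rightarrow> complex) set" and B :: "('x \<Rightarrow> complex) \<Rightarrow> ('x \<Rightarrow> complex) \<Rightarrow> complex"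
  assumes zero_mem: "(\<lambda>x. 0) \<in> V"
    and add_mem: "u \<in> V \<Longrightarrow> v \<in> V \<Longrightarrow> (\<lambda>x. u x + v x) \<in> V"
    and scale_mem: "u \<in> V \<Longrightarrow> (\<lambda>x. c * u x) \<in> V"
    and add_left: "u \<in> V \<Longrightarrow> v \<in> V \<Longrightarrow> w \<in> V \<Longrightarrow> B (\<lambda>x. u x + v x) w = B u w + B v w"
    and scale_left: "u \<in> V \<Longrightarrow> w \<in> V \<Longrightarrow> B (\<lambda>x. c * u x) w = c * B u w"
    and hermitian: "u \<in> V \<Longrightarrow> v \<in> V \<Longrightarrow> B v u = cnj (B u v)"
    and nonneg: "u \<in> V \<Longrightarrow> 0 \<le> Re (B u u)"
begin

definition nrm :: "('x \<Rightarrow> complex) \<Rightarrow> real" where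
  "nrm u = sqrt (Re (B u u))"

lemma diff_mem: "u \<in> V \<Longrightarrow> v \<in> V \<Longrightarrow> (\<lambda>x. u x - v x) \<in> V"
  using add_mem[of u "\<lambda>x. (-1) * v x"] scale_mem[of v "-1"] by simp

lemma sum_mem: "(\<And>k. k \<in> F \<Longrightarrow> e k \<in> V) \<Longrightarrow> (\<lambda>x. \<Sum>k\<in>F. c k * e k x) \<in> V"
proof (induction F rule: infinite_finite_induct)
  case (insert k F)
  then have "(\<lambda>x. c k * e k x + (\<Sum>k\<in>F. c k * e k x)) \<in> V"
    by (intro add_mem scale_mem) auto
  then show ?case using insert by simp
qed (auto simp: zero_mem)

lemma diff_left:
  "u \<in> V \<Longrightarrow> v \<in> V \<Longrightarrow> w \<in> V \<Longrightarrow> B (\<lambda>x. u x - v x) w = B u w - B v w"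
  using add_left[of u "\<lambda>x. (-1) * v x" w] scale_left[of v w "-1"] scale_mem[of v "-1"] by simp

lemma zero_left: "w \<in> V \<Longrightarrow> B (\<lambda>x. 0) w = 0"
  using scale_left[OF zero_mem, of w 0] by simp

lemma sum_left:
  assumes "\<And>k. k \<in> F \<Longrightarrow> e k \<in> V" "w \<in> V"
  shows "B (\<lambda>x. \<Sum>k\<in>F. c k * e k x) w = (\<Sum>k\<in>F. c k * B (e k) w)"
  using assms
proof (induction F rule: infinite_finite_induct)
  case (insert k F)
  have "B (\<lambda>x. c k * e k x + (\<Sum>k\<in>F. c k * e k x)) w = c k * B (e k) w + (\<Sum>k\<in>F. c k * B (e k) w)"
    using insert by (subst add_left) (auto simp: scale_left scale_mem sum_mem)
  then show ?case using insert by simp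
qed (auto simp: zero_left)

lemma add_right:
  "u \<in> V \<Longrightarrow> v \<in> V \<Longrightarrow> w \<in> V \<Longrightarrow> B w (\<lambda>x. u x + v x) = B w u + B w v"
  using hermitian[of "\<lambda>x. u x + v x" w] add_left[of u v w] hermitian[of u w] hermitian[of v w]
  by (simp add: add_mem)

lemma diff_right:
  "u \<in> V \<Longrightarrow> v \<in> V \<Longrightarrow> w \<in> V \<Longrightarrow> B w (\<lambda>x. u x - v x) = B w u - B w v"
  using hermitian[of "\<lambda>x. u x - v x" w] diff_left[of u v w] hermitian[of u w] hermitian[of v w]
  by (simp add: diff_mem)

lemma scale_right: "u \<in> V \<Longrightarrow> w \<in> V \<Longrightarrow> B w (\<lambda>x. c * u x) = cnj c * B w u"
  using hermitian[of "\<lambda>x. c * u x" w] scale_left[of u w c] hermitian[of u w]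
  by (simp add: scale_mem)

lemma sum_right:
  assumes "\<And>k. k \<in> F \<Longrightarrow> e k \<in> V" "w \<in> V"
  shows "B w (\<lambda>x. \<Sum>k\<in>F. c k * e k x) = (\<Sum>k\<in>F. cnj (c k) * B w (e k))"
proof -
  have "B w (\<lambda>x. \<Sum>k\<in>F. c k * e k x) = cnj (\<Sum>k\<in>F. c k * B (e k) w)"
    using hermitian[of "\<lambda>x. \<Sum>k\<in>F. c k * e k x" w] sum_left[of F e w c] assms
    by (simp add: sum_mem)
  also have "\<dots> = (\<Sum>k\<in>F. cnj (c k) * B w (e k))"
    unfolding cnj_sum using assms hermitian[of "e _" w] by (intro sum.cong) auto
  finally show ?thesis .
qed

lemma diag_real: "u \<in> V \<Longrightarrow> B u u = of_real ((nrm u)\<^sup>2)"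
  using hermitian[of u u] nonneg[of u]
  by (simp add: complex_eq_iff nrm_def)

lemma nrm_nonneg: "u \<in> V \<Longrightarrow> 0 \<le> nrm u"
  by (simp add: nrm_def nonneg)

lemma nrm_sq: "u \<in> V \<Longrightarrow> (nrm u)\<^sup>2 = Re (B u u)"
  by (simp add: nrm_def nonneg)

lemma nrm_sq_add:
  assumes "u \<in> V" "v \<in> V"
  shows "(nrm (\<lambda>x. u x + v x))\<^sup>2 = (nrm u)\<^sup>2 + (nrm v)\<^sup>2 + 2 * Re (B u v)"
proof -
  have "Re (B v u) = Re (B u v)" using hermitian[OF assms] by simp
  then show ?thesis using assms by (simp add: nrm_sq add_mem add_left add_right)
qed

lemma nrm_sq_diff:
  assumes "u \<in> V" "v \<in> V"
  shows "(nrm (\<lambda>x. u x - v x))\<^sup>2 = (nrm u)\<^sup>2 + (nrm v)\<^sup>2 - 2 * Re (B u v)"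
proof -
  have "Re (B v u) = Re (B u v)" using hermitian[OF assms] by simp
  then show ?thesis using assms by (simp add: nrm_sq diff_mem diff_left diff_right)
qed

lemma nrm_sq_scale:
  assumes "v \<in> V" shows "(nrm (\<lambda>x. c * v x))\<^sup>2 = (cmod c)\<^sup>2 * (nrm v)\<^sup>2"
proof -
  have "B (\<lambda>x. c * v x) (\<lambda>x. c * v x) = (c * cnj c) * B v v"
    using assms by (simp add: scale_left scale_right scale_mem)
  also have "\<dots> = of_real ((cmod c)\<^sup>2 * (nrm v)\<^sup>2)"
    using assms by (simp add: complex_norm_square[symmetric] diag_real)
  finally show ?thesis using assms by (simp add: nrm_sq scale_mem)
qed

lemma Cauchy_Schwarz:
  assumes u: "u \<in> V" and v: "v \<in> V"
  shows "cmod (B u v) \<le> nrm u * nrm v"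
proof -
  define b where "b = B u v"
  \<comment> \<open>Nonnegativity of the form at \<open>u - t b v\<close>; the factor \<open>b\<close> makes the mixed term real.\<close>
  have quad: "0 \<le> (nrm u)\<^sup>2 + t\<^sup>2 * (cmod b)\<^sup>2 * (nrm v)\<^sup>2 - 2 * t * (cmod b)\<^sup>2" for t :: real
  proof -
    let ?c = "of_real t * b"
    have "B u (\<lambda>x. ?c * v x) = of_real t * (b * cnj b)"
      using u v by (simp add: scale_right b_def)
    then have "Re (B u (\<lambda>x. ?c * v x)) = t * (cmod b)\<^sup>2"
      by (simp add: complex_norm_square[symmetric])
    moreover have "(cmod ?c)\<^sup>2 = t\<^sup>2 * (cmod b)\<^sup>2"
      by (simp add: norm_mult power_mult_distrib)
    ultimately have "(nrm (\<lambda>x. u x - ?c * v x))\<^sup>2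
        = (nrm u)\<^sup>2 + t\<^sup>2 * (cmod b)\<^sup>2 * (nrm v)\<^sup>2 - 2 * t * (cmod b)\<^sup>2"
      using u v by (simp add: nrm_sq_diff scale_mem nrm_sq_scale)
    then show ?thesis by (metis zero_le_power2)
  qed
  have "(cmod b)\<^sup>2 \<le> (nrm u * nrm v)\<^sup>2"
    unfolding power_mult_distrib by (rule quadratic_discriminant[OF quad]) auto
  then show ?thesis unfolding b_def
    by (rule power2_le_imp_le) (simp add: nrm_nonneg u v)
qed

lemma nrm_triangle:
  assumes "u \<in> V" "v \<in> V"
  shows "nrm (\<lambda>x. u x + v x) \<le> nrm u + nrm v"
proof (rule power2_le_imp_le)
  have "Re (B u v) \<le> nrm u * nrm v"
    using Cauchy_Schwarz[OF assms] complex_Re_le_cmod[of "B u v"] by linarith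
  then show "(nrm (\<lambda>x. u x + v x))\<^sup>2 \<le> (nrm u + nrm v)\<^sup>2"
    using assms by (simp add: nrm_sq_add power2_sum)
qed (use assms nrm_nonneg in auto)

end

locale orthogonal_family = hermitian_form V B
  for V :: "('x \<Rightarrow> complex) set" and B +
  fixes e :: "'k \<Rightarrow> 'x \<Rightarrow> complex" and \<omega> :: "'k \<Rightarrow> real"
  assumes e_mem: "e k \<in> V"
    and e_orth: "B (e k) (e l) = (if k = l then of_real (\<omega> k) else 0)"
    and \<omega>_pos: "0 < \<omega> k"
begin

lemma comb_mem: "(\<lambda>x. \<Sum>k\<in>F. c k * e k x) \<in> V"
  by (simp add: sum_mem e_mem)

lemma nrm_sq_comb:
  assumes "finite F"
  shows "(nrm (\<lambda>x. \<Sum>k\<in>F. c k * e k x))\<^sup>2 = (\<Sum>k\<in>F. \<omega> k * (cmod (c k))\<^sup>2)"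
proof -
  have "B (\<lambda>x. \<Sum>k\<in>F. c k * e k x) (\<lambda>x. \<Sum>k\<in>F. c k * e k x)
      = (\<Sum>k\<in>F. \<Sum>l\<in>F. c k * (cnj (c l) * B (e k) (e l)))"
    by (simp add: sum_left sum_right e_mem comb_mem sum_distrib_left)
  also have "\<dots> = (\<Sum>k\<in>F. c k * (cnj (c k) * of_real (\<omega> k)))"
    using assms by (intro sum.cong refl) (simp add: e_orth if_distrib cong: if_cong)
  also have "\<dots> = of_real (\<Sum>k\<in>F. \<omega> k * (cmod (c k))\<^sup>2)"
    unfolding of_real_sum of_real_mult complex_norm_square
    by (intro sum.cong) (auto simp: complex_norm_square[symmetric])
  finally show ?thesis by (simp add: nrm_sq comb_mem)
qed

text \<open>
  Completing the square in each coefficient.  The last sum vanishes for the generalised Fourier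
  coefficients, which therefore give the smallest error; Bessel's inequality and the reduction of
  Parseval's identity to density both come from this.
\<close>

lemma nrm_sq_diff_comb:
  assumes "finite F" "g \<in> V"
  shows "(nrm (\<lambda>x. g x - (\<Sum>k\<in>F. c k * e k x)))\<^sup>2
    = (nrm g)\<^sup>2 - (\<Sum>k\<in>F. (cmod (B g (e k)))\<^sup>2 / \<omega> k)
      + (\<Sum>k\<in>F. \<omega> k * (cmod (c k - B g (e k) / \<omega> k))\<^sup>2)"
proof -
  have complete_square: "\<omega> k * (cmod (c k))\<^sup>2 - 2 * Re (cnj (c k) * B g (e k))
      = \<omega> k * (cmod (c k - B g (e k) / \<omega> k))\<^sup>2 - (cmod (B g (e k)))\<^sup>2 / \<omega> k" for k
    using \<omega>_pos[of k] unfolding cmod_power2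
    by (simp add: field_simps power2_eq_square)
  have "(nrm (\<lambda>x. g x - (\<Sum>k\<in>F. c k * e k x)))\<^sup>2
      = (nrm g)\<^sup>2 + (\<Sum>k\<in>F. \<omega> k * (cmod (c k))\<^sup>2) - 2 * (\<Sum>k\<in>F. Re (cnj (c k) * B g (e k)))"
    using assms by (simp add: nrm_sq_diff comb_mem nrm_sq_comb sum_right e_mem)
  also have "\<dots> = (nrm g)\<^sup>2 + (\<Sum>k\<in>F. \<omega> k * (cmod (c k))\<^sup>2 - 2 * Re (cnj (c k) * B g (e k)))"
    by (simp add: sum_subtractf sum_distrib_left)
  finally show ?thesis unfolding complete_square by (simp add: sum_subtractf)
qed

lemma nrm_sq_diff_proj:
  assumes "finite F" "g \<in> V"
  shows "(nrm (\<lambda>x. g x - (\<Sum>k\<in>F. B g (e k) / \<omega> k * e k x)))\<^sup>2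
    = (nrm g)\<^sup>2 - (\<Sum>k\<in>F. (cmod (B g (e k)))\<^sup>2 / \<omega> k)"
  using nrm_sq_diff_comb[OF assms, of "\<lambda>k. B g (e k) / \<omega> k"] by simp

lemma Bessel:
  assumes "finite F" "g \<in> V"
  shows "(\<Sum>k\<in>F. (cmod (B g (e k)))\<^sup>2 / \<omega> k) \<le> (nrm g)\<^sup>2"
  using nrm_sq_diff_proj[OF assms] zero_le_power2 by (smt (verit))

lemma Parseval:
  assumes "g \<in> V"
    and dense: "\<And>\<epsilon>. 0 < \<epsilon> \<Longrightarrow> \<exists>F c. finite F \<and> (nrm (\<lambda>x. g x - (\<Sum>k\<in>F. c k * e k x)))\<^sup>2 < \<epsilon>"
  shows "((\<lambda>k. (cmod (B g (e k)))\<^sup>2 / \<omega> k) has_sum (nrm g)\<^sup>2) UNIV"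
  unfolding has_sum_def tendsto_iff eventually_finite_subsets_at_top
proof (intro allI impI)
  fix \<epsilon> :: real assume "0 < \<epsilon>"
  then obtain F c where F: "finite F" "(nrm (\<lambda>x. g x - (\<Sum>k\<in>F. c k * e k x)))\<^sup>2 < \<epsilon>"
    using dense by blast
  have "0 \<le> (\<Sum>k\<in>F. \<omega> k * (cmod (c k - B g (e k) / \<omega> k))\<^sup>2)"
    using \<omega>_pos by (intro sum_nonneg mult_nonneg_nonneg) (auto intro: less_imp_le)
  then have lower: "(nrm g)\<^sup>2 - \<epsilon> < (\<Sum>k\<in>F. (cmod (B g (e k)))\<^sup>2 / \<omega> k)"
    using F nrm_sq_diff_comb[OF F(1) assms(1), of c] by simp
  have "dist (\<Sum>k\<in>F'. (cmod (B g (e k)))\<^sup>2 / \<omega> k) ((nrm g)\<^sup>2) < \<epsilon>" if "finite F'" "F \<subseteq> F'" for F'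
  proof -
    have "(\<Sum>k\<in>F. (cmod (B g (e k)))\<^sup>2 / \<omega> k) \<le> (\<Sum>k\<in>F'. (cmod (B g (e k)))\<^sup>2 / \<omega> k)"
      by (rule sum_mono2[OF that]) (simp add: less_imp_le[OF \<omega>_pos])
    then show ?thesis using lower Bessel[OF that(1) assms(1)] \<open>0 < \<epsilon>\<close> by (simp add: dist_real_def)
  qed
  then show "\<exists>X. finite X \<and> X \<subseteq> UNIV \<and> (\<forall>Y. finite Y \<and> X \<subseteq> Y \<and> Y \<subseteq> UNIV \<longrightarrow>
      dist (\<Sum>k\<in>Y. (cmod (B g (e k)))\<^sup>2 / \<omega> k) ((nrm g)\<^sup>2) < \<epsilon>)"
    using F(1) by blast
qed

end

section \<open>Square-integrable functions on the period cell\<close>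

definition cell :: "(real^'d::finite) measure" where
  "cell = restrict_space lborel Omega"

definition L2 :: "'d::finite fn set" where
  "L2 = {g \<in> borel_measurable cell. integrable cell (\<lambda>x. (cmod (g x))\<^sup>2)}"

definition ip :: "'d::finite fn \<Rightarrow> 'd fn \<Rightarrow> complex" where
  "ip g h = (\<integral>x. g x * cnj (h x) \<partial>cell)"

lemma Omega_sets [measurable]: "Omega \<in> sets borel"
  by (simp add: Omega_def)

lemma space_cell: "space cell = Omega"
  by (simp add: cell_def space_restrict_space)

lemma mem_Omega: "x \<in> Omega \<longleftrightarrow> (\<forall>i. 0 < x $ i \<and> x $ i < 2 * pi)"
  by (simp add: Omega_def mem_box_cart)

lemma borel_measurable_cell: "g \<in> borel_measurable borel \<Longrightarrow> g \<in> borel_measurable cell"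
  unfolding cell_def by (intro measurable_restrict_space1) simp

lemma integral_cell:
  fixes g :: "real^'d::finite \<Rightarrow> 'b::{banach, second_countable_topology}"
  shows "(LINT x:Omega|lborel. g x) = (\<integral>x. g x \<partial>cell)"
  unfolding set_lebesgue_integral_def cell_def by (subst integral_restrict_space) auto

lemma integrable_cell:
  fixes g :: "real^'d::finite \<Rightarrow> 'b::{banach, second_countable_topology}"
  shows "set_integrable lborel Omega g \<longleftrightarrow> integrable cell g"
  unfolding set_integrable_def cell_def by (subst integrable_restrict_space) auto

lemma emeasure_cell: "emeasure cell (Omega :: (real^'d::finite) set) = ennreal ((2 * pi) ^ CARD('d))"
proof -
  have "emeasure cell (Omega :: (real^'d) set) = emeasure lborel (Omega :: (real^'d) set)"
    unfolding cell_def by (subst emeasure_restrict_space) auto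
  also have "\<dots> = ennreal (\<Prod>b\<in>Basis. ((\<chi> i. 2 * pi) - 0 :: real^'d) \<bullet> b)"
    unfolding Omega_def
    by (subst emeasure_lborel_box) (auto simp: Basis_vec_def inner_axis)
  also have "(\<Prod>b\<in>Basis. ((\<chi> i. 2 * pi) - 0 :: real^'d) \<bullet> b) = (2 * pi) ^ CARD('d)"
  proof -
    have "(\<Prod>b\<in>Basis. ((\<chi> i. 2 * pi) - 0 :: real^'d) \<bullet> b) = (\<Prod>b\<in>(Basis :: (real^'d) set). 2 * pi)"
      by (intro prod.cong) (auto simp: Basis_vec_def inner_axis)
    then show ?thesis by simp
  qed
  finally show ?thesis .
qed

lemma finite_measure_cell: "finite_measure (cell :: (real^'d::finite) measure)"
  by standard (simp add: space_cell emeasure_cell)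

interpretation cell: finite_measure "cell :: (real^'d::finite) measure"
  by (rule finite_measure_cell)

lemma measure_cell: "measure cell (Omega :: (real^'d::finite) set) = (2 * pi) ^ CARD('d)"
  by (simp add: measure_def emeasure_cell)

lemma L2_measurable: "g \<in> L2 \<Longrightarrow> g \<in> borel_measurable cell"
  by (simp add: L2_def)

lemma L2_mult_integrable:
  assumes "g \<in> L2" "h \<in> L2"
  shows "integrable cell (\<lambda>x. g x * h x)"
proof (rule Bochner_Integration.integrable_bound)
  show "integrable cell (\<lambda>x. (cmod (g x))\<^sup>2 + (cmod (h x))\<^sup>2)"
    using assms by (simp add: L2_def)
  show "(\<lambda>x. g x * h x) \<in> borel_measurable cell"
    using assms by (auto dest!: L2_measurable)
  have "cmod (g x) * cmod (h x) \<le> (cmod (g x))\<^sup>2 + (cmod (h x))\<^sup>2" for x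
    using sum_squares_bound[of "cmod (g x)" "cmod (h x)"]
      mult_nonneg_nonneg[OF norm_ge_zero norm_ge_zero, of "g x" "h x"] by linarith
  then show "AE x in cell. norm (g x * h x) \<le> norm ((cmod (g x))\<^sup>2 + (cmod (h x))\<^sup>2)"
    by (simp add: norm_mult)
qed

lemma borel_measurable_cnj: "g \<in> borel_measurable M \<Longrightarrow> (\<lambda>x. cnj (g x)) \<in> borel_measurable M"
  by (rule borel_measurable_continuous_on[OF continuous_on_cnj[OF continuous_on_id]])

lemma L2_cnj: "g \<in> L2 \<Longrightarrow> (\<lambda>x. cnj (g x)) \<in> L2"
  by (auto simp: L2_def borel_measurable_cnj)

text \<open>
  Multiplication by a bounded coefficient stays in \<open>L\<^sup>2\<close>; this is what makes the energy form finite.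
\<close>

lemma L2_bounded_mult:
  assumes g: "g \<in> L2" and m: "m \<in> borel_measurable cell" and bd: "\<And>x. x \<in> Omega \<Longrightarrow> cmod (m x) \<le> C"
  shows "(\<lambda>x. m x * g x) \<in> L2"
proof -
  have "integrable cell (\<lambda>x. (cmod (m x * g x))\<^sup>2)"
  proof (rule Bochner_Integration.integrable_bound)
    show "integrable cell (\<lambda>x. C\<^sup>2 * (cmod (g x))\<^sup>2)" using g by (simp add: L2_def)
    show "(\<lambda>x. (cmod (m x * g x))\<^sup>2) \<in> borel_measurable cell"
      using m L2_measurable[OF g] by measurable
    have "(cmod (m x))\<^sup>2 \<le> C\<^sup>2" if "x \<in> Omega" for x
      using bd[OF that] by (intro power_mono) auto
    then show "AE x in cell. norm ((cmod (m x * g x))\<^sup>2) \<le> norm (C\<^sup>2 * (cmod (g x))\<^sup>2)"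
      by (auto simp: space_cell norm_mult power_mult_distrib intro!: AE_I2 mult_right_mono)
  qed
  then show ?thesis using m L2_measurable[OF g] by (simp add: L2_def)
qed

lemma L2_bounded:
  assumes "m \<in> borel_measurable cell" "\<And>x. x \<in> Omega \<Longrightarrow> cmod (m x) \<le> C"
  shows "m \<in> L2"
proof -
  have "(\<lambda>x. 1) \<in> L2" by (simp add: L2_def)
  from L2_bounded_mult[OF this assms] show ?thesis by simp
qed

interpretation L2: hermitian_form "L2 :: 'd::finite fn set" ip
proof
  show "(\<lambda>x. 0) \<in> L2" by (simp add: L2_def)
next
  fix u v :: "'d fn" assume u: "u \<in> L2" and v: "v \<in> L2"
  have "integrable cell (\<lambda>x. (cmod (u x + v x))\<^sup>2)"
  proof (rule Bochner_Integration.integrable_bound)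
    show "integrable cell (\<lambda>x. 2 * (cmod (u x))\<^sup>2 + 2 * (cmod (v x))\<^sup>2)"
      using u v by (simp add: L2_def)
    show "(\<lambda>x. (cmod (u x + v x))\<^sup>2) \<in> borel_measurable cell"
      using u v by (auto dest!: L2_measurable)
    have "(cmod (u x + v x))\<^sup>2 \<le> 2 * (cmod (u x))\<^sup>2 + 2 * (cmod (v x))\<^sup>2" for x
    proof -
      have "(cmod (u x + v x))\<^sup>2 \<le> (cmod (u x) + cmod (v x))\<^sup>2"
        by (intro power_mono norm_triangle_ineq) simp
      also have "\<dots> \<le> 2 * (cmod (u x))\<^sup>2 + 2 * (cmod (v x))\<^sup>2"
        using sum_squares_bound[of "cmod (u x)" "cmod (v x)"] by (simp add: power2_sum)
      finally show ?thesis .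
    qed
    then show "AE x in cell. norm ((cmod (u x + v x))\<^sup>2) \<le> norm (2 * (cmod (u x))\<^sup>2 + 2 * (cmod (v x))\<^sup>2)"
      by simp
  qed
  then show "(\<lambda>x. u x + v x) \<in> L2"
    using u v by (auto simp: L2_def)
next
  fix u :: "'d fn" and c assume "u \<in> L2"
  then show "(\<lambda>x. c * u x) \<in> L2"
    by (auto simp: L2_def norm_mult power_mult_distrib)
next
  fix u v w :: "'d fn" assume "u \<in> L2" "v \<in> L2" "w \<in> L2"
  then show "ip (\<lambda>x. u x + v x) w = ip u w + ip v w"
    unfolding ip_def distrib_right
    by (intro Bochner_Integration.integral_add L2_mult_integrable L2_cnj)
next
  fix u w :: "'d fn" and c assume "u \<in> L2" "w \<in> L2"
  then show "ip (\<lambda>x. c * u x) w = c * ip u w"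
    unfolding ip_def by (simp add: mult.assoc)
next
  fix u v :: "'d fn"
  have "cnj (ip u v) = (\<integral>x. cnj (u x * cnj (v x)) \<partial>cell)"
    unfolding ip_def by (rule Bochner_Integration.integral_cnj[symmetric])
  then show "ip v u = cnj (ip u v)"
    by (simp add: ip_def mult.commute)
next
  fix u :: "'d fn" assume "u \<in> L2"
  have "ip u u = of_real (\<integral>x. (cmod (u x))\<^sup>2 \<partial>cell)"
    unfolding ip_def complex_norm_square[symmetric] by (simp del: of_real_power)
  then show "0 \<le> Re (ip u u)" by simp
qed

lemma L2_nrm_sq: "u \<in> L2 \<Longrightarrow> (L2.nrm u)\<^sup>2 = (\<integral>x. (cmod (u x))\<^sup>2 \<partial>cell)"
  by (simp add: L2.nrm_sq ip_def complex_norm_square[symmetric] del: of_real_power)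

lemma continuous_phi: "continuous_on UNIV (phi k)"
  unfolding phi_def by (intro continuous_intros)

lemma cmod_phi: "cmod (phi k (x :: real^'d::finite)) = (2 * pi) powr (- (real CARD('d) / 2))"
  unfolding phi_def by (simp add: norm_mult)

lemma phi_L2: "phi k \<in> L2"
  by (rule L2_bounded[OF borel_measurable_cell])
     (auto simp: cmod_phi intro: borel_measurable_continuous_onI continuous_phi)

lemma fcoef_ip: "fcoef v k = ip v (phi k)"
  by (simp add: fcoef_def integral_cell ip_def)

section \<open>Trigonometric polynomials\<close>

lemma Vspan_comb: "finite F \<Longrightarrow> F \<subseteq> \<Lambda> \<Longrightarrow> (\<lambda>x. \<Sum>k\<in>F. c k * phi k x) \<in> Vspan \<Lambda>"
  unfolding Vspan_def by blast

lemma Vspan_comb_finite: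
  assumes "finite \<Lambda>" "w \<in> Vspan \<Lambda>"
  obtains c where "w = (\<lambda>x. \<Sum>k\<in>\<Lambda>. c k * phi k x)"
proof -
  from assms(2) obtain F c where F: "finite F" "F \<subseteq> \<Lambda>" "w = (\<lambda>x. \<Sum>k\<in>F. c k * phi k x)"
    unfolding Vspan_def by blast
  have "w = (\<lambda>x. \<Sum>k\<in>\<Lambda>. (if k \<in> F then c k else 0) * phi k x)"
    unfolding F(3) using F assms(1)
    by (intro ext sum.mono_neutral_cong_left) auto
  then show thesis by (rule that)
qed

lemma Vspan_mono: "\<Lambda> \<subseteq> \<Lambda>' \<Longrightarrow> Vspan \<Lambda> \<subseteq> Vspan \<Lambda>'"
  unfolding Vspan_def by blast

lemma Vspan_finite_support: "w \<in> Vspan \<Lambda> \<Longrightarrow> \<exists>F. finite F \<and> F \<subseteq> \<Lambda> \<and> w \<in> Vspan F"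
  unfolding Vspan_def by blast

lemma Vspan_scale:
  assumes "v \<in> Vspan \<Lambda>" shows "(\<lambda>x. a * v x) \<in> Vspan \<Lambda>"
proof -
  from assms obtain F c where "finite F" "F \<subseteq> \<Lambda>" "v = (\<lambda>x. \<Sum>k\<in>F. c k * phi k x)"
    unfolding Vspan_def by blast
  then show ?thesis
    using Vspan_comb[of F \<Lambda> "\<lambda>k. a * c k"] by (simp add: sum_distrib_left mult.assoc)
qed

lemma Vspan_add:
  assumes "v \<in> Vspan \<Lambda>" "w \<in> Vspan \<Lambda>" shows "(\<lambda>x. v x + w x) \<in> Vspan \<Lambda>"
proof -
  obtain F G where F: "finite F" "F \<subseteq> \<Lambda>" "v \<in> Vspan F" and G: "finite G" "G \<subseteq> \<Lambda>" "w \<in> Vspan G"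
    using assms[THEN Vspan_finite_support] by blast
  have fin: "finite (F \<union> G)" using F G by simp
  obtain c d where "v = (\<lambda>x. \<Sum>k\<in>F \<union> G. c k * phi k x)" "w = (\<lambda>x. \<Sum>k\<in>F \<union> G. d k * phi k x)"
  proof -
    have "v \<in> Vspan (F \<union> G)" "w \<in> Vspan (F \<union> G)"
      using F(3) G(3) Vspan_mono[of F "F \<union> G"] Vspan_mono[of G "F \<union> G"] by auto
    then show thesis by (elim Vspan_comb_finite[OF fin] that)
  qed
  then show ?thesis
    using Vspan_comb[OF fin, of \<Lambda> "\<lambda>k. c k + d k"] F G by (simp add: distrib_right sum.distrib)
qed

lemma Vspan_diff:
  assumes "v \<in> Vspan \<Lambda>" "w \<in> Vspan \<Lambda>" shows "(\<lambda>x. v x - w x) \<in> Vspan \<Lambda>"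
  using Vspan_add[OF assms(1) Vspan_scale[OF assms(2), of "-1"]] by simp

lemma Vspan_zero: "(\<lambda>x. 0) \<in> Vspan \<Lambda>"
  using Vspan_comb[of "{}" \<Lambda>] by simp

lemma Vspan_sum:
  "(\<And>i. i \<in> I \<Longrightarrow> g i \<in> Vspan \<Lambda>) \<Longrightarrow> (\<lambda>x. \<Sum>i\<in>I. g i x) \<in> Vspan \<Lambda>"
  by (induction I rule: infinite_finite_induct) (auto simp: Vspan_zero intro: Vspan_add)

lemma phi_Vspan: "k \<in> \<Lambda> \<Longrightarrow> phi k \<in> Vspan \<Lambda>"
  using Vspan_comb[of "{k}" \<Lambda> "\<lambda>_. 1"] by simp

text \<open>
  The exponentials without the normalising factor of \<open>phi\<close>; they are closed under products.
\<close>

definition character :: "'d::finite idx \<Rightarrow> 'd fn" where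
  "character k x = exp (\<i> * complex_of_real (rvec k \<bullet> x))"

lemma phi_character:
  "phi k (x :: real^'d::finite) = complex_of_real ((2 * pi) powr (- (real CARD('d) / 2))) * character k x"
  by (simp add: phi_def character_def)

lemma character_Vspan: "character (k :: 'd::finite idx) \<in> Vspan UNIV"
proof -
  have "character k = (\<lambda>x. complex_of_real ((2 * pi) powr (real CARD('d) / 2)) * phi k x)"
    unfolding phi_character mult.assoc[symmetric] of_real_mult[symmetric] powr_add[symmetric] by simp
  then show ?thesis using Vspan_scale[OF phi_Vspan[of k UNIV]] by simp
qed

lemma rvec_add: "rvec (k + l) = rvec k + rvec l"
  by (simp add: rvec_def vec_eq_iff)

lemma character_mult: "character k x * character l x = character (k + l) x"
  by (simp add: character_def rvec_add inner_add_left distrib_left exp_add)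

lemma Vspan_mult:
  assumes "v \<in> Vspan UNIV" "w \<in> Vspan (UNIV :: 'd::finite idx set)"
  shows "(\<lambda>x. v x * w x) \<in> Vspan UNIV"
proof -
  obtain F c where v: "v = (\<lambda>x. \<Sum>k\<in>F. c k * phi k x)"
    using assms(1) unfolding Vspan_def by blast
  obtain G d where w: "w = (\<lambda>x. \<Sum>k\<in>G. d k * phi k x)"
    using assms(2) unfolding Vspan_def by blast
  have phi2: "(\<lambda>x. phi k x * phi l x) \<in> Vspan UNIV" for k l :: "'d idx"
  proof -
    let ?a = "complex_of_real ((2 * pi) powr (- (real CARD('d) / 2)))"
    have "(\<lambda>x. phi k x * phi l x) = (\<lambda>x. (?a * ?a) * character (k + l) x)"
      unfolding phi_character character_mult[symmetric] by (simp add: mult_ac)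
    then show ?thesis using Vspan_scale[OF character_Vspan] by simp
  qed
  have "(\<lambda>x. v x * w x) = (\<lambda>x. \<Sum>k\<in>F. \<Sum>l\<in>G. (c k * d l) * (phi k x * phi l x))"
    unfolding v w sum_product by (simp add: mult_ac)
  then show ?thesis by (simp add: Vspan_sum Vspan_scale phi2)
qed

lemma Vspan_L2: "v \<in> Vspan \<Lambda> \<Longrightarrow> v \<in> L2"
  unfolding Vspan_def by (auto intro: L2.sum_mem phi_L2)

text \<open>
  The covering of the torus by Euclidean space.  The torus is the compact range of this map, and its
  coordinates are characters, which is why the Stone-Weierstrass theorem applies to trigonometric
  polynomials.
\<close>

definition wrap :: "real^'d::finite \<Rightarrow> complex^'d" where
  "wrap x = (\<chi> i. cis (x $ i))"

lemma wrap_continuous: "continuous_on S wrap"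
  unfolding wrap_def by (intro continuous_intros)

lemma cis_character: "cis (x $ i) = character (axis i 1) x"
proof -
  have "rvec (axis i 1) = axis i (1::real)"
    by (simp add: rvec_def axis_def vec_eq_iff)
  then show ?thesis by (simp add: character_def inner_axis' cis_conv_exp)
qed

lemma cnj_cis_character: "cnj (cis (x $ i)) = character (- axis i 1) x"
proof -
  have "rvec (- axis i 1) = - axis i (1::real)"
    by (simp add: rvec_def axis_def vec_eq_iff)
  moreover have "cnj (cis t) = exp (- (\<i> * of_real t))" for t
    using cis_conv_exp[of "- t"] by (simp add: cis_cnj)
  ultimately show ?thesis by (simp add: character_def inner_axis')
qed

lemma compact_range_wrap: "compact (range (wrap :: real^'d::finite \<Rightarrow> _))"
proof -
  have "wrap ` (UNIV :: (real^'d) set) = wrap ` cbox 0 (\<chi> i. 2 * pi)"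
  proof (intro set_eqI iffI)
    fix z assume "z \<in> range (wrap :: real^'d \<Rightarrow> _)"
    then obtain x :: "real^'d" where z: "z = wrap x" by blast
    \<comment> \<open>Each coordinate is reduced modulo \<open>2 * pi\<close>.\<close>
    have "wrap (\<chi> i. x $ i - of_int \<lfloor>x $ i / (2 * pi)\<rfloor> * (2 * pi)) = z"
    proof -
      have "cis (t - of_int n * (2 * pi)) = cis t" for t n
        using cis_multiple_2pi[of "of_int n"] by (simp add: cis_divide[symmetric] mult_ac)
      then show ?thesis by (simp add: wrap_def z)
    qed
    moreover have "(\<chi> i. x $ i - of_int \<lfloor>x $ i / (2 * pi)\<rfloor> * (2 * pi)) \<in> cbox 0 (\<chi> i. 2 * pi)"
    proof -
      have "0 \<le> t - of_int \<lfloor>t / (2 * pi)\<rfloor> * (2 * pi) \<and> t - of_int \<lfloor>t / (2 * pi)\<rfloor> * (2 * pi) \<le> 2 * pi" for t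
        using floor_divide_lower[of "2 * pi" t] floor_divide_upper[of "2 * pi" t]
        by (simp add: algebra_simps)
      then show ?thesis by (simp add: mem_box_cart)
    qed
    ultimately show "z \<in> wrap ` cbox 0 (\<chi> i. 2 * pi)" by blast
  qed auto
  then show ?thesis using compact_continuous_image[OF wrap_continuous] compact_cbox by metis
qed

text \<open>
  The functions on the torus whose pullbacks are trigonometric polynomials form an algebra.  The real
  and imaginary parts of the coordinates belong to it and separate points.
\<close>

lemma trig_uniform_approx:
  fixes h :: "complex^'d::finite \<Rightarrow> real"
  assumes "continuous_on (range wrap) h" "0 < \<epsilon>"
  shows "\<exists>p\<in>Vspan UNIV. \<forall>x. cmod (of_real (h (wrap x)) - p x) < \<epsilon>"
proof -
  \<comment> \<open>Real functions are required here, but membership is tested after the embedding into the complex numbers.\<close>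
  define R where "R = {g. continuous_on (range wrap) g \<and>
      (\<lambda>x. complex_of_real (g (wrap x))) \<in> Vspan (UNIV :: 'd idx set)}"
  have Re_R: "(\<lambda>z. Re (z $ i)) \<in> R" for i
  proof -
    have "(\<lambda>x::real^'d. complex_of_real (Re (wrap x $ i)))
        = (\<lambda>x. (1/2) * (character (axis i 1) x + character (- axis i 1) x))"
      unfolding cis_character[symmetric] cnj_cis_character[symmetric] wrap_def
      by (rule ext, rule complex_eqI) simp_all
    moreover have "\<dots> \<in> Vspan UNIV"
      by (intro Vspan_scale Vspan_add character_Vspan)
    ultimately have "(\<lambda>x::real^'d. complex_of_real (Re (wrap x $ i))) \<in> Vspan UNIV" by (simp only:)
    moreover have "continuous_on (range wrap) (\<lambda>z :: complex^'d. Re (z $ i))" by (intro continuous_intros)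
    ultimately show ?thesis unfolding R_def by blast
  qed
  have Im_R: "(\<lambda>z. Im (z $ i)) \<in> R" for i
  proof -
    have "(\<lambda>x::real^'d. complex_of_real (Im (wrap x $ i)))
        = (\<lambda>x. (-\<i>/2) * (character (axis i 1) x - character (- axis i 1) x))"
      unfolding cis_character[symmetric] cnj_cis_character[symmetric] wrap_def
      by (rule ext, rule complex_eqI) simp_all
    moreover have "\<dots> \<in> Vspan UNIV"
      by (intro Vspan_scale Vspan_diff character_Vspan)
    ultimately have "(\<lambda>x::real^'d. complex_of_real (Im (wrap x $ i))) \<in> Vspan UNIV" by (simp only:)
    moreover have "continuous_on (range wrap) (\<lambda>z :: complex^'d. Im (z $ i))" by (intro continuous_intros)
    ultimately show ?thesis unfolding R_def by blast
  qed
  have const: "(\<lambda>z. c) \<in> R" for c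
  proof -
    have "(\<lambda>x. 1) = character (0 :: 'd idx)"
      by (rule ext) (simp add: character_def rvec_def inner_vec_def)
    then have "(\<lambda>x. 1) \<in> Vspan (UNIV :: 'd idx set)" using character_Vspan by simp
    from Vspan_scale[OF this] show ?thesis by (simp add: R_def)
  qed
  interpret function_ring_on R "range wrap"
  proof
    show "compact (range (wrap :: real^'d \<Rightarrow> _))" by (rule compact_range_wrap)
    show "continuous_on (range wrap) g" if "g \<in> R" for g using that by (simp add: R_def)
    show "(\<lambda>x. g x + h x) \<in> R" if "g \<in> R" "h \<in> R" for g h
      using that Vspan_add[of "\<lambda>x. complex_of_real (g (wrap x))" UNIV "\<lambda>x. complex_of_real (h (wrap x))"]
      by (simp add: R_def continuous_on_add)
    show "(\<lambda>x. g x * h x) \<in> R" if "g \<in> R" "h \<in> R" for g h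
      using that Vspan_mult[of "\<lambda>x. complex_of_real (g (wrap x))" "\<lambda>x. complex_of_real (h (wrap x))"]
      by (simp add: R_def continuous_on_mult)
    show "(\<lambda>_. c) \<in> R" for c by (rule const)
    fix x y assume xy: "x \<in> range wrap" "y \<in> range wrap" "x \<noteq> (y :: complex^'d)"
    then obtain i where "x $ i \<noteq> y $ i" by (auto simp: vec_eq_iff)
    then have "Re (x $ i) \<noteq> Re (y $ i) \<or> Im (x $ i) \<noteq> Im (y $ i)" by (simp add: complex_eq_iff)
    then show "\<exists>f\<in>R. f x \<noteq> f y"
      by (elim disjE) (rule bexI[OF _ Re_R[of i]] bexI[OF _ Im_R[of i]], assumption)+
  qed
  obtain g where g: "g \<in> R" "\<And>z. z \<in> range wrap \<Longrightarrow> \<bar>h z - g z\<bar> < \<epsilon>"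
    using Stone_Weierstrass_basic[OF assms] by blast
  have "cmod (of_real (h (wrap x)) - of_real (g (wrap x))) < \<epsilon>" for x
    using g(2)[of "wrap x"] unfolding of_real_diff[symmetric] norm_of_real by simp
  moreover have "(\<lambda>x. complex_of_real (g (wrap x))) \<in> Vspan UNIV" using g(1) by (simp add: R_def)
  ultimately show ?thesis by (intro bexI[of _ "\<lambda>x. complex_of_real (g (wrap x))"]) auto
qed

section \<open>Density of trigonometric polynomials\<close>

definition trig_approx :: "'d::finite fn \<Rightarrow> bool" where
  "trig_approx g \<longleftrightarrow> g \<in> L2 \<and> (\<forall>\<epsilon>>0. \<exists>p\<in>Vspan UNIV. L2.nrm (\<lambda>x. g x - p x) < \<epsilon>)"

lemma trig_approx_limit:
  assumes g: "g \<in> L2" and near: "\<And>\<epsilon>. 0 < \<epsilon> \<Longrightarrow> \<exists>h. trig_approx h \<and> L2.nrm (\<lambda>x. g x - h x) < \<epsilon>"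
  shows "trig_approx g"
  unfolding trig_approx_def
proof (intro conjI g allI impI)
  fix \<epsilon> :: real assume "0 < \<epsilon>"
  then obtain h where h: "trig_approx h" "L2.nrm (\<lambda>x. g x - h x) < \<epsilon> / 2" using near[of "\<epsilon> / 2"] by auto
  moreover obtain p where p: "p \<in> Vspan UNIV" "L2.nrm (\<lambda>x. h x - p x) < \<epsilon> / 2"
    using h(1) \<open>0 < \<epsilon>\<close> unfolding trig_approx_def by (meson half_gt_zero)
  have "L2.nrm (\<lambda>x. (g x - h x) + (h x - p x)) \<le> L2.nrm (\<lambda>x. g x - h x) + L2.nrm (\<lambda>x. h x - p x)"
    using g h(1) p(1) unfolding trig_approx_def
    by (intro L2.nrm_triangle L2.diff_mem) (auto intro: Vspan_L2)
  then show "\<exists>p\<in>Vspan UNIV. L2.nrm (\<lambda>x. g x - p x) < \<epsilon>"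
    using h p by (intro bexI[of _ p]) auto
qed

lemma trig_approx_Vspan: "p \<in> Vspan UNIV \<Longrightarrow> trig_approx p"
  unfolding trig_approx_def
  by (auto intro!: Vspan_L2 bexI[of _ p] simp: L2.nrm_def L2.zero_left[OF L2.zero_mem])

lemma trig_approx_add:
  assumes "trig_approx g" "trig_approx h"
  shows "trig_approx (\<lambda>x. g x + h x)"
  unfolding trig_approx_def
proof (intro conjI allI impI)
  show "(\<lambda>x. g x + h x) \<in> L2" using assms by (auto simp: trig_approx_def intro: L2.add_mem)
  fix \<epsilon> :: real assume "0 < \<epsilon>"
  then obtain p q where p: "p \<in> Vspan UNIV" "L2.nrm (\<lambda>x. g x - p x) < \<epsilon> / 2"
    and q: "q \<in> Vspan UNIV" "L2.nrm (\<lambda>x. h x - q x) < \<epsilon> / 2"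
    using assms unfolding trig_approx_def by (meson half_gt_zero)
  have "L2.nrm (\<lambda>x. (g x - p x) + (h x - q x)) \<le> L2.nrm (\<lambda>x. g x - p x) + L2.nrm (\<lambda>x. h x - q x)"
    using assms p(1) q(1) unfolding trig_approx_def
    by (intro L2.nrm_triangle L2.diff_mem) (auto intro: Vspan_L2)
  then show "\<exists>p\<in>Vspan UNIV. L2.nrm (\<lambda>x. g x + h x - p x) < \<epsilon>"
    using p q Vspan_add[OF p(1) q(1)]
    by (intro bexI[of _ "\<lambda>x. p x + q x"]) (auto simp: algebra_simps)
qed

lemma trig_approx_scale:
  assumes "trig_approx g" shows "trig_approx (\<lambda>x. c * g x)"
  unfolding trig_approx_def
proof (intro conjI allI impI)
  show "(\<lambda>x. c * g x) \<in> L2" using assms by (auto simp: trig_approx_def intro: L2.scale_mem)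
  fix \<epsilon> :: real assume "0 < \<epsilon>"
  then have "0 < \<epsilon> / (cmod c + 1)" by (simp add: add_nonneg_pos)
  then obtain p where p: "p \<in> Vspan UNIV" "L2.nrm (\<lambda>x. g x - p x) < \<epsilon> / (cmod c + 1)"
    using assms unfolding trig_approx_def by blast
  have mem: "(\<lambda>x. g x - p x) \<in> L2"
    using assms p by (auto simp: trig_approx_def intro: L2.diff_mem Vspan_L2)
  have "(L2.nrm (\<lambda>x. c * (g x - p x)))\<^sup>2 = (cmod c * L2.nrm (\<lambda>x. g x - p x))\<^sup>2"
    by (simp add: L2.nrm_sq_scale[OF mem] power_mult_distrib)
  then have "L2.nrm (\<lambda>x. c * (g x - p x)) = cmod c * L2.nrm (\<lambda>x. g x - p x)"
    using L2.nrm_nonneg[OF mem] L2.nrm_nonneg[OF L2.scale_mem[OF mem]] by (simp add: power2_eq_iff_nonneg)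
  also have "\<dots> \<le> (cmod c + 1) * L2.nrm (\<lambda>x. g x - p x)"
    using L2.nrm_nonneg[OF mem] by (intro mult_right_mono) auto
  also have "\<dots> < \<epsilon>" using p(2) by (simp add: pos_less_divide_eq add_nonneg_pos mult.commute)
  finally show "\<exists>p\<in>Vspan UNIV. L2.nrm (\<lambda>x. c * g x - p x) < \<epsilon>"
    using Vspan_scale[OF p(1)] by (intro bexI[of _ "\<lambda>x. c * p x"]) (auto simp: algebra_simps)
qed

lemma trig_approx_sum:
  "(\<And>i. i \<in> I \<Longrightarrow> trig_approx (g i)) \<Longrightarrow> trig_approx (\<lambda>x. \<Sum>i\<in>I. g i x)"
  by (induction I rule: infinite_finite_induct)
     (auto intro: trig_approx_add trig_approx_Vspan Vspan_zero)

text \<open>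
  Closure under dominated pointwise limits.  It lets density in \<open>L\<^sup>2\<close> be proved along the construction
  of measurable functions, without knowing that \<open>L\<^sup>2\<close> is complete.
\<close>

lemma trig_approx_dominated:
  fixes g :: "'d::finite fn"
  assumes approx: "\<And>n. trig_approx (s n)" and g: "g \<in> borel_measurable cell"
    and lim: "\<And>x. x \<in> Omega \<Longrightarrow> (\<lambda>n. s n x) \<longlonglongrightarrow> g x"
    and bd: "\<And>n x. x \<in> Omega \<Longrightarrow> cmod (s n x) \<le> h x"
    and h: "integrable cell (\<lambda>x. (h x)\<^sup>2)"
  shows "trig_approx g"
proof (rule trig_approx_limit)
  have bdg: "cmod (g x) \<le> h x" if "x \<in> Omega" for x
    by (rule Lim_bounded[OF tendsto_norm[OF lim[OF that]], of 0]) (auto intro: bd that)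
  have "integrable cell (\<lambda>x. (cmod (g x))\<^sup>2)"
  proof (rule Bochner_Integration.integrable_bound[OF h])
    show "AE x in cell. norm ((cmod (g x))\<^sup>2) \<le> norm ((h x)\<^sup>2)"
      using bdg by (intro AE_I2) (auto simp: space_cell intro: power_mono)
  qed (use g in measurable)
  then show L2g: "g \<in> L2" using g by (simp add: L2_def)
  have L2s: "s n \<in> L2" for n using approx by (simp add: trig_approx_def)
  have "(\<lambda>n. \<integral>x. (cmod (g x - s n x))\<^sup>2 \<partial>cell) \<longlonglongrightarrow> (\<integral>x. 0 \<partial>(cell :: (real^'d) measure))"
  proof (rule integral_dominated_convergence[where w = "\<lambda>x. 4 * (h x)\<^sup>2"])
    show "(\<lambda>x. (cmod (g x - s n x))\<^sup>2) \<in> borel_measurable cell" for n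
      using g L2_measurable[OF L2s] by measurable
    show "integrable cell (\<lambda>x. 4 * (h x)\<^sup>2)" using h by simp
    show "AE x in cell. (\<lambda>n. (cmod (g x - s n x))\<^sup>2) \<longlonglongrightarrow> 0"
    proof (intro AE_I2)
      fix x :: "real^'d" assume "x \<in> space cell"
      then have "(\<lambda>n. (cmod (g x - s n x))\<^sup>2) \<longlonglongrightarrow> (cmod (g x - g x))\<^sup>2"
        by (intro tendsto_intros lim) (simp add: space_cell)
      then show "(\<lambda>n. (cmod (g x - s n x))\<^sup>2) \<longlonglongrightarrow> 0" by simp
    qed
    show "AE x in cell. norm ((cmod (g x - s n x))\<^sup>2) \<le> 4 * (h x)\<^sup>2" for n
    proof (intro AE_I2)
      fix x :: "real^'d" assume "x \<in> space cell"
      then have x: "x \<in> Omega" by (simp add: space_cell)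
      have "cmod (g x - s n x) \<le> 2 * h x"
        using norm_triangle_ineq4[of "g x" "s n x"] bdg[OF x] bd[OF x, of n] by linarith
      then have "(cmod (g x - s n x))\<^sup>2 \<le> (2 * h x)\<^sup>2" by (intro power_mono) auto
      then show "norm ((cmod (g x - s n x))\<^sup>2) \<le> 4 * (h x)\<^sup>2" by (simp add: power_mult_distrib)
    qed
  qed simp
  then have conv: "(\<lambda>n. (L2.nrm (\<lambda>x. g x - s n x))\<^sup>2) \<longlonglongrightarrow> 0"
    using L2g L2s by (simp add: L2_nrm_sq L2.diff_mem)
  fix \<epsilon> :: real assume "0 < \<epsilon>"
  then have "\<forall>\<^sub>F n in sequentially. (L2.nrm (\<lambda>x. g x - s n x))\<^sup>2 < \<epsilon>\<^sup>2"
    by (intro order_tendstoD[OF conv]) simp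
  then obtain n where "(L2.nrm (\<lambda>x. g x - s n x))\<^sup>2 < \<epsilon>\<^sup>2"
    unfolding eventually_sequentially by blast
  then have "L2.nrm (\<lambda>x. g x - s n x) < \<epsilon>" by (rule power2_less_imp_less) (use \<open>0 < \<epsilon>\<close> in simp)
  then show "\<exists>h. trig_approx h \<and> L2.nrm (\<lambda>x. g x - h x) < \<epsilon>" using approx by blast
qed

lemma trig_approx_continuous:
  fixes h :: "complex^'d::finite \<Rightarrow> real"
  assumes h: "continuous_on UNIV h"
  shows "trig_approx (\<lambda>x. complex_of_real (h (wrap x)))"
proof -
  have "\<exists>p\<in>Vspan UNIV. \<forall>x. cmod (of_real (h (wrap x)) - p x) < 1 / real (Suc n)" for n
    using h by (intro trig_uniform_approx) (auto intro: continuous_on_subset)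
  then have "\<exists>p. \<forall>n. p n \<in> Vspan (UNIV :: 'd idx set) \<and>
      (\<forall>x. cmod (of_real (h (wrap x)) - p n x) < 1 / real (Suc n))"
    by (intro choice) blast
  then obtain p where p: "\<And>n. p n \<in> Vspan (UNIV :: 'd idx set)"
    and close: "\<And>n x. cmod (of_real (h (wrap x)) - p n x) < 1 / real (Suc n)"
    by blast
  have cont: "continuous_on UNIV (\<lambda>x :: real^'d. h (wrap x))"
    using continuous_on_compose2[OF h wrap_continuous] by auto
  have "bounded ((h :: complex^'d \<Rightarrow> real) ` range wrap)"
    using compact_continuous_image[OF continuous_on_subset[OF h] compact_range_wrap]
    by (simp add: compact_imp_bounded)
  then obtain C where C: "\<And>x. \<bar>h (wrap x)\<bar> \<le> C" unfolding bounded_iff by auto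
  show ?thesis
  proof (rule trig_approx_dominated[where h = "\<lambda>_. C + 1"])
    show "trig_approx (p n)" for n using p by (rule trig_approx_Vspan)
    show "(\<lambda>x::real^'d. complex_of_real (h (wrap x))) \<in> borel_measurable cell"
      using cont by (intro borel_measurable_cell borel_measurable_continuous_onI continuous_on_of_real)
    show "(\<lambda>n. p n x) \<longlonglongrightarrow> of_real (h (wrap x))" for x
    proof (rule LIM_zero_cancel, rule Lim_null_comparison)
      show "\<forall>\<^sub>F n in sequentially. cmod (p n x - of_real (h (wrap x))) \<le> 1 / real (Suc n)"
        using less_imp_le[OF close] by (simp add: norm_minus_commute)
      show "(\<lambda>n. 1 / real (Suc n)) \<longlonglongrightarrow> 0" using LIMSEQ_inverse_real_of_nat by (simp add: inverse_eq_divide)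
    qed
    show "cmod (p n x) \<le> C + 1" for n x
    proof -
      have "1 / real (Suc n) \<le> 1" "cmod (of_real (h (wrap x))) = \<bar>h (wrap x)\<bar>" by simp_all
      then show ?thesis
        using close[of x n] C[of x] norm_triangle_ineq2[of "p n x" "of_real (h (wrap x))"]
        unfolding norm_minus_commute[of "p n x"] by linarith
    qed
  qed (rule cell.integrable_const)
qed

text \<open>
  Open sets are intersection stable and generate the Borel sets, so Dynkin's argument applies: the
  indicator of an open set is an increasing limit of continuous functions, and complements and disjoint
  unions are handled by linearity and dominated limits.
\<close>

lemma trig_approx_indicator_wrap:
  fixes A :: "(complex^'d::finite) set"
  assumes "A \<in> sets borel"
  shows "trig_approx (\<lambda>x. indicator A (wrap x))"
proof -
  have meas: "wrap \<in> borel_measurable (borel :: (real^'d) measure)"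
    by (intro borel_measurable_continuous_onI wrap_continuous)
  have ind_meas: "(\<lambda>x::real^'d. indicator B (wrap x) :: complex) \<in> borel_measurable cell"
    if "B \<in> sets borel" for B
    using that by (intro borel_measurable_cell, intro measurable_compose[OF meas borel_measurable_indicator]) simp
  have one: "trig_approx (\<lambda>x::real^'d. 1)"
    using trig_approx_continuous[of "\<lambda>_. 1"] by simp
  have sig: "sets (borel :: (complex^'d) measure) = sigma_sets UNIV {U. open U}" by (simp add: borel_def)
  have "Int_stable {U :: (complex^'d) set. open U}" by (auto simp: Int_stable_def)
  moreover have "{U :: (complex^'d) set. open U} \<subseteq> Pow UNIV" by simp
  moreover have "A \<in> sigma_sets UNIV {U. open U}" using assms unfolding sig .
  ultimately show ?thesis
  proof (induct rule: sigma_sets_induct_disjoint)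
    fix U :: "(complex^'d) set" assume "U \<in> {U. open U}"
    then have U: "open U" by simp
    show "trig_approx (\<lambda>x. indicator U (wrap x))"
    proof (cases "U = UNIV")
      case True then show ?thesis using one by simp
    next
      case False
      define s where "s n z = min 1 (real n * infdist z (- U))" for n z
      have s01: "0 \<le> s n z" "s n z \<le> 1" for n z by (simp_all add: s_def infdist_nonneg)
      show ?thesis
      proof (rule trig_approx_dominated[where h = "\<lambda>_. 1"])
        show "trig_approx (\<lambda>x. complex_of_real (s n (wrap x)))" for n
          unfolding s_def by (intro trig_approx_continuous continuous_intros)
        show "(\<lambda>x. indicator U (wrap x) :: complex) \<in> borel_measurable cell"
          using U by (intro ind_meas) simp
        show "(\<lambda>n. complex_of_real (s n (wrap x))) \<longlonglongrightarrow> indicator U (wrap x)" for x :: "real^'d"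
        proof (cases "wrap x \<in> U")
          case False
          then show ?thesis by (simp add: s_def)
        next
          case True
          then have "infdist (wrap x) (- U) \<noteq> 0"
            using in_closed_iff_infdist_zero[of "- U" "wrap x"] U \<open>U \<noteq> UNIV\<close> by auto
          then have pos: "0 < infdist (wrap x) (- U)" using infdist_nonneg[of "wrap x" "- U"] by simp
          have "\<forall>\<^sub>F n in sequentially. 1 / infdist (wrap x) (- U) \<le> real n"
            using filterlim_real_sequentially unfolding filterlim_at_top by blast
          then have "\<forall>\<^sub>F n in sequentially. complex_of_real (s n (wrap x)) = indicator U (wrap x)"
          proof eventually_elim
            case (elim n)
            then have "1 \<le> real n * infdist (wrap x) (- U)"
              using pos by (simp add: pos_divide_le_eq)
            then show ?case using True by (simp add: s_def)
          qed
          then show ?thesis by (rule tendsto_eventually)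
        qed
        show "cmod (complex_of_real (s n (wrap x))) \<le> 1" for n x using s01 by simp
      qed (rule cell.integrable_const)
    qed
  next
    show "trig_approx (\<lambda>x::real^'d. indicator {} (wrap x))"
      using trig_approx_Vspan[OF Vspan_zero] by simp
  next
    fix B :: "(complex^'d) set" assume "trig_approx (\<lambda>x. indicator B (wrap x))"
    from trig_approx_add[OF one trig_approx_scale[OF this, of "-1"]]
    have "trig_approx (\<lambda>x. 1 - indicator B (wrap x))" by simp
    then show "trig_approx (\<lambda>x. indicator (UNIV - B) (wrap x))"
      by (simp add: indicator_diff)
  next
    fix F :: "nat \<Rightarrow> (complex^'d) set"
    assume disj: "disjoint_family F" and meas_F: "range F \<subseteq> sigma_sets UNIV {U. open U}"
      and IH: "\<And>i. trig_approx (\<lambda>x. indicator (F i) (wrap x))"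
    have F: "F i \<in> sets borel" for i using meas_F unfolding sig by auto
    have part: "(\<Sum>i<n. indicator (F i) z :: complex) = indicator (\<Union>i<n. F i) z" for n z
      using disj by (subst indicator_UN_disjoint) (auto intro: disjoint_family_on_mono)
    show "trig_approx (\<lambda>x. indicator (\<Union>i. F i) (wrap x))"
    proof (rule trig_approx_dominated[where h = "\<lambda>_. 1"])
      show "trig_approx (\<lambda>x. \<Sum>i<n. indicator (F i) (wrap x))" for n
        by (rule trig_approx_sum[OF IH])
      show "(\<lambda>x. indicator (\<Union>i. F i) (wrap x) :: complex) \<in> borel_measurable cell"
        using F by (intro ind_meas) auto
      show "(\<lambda>n. \<Sum>i<n. indicator (F i) (wrap x) :: complex) \<longlonglongrightarrow> indicator (\<Union>i. F i) (wrap x)"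
        for x :: "real^'d"
        unfolding part by (rule LIMSEQ_indicator_UN)
      show "cmod (\<Sum>i<n. indicator (F i) (wrap x)) \<le> 1" for n x
        unfolding part by (simp add: indicator_def)
    qed (rule cell.integrable_const)
  qed
qed

text \<open>
  A Borel left inverse of \<open>wrap\<close> on the open cell.  Truncation of the real part keeps \<open>arccos\<close>
  continuous on the whole line, which makes measurability immediate.
\<close>

definition unwrap :: "complex^'d::finite \<Rightarrow> real^'d" where
  "unwrap z = (\<chi> i. let c = arccos (max (- 1) (min 1 (Re (z $ i))))
                     in if 0 \<le> Im (z $ i) then c else 2 * pi - c)"

lemma unwrap_wrap:
  assumes "x \<in> Omega" shows "unwrap (wrap x) = x"
proof -
  have "(if 0 \<le> sin t then arccos (cos t) else 2 * pi - arccos (cos t)) = t"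
    if t: "0 < t" "t < 2 * pi" for t
  proof (cases "t \<le> pi")
    case True
    then show ?thesis using t sin_ge_zero[of t] by (simp add: arccos_cos)
  next
    case False
    then have "arccos (cos (2 * pi - t)) = 2 * pi - t" using t by (intro arccos_cos) auto
    then show ?thesis using False t sin_lt_zero[of t] by simp
  qed
  then show ?thesis using assms
    by (simp add: unwrap_def wrap_def mem_Omega vec_eq_iff Let_def)
qed

lemma borel_measurable_unwrap: "unwrap \<in> borel_measurable (borel :: (complex^'d::finite) measure)"
proof -
  have *: "(\<lambda>z. unwrap z $ i) \<in> borel_measurable (borel :: (complex^'d) measure)" for i
  proof -
    have arccos: "continuous_on UNIV (\<lambda>z :: complex^'d. arccos (max (- 1) (min 1 (Re (z $ i)))))"
      by (rule continuous_on_arccos) (auto intro!: continuous_intros)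
    have Im: "continuous_on UNIV (\<lambda>z :: complex^'d. Im (z $ i))"
      by (intro continuous_intros)
    note [measurable] = arccos[THEN borel_measurable_continuous_onI] Im[THEN borel_measurable_continuous_onI]
    show ?thesis unfolding unwrap_def Let_def vec_lambda_beta by measurable
  qed
  show ?thesis
    by (subst borel_measurable_euclidean_space) (auto simp: Basis_vec_def inner_axis *)
qed

lemma trig_approx_cong:
  assumes g: "trig_approx g" and h: "h \<in> borel_measurable cell" and eq: "\<And>x. x \<in> Omega \<Longrightarrow> g x = h x"
  shows "trig_approx h"
proof (rule trig_approx_dominated[where s = "\<lambda>_. g" and h = "\<lambda>x. cmod (g x)", OF g h])
  show "(\<lambda>n. g x) \<longlonglongrightarrow> h x" if "x \<in> Omega" for x using eq[OF that] by simp
  show "integrable cell (\<lambda>x. (cmod (g x))\<^sup>2)" using g by (simp add: trig_approx_def L2_def)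
qed simp

text \<open>
  On the cell, every measurable set is the preimage under \<open>wrap\<close> of a Borel set of the ambient space,
  namely of its own preimage under \<open>unwrap\<close>.
\<close>

lemma trig_approx_indicator:
  assumes C: "C \<in> sets cell"
  shows "trig_approx (indicator C)"
proof (rule trig_approx_cong)
  have "unwrap -` C \<inter> space borel \<in> sets borel"
    using C by (intro measurable_sets[OF borel_measurable_unwrap])
      (auto simp: cell_def sets_restrict_space_iff)
  then show "trig_approx (\<lambda>x. indicator (unwrap -` C) (wrap x))"
    by (intro trig_approx_indicator_wrap) simp
  show "(indicator C :: _ \<Rightarrow> complex) \<in> borel_measurable cell"
    using C by (rule borel_measurable_indicator)
  show "indicator (unwrap -` C) (wrap x) = (indicator C x :: complex)" if "x \<in> Omega" for x
    using unwrap_wrap[OF that] by (simp add: indicator_def)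
qed

lemma trig_approx_simple:
  assumes s: "simple_function cell s"
  shows "trig_approx s"
proof (rule trig_approx_cong)
  show "trig_approx (\<lambda>x. \<Sum>y\<in>s ` space cell. y * indicator (s -` {y} \<inter> space cell) x)"
    using s by (intro trig_approx_sum trig_approx_scale trig_approx_indicator)
      (auto simp: simple_function_def)
  show "s \<in> borel_measurable cell" using s by (rule borel_measurable_simple_function)
  show "(\<Sum>y\<in>s ` space cell. y * indicator (s -` {y} \<inter> space cell) x) = s x" if "x \<in> Omega" for x
  proof -
    have "(\<Sum>y\<in>s ` space cell. y * indicator (s -` {y} \<inter> space cell) x)
        = (\<Sum>y\<in>s ` space cell. if s x = y then y else 0)"
      using that by (intro sum.cong) (auto simp: indicator_def space_cell)
    then show ?thesis using s that by (simp add: simple_function_def space_cell)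
  qed
qed

text \<open>
  Simple functions approximate pointwise with a square-integrable bound.
\<close>

theorem trig_dense:
  assumes g: "g \<in> L2"
  shows "trig_approx g"
proof -
  obtain s where s: "\<And>n. simple_function cell (s n)"
    and lim: "\<And>x. x \<in> Omega \<Longrightarrow> (\<lambda>n. s n x) \<longlonglongrightarrow> g x"
    and bd: "\<And>n x. x \<in> Omega \<Longrightarrow> cmod (s n x) \<le> 2 * cmod (g x)"
    using borel_measurable_implies_sequence_metric[OF L2_measurable[OF g], of 0]
    unfolding space_cell dist_norm diff_0_right by metis
  show ?thesis
  proof (rule trig_approx_dominated[where h = "\<lambda>x. 2 * cmod (g x)", OF trig_approx_simple[OF s] L2_measurable[OF g] lim bd])
    show "integrable cell (\<lambda>x. (2 * cmod (g x))\<^sup>2)"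
      using g by (simp add: L2_def power_mult_distrib)
  qed
qed

section \<open>Folding integrals over the space back to the period cell\<close>

lemma periodic_shift:
  assumes "periodic v"
  shows "v (x + (2 * pi) *\<^sub>R rvec m) = v x"
proof -
  have nat: "v (y + axis i (2 * pi * real n)) = v y" for y i n
  proof (induction n arbitrary: y)
    case (Suc n)
    have "y + axis i (2 * pi * real (Suc n)) = (y + axis i (2 * pi)) + axis i (2 * pi * real n)"
      by (simp add: vec_eq_iff axis_def algebra_simps)
    then show ?case using Suc.IH[of "y + axis i (2 * pi)"] assms unfolding periodic_def by metis
  qed (simp add: axis_def zero_vec_def[symmetric])
  have int: "v (y + axis i (2 * pi * real_of_int n)) = v y" for y i n
  proof (cases "0 \<le> n")
    case True then show ?thesis using nat[of y i "nat n"] by simp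
  next
    case False
    have cancel: "(y + axis i (2 * pi * real_of_int n)) + axis i (2 * pi * real (nat (- n))) = y"
      using False by (simp add: vec_eq_iff axis_def algebra_simps)
    show ?thesis using nat[of "y + axis i (2 * pi * real_of_int n)" i "nat (- n)"] unfolding cancel by simp
  qed
  have "v (x + (\<Sum>i\<in>F. axis i (2 * pi * real_of_int (m $ i)))) = v x" if "finite F" for F
    using that
  proof (induction F)
    case (insert i F)
    have "v (x + (\<Sum>i\<in>insert i F. axis i (2 * pi * real_of_int (m $ i))))
        = v ((x + (\<Sum>i\<in>F. axis i (2 * pi * real_of_int (m $ i)))) + axis i (2 * pi * real_of_int (m $ i)))"
      using insert by (simp add: algebra_simps)
    then show ?case using insert by (simp only: int)
  qed simp
  from this[of UNIV] show ?thesis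
  proof -
    have "(\<Sum>i\<in>UNIV. axis i (2 * pi * real_of_int (m $ i))) = (2 * pi) *\<^sub>R rvec m"
      by (simp add: vec_eq_iff axis_def rvec_def sum.delta if_distrib cong: if_cong)
    then show ?thesis using \<open>finite UNIV \<Longrightarrow> _\<close> by simp
  qed
qed

text \<open>
  The index of the half-open translate of the cell that contains a point.
\<close>

definition tile :: "real^'d::finite \<Rightarrow> 'd idx" where
  "tile x = (\<chi> i. \<lfloor>x $ i / (2 * pi)\<rfloor>)"

lemma tile_shift: "tile (x + (2 * pi) *\<^sub>R rvec m) = tile x + m"
  by (simp add: tile_def rvec_def vec_eq_iff add_divide_distrib)

lemma tile_measurable: "{x. tile x = m} \<in> sets borel"
proof -
  have "(\<lambda>x::real^'d. \<lfloor>x $ i / (2 * pi)\<rfloor>) \<in> measurable borel (count_space UNIV)" for i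
    by (rule measurable_compose[OF _ measurable_real_floor])
      (intro borel_measurable_continuous_onI continuous_intros, simp)
  note [measurable] = this
  have "{x \<in> space borel. \<forall>i. \<lfloor>x $ i / (2 * pi)\<rfloor> = m $ i} \<in> sets borel" by measurable
  then show ?thesis by (simp add: tile_def vec_eq_iff)
qed

lemma AE_tile: "AE x in lborel. tile x = 0 \<longleftrightarrow> x \<in> (Omega :: (real^'d::finite) set)"
proof (rule AE_I[where N = "cbox 0 (\<chi> i. 2 * pi) - Omega"])
  have floor0: "\<lfloor>t / (2 * pi)\<rfloor> = 0 \<longleftrightarrow> 0 \<le> t \<and> t < 2 * pi" for t
    by (simp add: floor_eq_iff field_simps)
  show "{x \<in> space lborel. \<not> (tile x = 0 \<longleftrightarrow> x \<in> (Omega :: (real^'d) set))} \<subseteq> cbox 0 (\<chi> i. 2 * pi) - Omega"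
  proof
    fix x :: "real^'d" assume x: "x \<in> {x \<in> space lborel. \<not> (tile x = 0 \<longleftrightarrow> x \<in> Omega)}"
    have "x \<in> Omega \<Longrightarrow> tile x = 0" by (simp add: tile_def vec_eq_iff floor0 mem_Omega less_imp_le)
    then have "tile x = 0" "x \<notin> Omega" using x by auto
    then show "x \<in> cbox 0 (\<chi> i. 2 * pi) - Omega"
      by (simp add: tile_def vec_eq_iff floor0 mem_box_cart less_imp_le)
  qed
  have sub: "Omega \<subseteq> cbox 0 ((\<chi> i. 2 * pi) :: real^'d)" unfolding Omega_def by (rule box_subset_cbox)
  have "emeasure lborel (Omega :: (real^'d) set) = emeasure lborel (cbox 0 (\<chi> i. 2 * pi) :: (real^'d) set)"
    unfolding Omega_def by (simp add: emeasure_lborel_box_eq emeasure_lborel_cbox_eq)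
  moreover have "emeasure lborel (Omega :: (real^'d) set) \<noteq> \<infinity>"
    unfolding Omega_def by (rule less_imp_neq) (rule emeasure_lborel_box_finite)
  ultimately show "emeasure lborel (cbox 0 (\<chi> i. 2 * pi) - Omega :: (real^'d) set) = 0"
    using sub by (subst emeasure_Diff) auto
qed simp

text \<open>
  A translation moves the tile to the tile of index 0, where periodicity removes the shift from \<open>v\<close>;
  that tile differs from the open cell by a null set.
\<close>

lemma integral_tile:
  fixes v w :: "'d::finite fn"
  assumes per: "periodic v" and v: "v \<in> borel_measurable borel" and int: "integrable cell v"
    and w: "w \<in> borel_measurable borel" and bd: "\<And>x. cmod (w x) \<le> C"
  shows "integrable lborel (\<lambda>x. indicator {x. tile x = m} x *\<^sub>R (v x * w x))" (is "integrable _ ?h")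
    and "(\<integral>x. indicator {x. tile x = m} x *\<^sub>R (v x * w x) \<partial>lborel)
          = (\<integral>x. v x * w (x + (2 * pi) *\<^sub>R rvec m) \<partial>cell)"
    and "integrable cell (\<lambda>x. v x * w (x + (2 * pi) *\<^sub>R rvec m))"
proof -
  let ?p = "(2 * pi) *\<^sub>R rvec m :: real^'d"
  let ?k = "\<lambda>x. indicator Omega x *\<^sub>R (v x * w (x + ?p))"
  have w': "(\<lambda>x. w (x + ?p)) \<in> borel_measurable borel"
    by (rule measurable_compose[OF _ w]) simp
  show int_cell: "integrable cell (\<lambda>x. v x * w (x + ?p))"
  proof (rule Bochner_Integration.integrable_bound)
    show "integrable cell (\<lambda>x. C * cmod (v x))" using int by simp
    show "(\<lambda>x. v x * w (x + ?p)) \<in> borel_measurable cell"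
      using v w' by (intro borel_measurable_cell borel_measurable_times)
    have "0 \<le> C" using bd[of 0] norm_ge_zero[of "w 0"] by linarith
    then have "cmod (v x) * cmod (w (x + ?p)) \<le> \<bar>C * cmod (v x)\<bar>" for x
      using mult_left_mono[OF bd[of "x + ?p"], of "cmod (v x)"] by (simp add: abs_mult mult.commute)
    then show "AE x in cell. norm (v x * w (x + ?p)) \<le> norm (C * cmod (v x))"
      by (simp add: norm_mult)
  qed
  then have int_k: "integrable lborel ?k"
    using integrable_cell[of "\<lambda>x. v x * w (x + ?p)"] by (simp add: set_integrable_def)
  have meas_h: "?h \<in> borel_measurable borel"
    using v w by (intro borel_measurable_scaleR borel_measurable_indicator tile_measurable borel_measurable_times)
  have meas_k: "?k \<in> borel_measurable borel"
    using v w' by (intro borel_measurable_scaleR borel_measurable_indicator Omega_sets borel_measurable_times)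
  have hp: "?h (?p + x) = indicator {x. tile x = 0} x *\<^sub>R (v x * w (x + ?p))" for x
    using tile_shift[of x m] periodic_shift[OF per, of x m] by (simp add: add.commute indicator_def)
  have AE: "AE x in lborel. ?h (?p + x) = ?k x"
    unfolding hp using AE_tile by eventually_elim (simp add: indicator_def)
  have meas_hp: "(\<lambda>x. ?h (?p + x)) \<in> borel_measurable borel"
    by (rule measurable_compose[OF _ meas_h]) simp
  have "integrable lborel (\<lambda>x. ?h (?p + x))"
    using int_k integrable_cong_AE[OF _ _ AE] meas_hp meas_k by simp
  then have "integrable (distr lborel borel ((+) ?p)) ?h"
    by (subst integrable_distr_eq) (use meas_h in auto)
  then show "integrable lborel ?h" by (simp add: lborel_distr_plus)
  have "(\<integral>x. ?h x \<partial>lborel) = (\<integral>x. ?h x \<partial>(distr lborel borel ((+) ?p)))"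
    by (simp add: lborel_distr_plus)
  also have "\<dots> = (\<integral>x. ?h (?p + x) \<partial>lborel)"
    by (rule integral_distr) (use meas_h in auto)
  also have "\<dots> = (\<integral>x. ?k x \<partial>lborel)"
    by (rule integral_cong_AE) (use AE meas_hp meas_k in auto)
  also have "\<dots> = (\<integral>x. v x * w (x + ?p) \<partial>cell)"
    using integral_cell[of "\<lambda>x. v x * w (x + ?p)"] by (simp add: set_lebesgue_integral_def)
  finally show "(\<integral>x. ?h x \<partial>lborel) = (\<integral>x. v x * w (x + ?p) \<partial>cell)" .
qed

text \<open>
  Only finitely many tiles meet the support of \<open>w\<close>, so the integral is the finite sum of the integrals
  over these tiles.
\<close>

lemma integral_unfold:
  fixes v w :: "'d::finite fn"
  assumes per: "periodic v" and v: "v \<in> borel_measurable borel" and int: "integrable cell v"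
    and w: "w \<in> borel_measurable borel" and bd: "\<And>x. cmod (w x) \<le> C"
    and fin: "finite I" and supp: "\<And>x. w x \<noteq> 0 \<Longrightarrow> tile x \<in> I"
  shows "integrable lborel (\<lambda>x. v x * w x)"
    and "(\<integral>x. v x * w x \<partial>lborel) = (\<integral>x. v x * (\<Sum>m\<in>I. w (x + (2 * pi) *\<^sub>R rvec m)) \<partial>cell)"
proof -
  note tile = integral_tile[OF per v int w bd]
  have "(\<Sum>m\<in>I. indicator {x. tile x = m} x *\<^sub>R (v x * w x)) = v x * w x" for x
  proof -
    have "(\<Sum>m\<in>I. indicator {x. tile x = m} x *\<^sub>R (v x * w x))
        = (\<Sum>m\<in>I. if tile x = m then v x * w x else 0)"
      by (intro sum.cong) (auto simp: indicator_def)
    also have "\<dots> = (if tile x \<in> I then v x * w x else 0)" using fin by (rule sum.delta')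
    also have "\<dots> = v x * w x" using supp[of x] by auto
    finally show ?thesis .
  qed
  then have split: "(\<lambda>x. v x * w x) = (\<lambda>x. \<Sum>m\<in>I. indicator {x. tile x = m} x *\<^sub>R (v x * w x))"
    by (intro ext) (rule sym)
  show "integrable lborel (\<lambda>x. v x * w x)"
    unfolding split by (intro Bochner_Integration.integrable_sum tile(1))
  show "(\<integral>x. v x * w x \<partial>lborel) = (\<integral>x. v x * (\<Sum>m\<in>I. w (x + (2 * pi) *\<^sub>R rvec m)) \<partial>cell)"
    unfolding split sum_distrib_left
    by (simp only: Bochner_Integration.integral_sum[OF tile(1)] tile(2) Bochner_Integration.integral_sum[OF tile(3)])
qed

lemma finite_idx_box: "finite A \<Longrightarrow> finite {m :: 'd::finite idx. \<forall>i. m $ i \<in> A}"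
proof -
  assume "finite A"
  then have "finite (Pi\<^sub>E (UNIV :: 'd set) (\<lambda>_. A))" by (intro finite_PiE) auto
  moreover have "vec_nth ` {m :: 'd idx. \<forall>i. m $ i \<in> A} \<subseteq> Pi\<^sub>E (UNIV :: 'd set) (\<lambda>_. A)" by auto
  ultimately have "finite (vec_nth ` {m :: 'd idx. \<forall>i. m $ i \<in> A})" by (rule finite_subset[rotated])
  then show ?thesis by (rule finite_imageD) (simp add: inj_on_def vec_nth_inject)
qed

lemma finite_tiles:
  assumes "bounded S" shows "finite (tile ` (S :: (real^'d::finite) set))"
proof -
  obtain R where R: "\<And>x. x \<in> S \<Longrightarrow> norm x \<le> R" using assms unfolding bounded_iff by blast
  have "tile x $ i \<in> {\<lfloor>- R / (2 * pi)\<rfloor>..\<lfloor>R / (2 * pi)\<rfloor>}" if "x \<in> S" for x i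
  proof -
    have "- R \<le> x $ i" "x $ i \<le> R"
      using component_le_norm_cart[of x i] R[OF that] by auto
    then have "- R / (2 * pi) \<le> x $ i / (2 * pi)" "x $ i / (2 * pi) \<le> R / (2 * pi)"
      by (intro divide_right_mono; simp)+
    then show ?thesis unfolding tile_def by (simp add: floor_mono)
  qed
  then have "tile ` S \<subseteq> {m. \<forall>i. m $ i \<in> {\<lfloor>- R / (2 * pi)\<rfloor>..\<lfloor>R / (2 * pi)\<rfloor>}}" by auto
  then show ?thesis using finite_idx_box by (rule finite_subset) simp
qed

section \<open>Fourier coefficients of weak derivatives\<close>

definition clamp2pi :: "real \<Rightarrow> real" where
  "clamp2pi t = max (- (2 * pi)) (min (2 * pi) t)"

text \<open>
  A cutoff of class \<open>C\<^sup>1\<close> supported in \<open>{- 2 * pi .. 2 * pi}\<close> whose translates by \<open>2 * pi\<close> sum to 1,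
  because \<open>(1 + cos s) / 2 + (1 - cos s) / 2 = 1\<close>.  With the clamped argument no case distinction is
  needed, and continuity of the derivative is evident.
\<close>

definition hat :: "real \<Rightarrow> real" where
  "hat t = (1 + cos (clamp2pi t / 2)) / 2"

definition hat' :: "real \<Rightarrow> real" where
  "hat' t = - (sin (clamp2pi t / 2) / 4)"

lemma hat_if: "hat t = (if t \<in> {- (2 * pi)..2 * pi} then (1 + cos (t / 2)) / 2 else 0)"
  by (auto simp: hat_def clamp2pi_def max_def min_def)

lemma hat'_if: "hat' t = (if t \<in> {- (2 * pi)..2 * pi} then - (sin (t / 2) / 4) else 0)"
  by (auto simp: hat'_def clamp2pi_def max_def min_def)

lemma hat_has_derivative: "(hat has_vector_derivative hat' t) (at t)"
proof -
  let ?S = "{- (2 * pi)..2 * pi}"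
  have edge: "t = 2 * pi \<or> t = - (2 * pi)" if "t \<in> closure ?S" "t \<in> closure (- ?S)" for t
    using that by (auto simp: closure_complement interior_atLeastAtMost_real)
  have "((\<lambda>t. if t \<in> ?S then (1 + cos (t / 2)) / 2 else 0) has_vector_derivative
      (if t \<in> ?S then - (sin (t / 2) / 4) else 0)) (at t within UNIV)"
  proof (rule has_vector_derivative_If_within_closures[where T = "- ?S"])
    show "((\<lambda>t. (1 + cos (t / 2)) / 2) has_vector_derivative - (sin (t / 2) / 4))
        (at t within ?S \<union> (closure ?S \<inter> closure (- ?S)))"
      by (rule has_vector_derivative_at_within)
         (auto intro!: derivative_eq_intros simp: has_real_derivative_iff_has_vector_derivative[symmetric])
    show "(1 + cos (t / 2)) / 2 = 0" "- (sin (t / 2) / 4) = 0" if "t \<in> closure ?S" "t \<in> closure (- ?S)"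
      using edge[OF that] by auto
  qed auto
  then show ?thesis unfolding hat_if hat'_if .
qed

lemma continuous_hat: "continuous_on UNIV hat" "continuous_on UNIV hat'"
  unfolding hat_def hat'_def clamp2pi_def by (intro continuous_intros; simp)+

lemma hat_support: "hat t \<noteq> 0 \<or> hat' t \<noteq> 0 \<Longrightarrow> - (2 * pi) < t \<and> t < 2 * pi"
proof -
  assume *: "hat t \<noteq> 0 \<or> hat' t \<noteq> 0"
  have "t \<noteq> 2 * pi \<and> t \<noteq> - (2 * pi)" using * by (auto simp: hat_if hat'_if)
  then show ?thesis using * by (auto simp: hat_if hat'_if split: if_splits)
qed

lemma hat_bounded: "\<bar>hat t\<bar> \<le> 1" "\<bar>hat' t\<bar> \<le> 1"
proof -
  show "\<bar>hat t\<bar> \<le> 1"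
  proof -
    have bounds: "0 \<le> 1 + c \<and> 1 + c \<le> 2" if "c \<le> 1" "- 1 \<le> c" for c :: real
      using that by simp
    have "0 \<le> 1 + cos (clamp2pi t / 2) \<and> 1 + cos (clamp2pi t / 2) \<le> 2"
      by (rule bounds[OF cos_le_one cos_ge_minus_one])
    then show ?thesis by (simp add: hat_def)
  qed
  show "\<bar>hat' t\<bar> \<le> 1"
    by (simp add: hat'_def order_trans[OF abs_sin_le_one])
qed

lemma hat_partition:
  assumes "0 < t" "t < 2 * pi"
  shows "hat t + hat (t - 2 * pi) = 1" "hat' t + hat' (t - 2 * pi) = 0"
proof -
  have half: "(t - 2 * pi) / 2 = t / 2 - pi" by simp
  have "cos (t / 2 - pi) = - cos (t / 2)" "sin (t / 2 - pi) = - sin (t / 2)"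
    by (simp_all add: cos_diff sin_diff)
  then show "hat t + hat (t - 2 * pi) = 1" "hat' t + hat' (t - 2 * pi) = 0"
    using assms unfolding hat_if hat'_if half by (simp_all add: field_simps)
qed

text \<open>
  The one-dimensional factors of the conjugates of the characters.
\<close>

definition wave :: "int \<Rightarrow> real \<Rightarrow> complex" where
  "wave n t = exp (- (\<i> * of_int n * of_real t))"

lemma wave_has_derivative: "(wave n has_vector_derivative - (\<i> * of_int n) * wave n t) (at t)"
proof -
  have "((\<lambda>z. exp (- (\<i> * of_int n * z))) has_field_derivative - (\<i> * of_int n) * wave n t) (at (of_real t))"
    by (auto intro!: derivative_eq_intros simp: wave_def)
  from has_vector_derivative_real_field[OF this] show ?thesis
    by (simp add: wave_def[abs_def])
qed

lemma continuous_wave: "continuous_on UNIV (wave n)"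
  unfolding wave_def by (intro continuous_intros)

lemma norm_wave: "cmod (wave n t) = 1"
  by (simp add: wave_def)

lemma wave_shift: "wave n (t - 2 * pi) = wave n t"
proof -
  have "wave n (t - 2 * pi) = wave n t * exp (\<i> * (of_int n * (of_real pi * 2)))"
    unfolding wave_def exp_add[symmetric] by (simp add: algebra_simps)
  also have "exp (\<i> * (of_int n * (of_real pi * 2))) = 1"
    using exp_integer_2pi[of "of_int n"] by (simp add: mult_ac)
  finally show ?thesis by simp
qed

definition bump :: "int \<Rightarrow> real \<Rightarrow> complex" where
  "bump n t = of_real (hat t) * wave n t"

definition bump' :: "int \<Rightarrow> real \<Rightarrow> complex" where
  "bump' n t = (of_real (hat' t) - \<i> * of_int n * of_real (hat t)) * wave n t"

lemma bump_has_derivative: "(bump n has_vector_derivative bump' n t) (at t)"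
proof -
  have "((\<lambda>t. complex_of_real (hat t)) has_vector_derivative of_real (hat' t)) (at t)"
    using has_vector_derivative_of_real[OF hat_has_derivative[of t, folded has_real_derivative_iff_has_vector_derivative]] .
  from has_vector_derivative_mult[OF this wave_has_derivative[of n t]]
  show ?thesis by (simp add: bump_def[abs_def] bump'_def algebra_simps)
qed

lemma continuous_bump: "continuous_on UNIV (bump n)" "continuous_on UNIV (bump' n)"
  unfolding bump_def bump'_def
  by (intro continuous_intros continuous_hat continuous_wave)+

lemma bump_bounded: "cmod (bump n t) \<le> 1 + \<bar>of_int n\<bar>" "cmod (bump' n t) \<le> 1 + \<bar>of_int n\<bar>"
proof -
  show "cmod (bump n t) \<le> 1 + \<bar>of_int n\<bar>"
    using hat_bounded(1)[of t] by (simp add: bump_def norm_mult norm_wave)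
  have "cmod (of_real (hat' t) - \<i> * of_int n * of_real (hat t)) \<le> \<bar>hat' t\<bar> + \<bar>of_int n\<bar> * \<bar>hat t\<bar>"
    by (rule order_trans[OF norm_triangle_ineq4]) (simp add: norm_mult)
  also have "\<dots> \<le> 1 + \<bar>of_int n\<bar> * 1"
    using hat_bounded[of t] by (intro add_mono mult_left_mono) auto
  finally show "cmod (bump' n t) \<le> 1 + \<bar>of_int n\<bar>"
    by (simp add: bump'_def norm_mult norm_wave)
qed

lemma bump_support: "bump n t \<noteq> 0 \<or> bump' n t \<noteq> 0 \<Longrightarrow> - (2 * pi) < t \<and> t < 2 * pi"
  by (rule hat_support) (auto simp: bump_def bump'_def)

text \<open>
  Only two translates of the cutoff are nonzero on the cell.  The derivatives of the cutoff cancel, so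
  that the sum of the translates of \<open>bump'\<close> is the derivative of the exponential alone.
\<close>

lemma bump_partition:
  assumes "0 < t" "t < 2 * pi"
  shows "bump n (t - 2 * pi) + bump n t = wave n t"
    and "bump' n (t - 2 * pi) + bump' n t = - (\<i> * of_int n) * wave n t"
proof -
  have "bump n (t - 2 * pi) + bump n t = of_real (hat t + hat (t - 2 * pi)) * wave n t"
    unfolding bump_def wave_shift by (simp add: algebra_simps)
  then show "bump n (t - 2 * pi) + bump n t = wave n t" by (simp only: hat_partition[OF assms]) simp
  have "bump' n (t - 2 * pi) + bump' n t
      = (of_real (hat' t + hat' (t - 2 * pi)) - \<i> * of_int n * of_real (hat t + hat (t - 2 * pi))) * wave n t"
    unfolding bump'_def wave_shift by (simp add: algebra_simps)
  then show "bump' n (t - 2 * pi) + bump' n t = - (\<i> * of_int n) * wave n t"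
    by (simp only: hat_partition[OF assms]) simp
qed

text \<open>
  The distributive law, with indices written as vectors.
\<close>

lemma sum_prod_idx:
  fixes \<tau> :: "'d::finite \<Rightarrow> int \<Rightarrow> complex"
  assumes "finite A"
  shows "(\<Sum>m\<in>{m :: 'd idx. \<forall>i. m $ i \<in> A}. \<Prod>i\<in>UNIV. \<tau> i (m $ i)) = (\<Prod>i\<in>UNIV. \<Sum>n\<in>A. \<tau> i n)"
proof -
  have "(\<Prod>i\<in>UNIV. \<Sum>n\<in>A. \<tau> i n) = (\<Sum>g\<in>Pi\<^sub>E UNIV (\<lambda>_. A). \<Prod>i\<in>UNIV. \<tau> i (g i))"
    using assms by (intro prod_sum_PiE) auto
  also have "\<dots> = (\<Sum>m\<in>{m :: 'd idx. \<forall>i. m $ i \<in> A}. \<Prod>i\<in>UNIV. \<tau> i (m $ i))"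
    by (rule sum.reindex_bij_witness[where i = vec_nth and j = vec_lambda])
       (auto simp: PiE_def extensional_def)
  finally show ?thesis by simp
qed

text \<open>
  For a tensor product, the sum over the \<open>2 ^ d\<close> relevant tiles factorises into sums of two terms.
\<close>

lemma integral_unfold_tensor:
  fixes v :: "'d::finite fn" and \<tau> :: "'d \<Rightarrow> real \<Rightarrow> complex"
  assumes per: "periodic v" and v: "v \<in> borel_measurable borel" and int: "integrable cell v"
    and cont: "\<And>j. continuous_on UNIV (\<tau> j)" and bd: "\<And>j t. cmod (\<tau> j t) \<le> C j"
    and supp: "\<And>j t. \<tau> j t \<noteq> 0 \<Longrightarrow> - (2 * pi) < t \<and> t < 2 * pi"
  shows "(\<integral>x. v x * (\<Prod>j\<in>UNIV. \<tau> j (x $ j)) \<partial>lborel)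
       = (\<integral>x. v x * (\<Prod>j\<in>UNIV. \<tau> j (x $ j - 2 * pi) + \<tau> j (x $ j)) \<partial>cell)"
proof -
  let ?w = "\<lambda>x. \<Prod>j\<in>UNIV. \<tau> j (x $ j)"
  let ?I = "{m :: 'd idx. \<forall>i. m $ i \<in> {-1, 0}}"
  have "continuous_on UNIV ?w"
    by (intro continuous_on_prod continuous_on_compose2[OF cont] continuous_intros) auto
  then have w: "?w \<in> borel_measurable borel" by (rule borel_measurable_continuous_onI)
  have bd_w: "cmod (?w x) \<le> (\<Prod>j\<in>UNIV. C j)" for x
    unfolding prod_norm[symmetric] by (intro prod_mono) (simp add: bd)
  have supp_w: "tile x \<in> ?I" if "?w x \<noteq> 0" for x
  proof -
    have "\<lfloor>x $ i / (2 * pi)\<rfloor> \<in> {-1, 0}" for i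
    proof -
      have "\<tau> i (x $ i) \<noteq> 0" using that by auto
      then have "- 1 < x $ i / (2 * pi)" "x $ i / (2 * pi) < 1" using supp[of i "x $ i"]
        by (simp_all add: field_simps)
      then show ?thesis by (simp add: floor_eq_iff) linarith
    qed
    then show ?thesis by (simp add: tile_def)
  qed
  have "(\<Sum>m\<in>?I. ?w (x + (2 * pi) *\<^sub>R rvec m)) = (\<Prod>j\<in>UNIV. \<tau> j (x $ j - 2 * pi) + \<tau> j (x $ j))" for x
  proof -
    have "(\<Sum>m\<in>?I. ?w (x + (2 * pi) *\<^sub>R rvec m))
        = (\<Prod>j\<in>UNIV. \<Sum>n\<in>{-1, 0}. \<tau> j (x $ j + 2 * pi * of_int n))"
      using sum_prod_idx[of "{-1, 0}" "\<lambda>j n. \<tau> j (x $ j + 2 * pi * of_int n)"] by (simp add: rvec_def)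
    then show ?thesis by simp
  qed
  then show ?thesis
    using integral_unfold(2)[OF per v int w bd_w finite_idx_box supp_w] by simp
qed

lemma L2p_iff: "v \<in> L2p \<longleftrightarrow> periodic v \<and> v \<in> borel_measurable borel \<and> v \<in> L2"
  by (auto simp: L2p_def L2_def integrable_cell borel_measurable_cell)

lemma L2_integrable: "v \<in> L2 \<Longrightarrow> integrable cell v"
  using L2_mult_integrable[of v "\<lambda>_. 1"] L2_bounded[of "\<lambda>_. 1" 1] by simp

lemma cnj_phi: "cnj (phi k (x :: real^'d::finite))
    = complex_of_real ((2 * pi) powr (- (real CARD('d) / 2))) * (\<Prod>j\<in>UNIV. wave (k $ j) (x $ j))"
proof -
  have "(\<Prod>j\<in>UNIV. wave (k $ j) (x $ j)) = exp (- (\<i> * of_real (rvec k \<bullet> x)))"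
    by (simp add: wave_def exp_sum[symmetric] inner_vec_def rvec_def sum_negf sum_distrib_left mult_ac)
  moreover have "cnj (exp (\<i> * of_real (rvec k \<bullet> x))) = exp (- (\<i> * of_real (rvec k \<bullet> x)))"
    unfolding exp_cnj by simp
  ultimately show ?thesis by (simp add: phi_def)
qed

text \<open>
  The admissible test function that replaces the \<open>k\<close>-th exponential.
\<close>

lemma bump_tensor:
  fixes k :: "'d::finite idx"
  defines "\<psi> \<equiv> \<lambda>x :: real^'d. \<Prod>j\<in>UNIV. bump (k $ j) (x $ j)"
  shows "C1 \<psi>" and "bounded {x. \<psi> x \<noteq> 0}"
    and "partial_deriv i \<psi> x = (\<Prod>j\<in>UNIV. (if j = i then bump' else bump) (k $ j) (x $ j))"
proof -
  have factor: "((\<lambda>x. bump (k $ j) (x $ j)) has_derivative (\<lambda>y. y $ j *\<^sub>R bump' (k $ j) (x $ j))) (at x)" for j x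
    using has_derivative_compose[OF bounded_linear.has_derivative[OF bounded_linear_vec_nth has_derivative_ident]
        bump_has_derivative[unfolded has_vector_derivative_def]] by blast
  have deriv: "(\<psi> has_derivative (\<lambda>y. \<Sum>l\<in>UNIV. (y $ l *\<^sub>R bump' (k $ l) (x $ l)) *
      (\<Prod>j\<in>UNIV - {l}. bump (k $ j) (x $ j)))) (at x)" for x
    unfolding \<psi>_def by (rule has_derivative_prod) (rule factor)
  show partial: "partial_deriv i \<psi> x = (\<Prod>j\<in>UNIV. (if j = i then bump' else bump) (k $ j) (x $ j))" for i x
  proof -
    have "partial_deriv i \<psi> x = (\<Sum>l\<in>UNIV. (axis i 1 $ l *\<^sub>R bump' (k $ l) (x $ l)) *
        (\<Prod>j\<in>UNIV - {l}. bump (k $ j) (x $ j)))"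
      unfolding partial_deriv_def frechet_derivative_at[OF deriv, symmetric] ..
    also have "\<dots> = (\<Sum>l\<in>UNIV. if l = i then bump' (k $ l) (x $ l) * (\<Prod>j\<in>UNIV - {l}. bump (k $ j) (x $ j)) else 0)"
      by (intro sum.cong) (auto simp: axis_def)
    also have "\<dots> = bump' (k $ i) (x $ i) * (\<Prod>j\<in>UNIV - {i}. bump (k $ j) (x $ j))"
      by simp
    also have "\<dots> = (\<Prod>j\<in>UNIV. (if j = i then bump' else bump) (k $ j) (x $ j))"
      by (subst prod.remove[of UNIV i]) (auto intro!: prod.cong)
    finally show ?thesis .
  qed
  have "continuous_on UNIV (partial_deriv i \<psi>)" for i
  proof -
    have "continuous_on UNIV (\<lambda>x :: real^'d. (if j = i then bump' else bump) (k $ j) (x $ j))" for j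
      by (cases "j = i")
        (auto intro!: continuous_on_compose2[OF continuous_bump(1)] continuous_on_compose2[OF continuous_bump(2)]
          continuous_intros)
    then show ?thesis unfolding partial[abs_def] by (rule continuous_on_prod)
  qed
  then show "C1 \<psi>" unfolding C1_def differentiable_def using deriv by blast
  have "{x. \<psi> x \<noteq> 0} \<subseteq> cbox (\<chi> i. - (2 * pi)) (\<chi> i. 2 * pi)"
  proof
    fix x assume "x \<in> {x. \<psi> x \<noteq> 0}"
    then have "bump (k $ j) (x $ j) \<noteq> 0" for j by (auto simp: \<psi>_def)
    then have "- (2 * pi) < x $ j \<and> x $ j < 2 * pi" for j using bump_support by blast
    then show "x \<in> cbox (\<chi> i. - (2 * pi)) (\<chi> i. 2 * pi)" by (simp add: mem_box_cart less_imp_le)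
  qed
  then show "bounded {x. \<psi> x \<noteq> 0}" by (rule bounded_subset[OF bounded_cbox])
qed

text \<open>
  Testing the weak derivative with the cut-off exponential and folding back to the cell removes the
  cutoff on both sides, and leaves the integration by parts for the exponential itself.
\<close>

theorem fcoef_weak_partial:
  assumes v: "v \<in> L2p" and g: "weak_partial i v g"
  shows "fcoef g k = \<i> * of_int (k $ i) * fcoef v k"
proof -
  let ?\<psi> = "\<lambda>x. \<Prod>j\<in>UNIV. bump (k $ j) (x $ j)"
  have gL: "g \<in> L2p" using g by (simp add: weak_partial_def)
  note v' = v[unfolded L2p_iff] and g' = gL[unfolded L2p_iff]
  have "(\<integral>x. v x * partial_deriv i ?\<psi> x \<partial>lborel) = - (\<integral>x. g x * ?\<psi> x \<partial>lborel)"
    using g bump_tensor(1,2)[of k] unfolding weak_partial_def by blast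
  moreover have "(\<integral>x. g x * ?\<psi> x \<partial>lborel) = (\<integral>x. g x * (\<Prod>j\<in>UNIV. wave (k $ j) (x $ j)) \<partial>cell)"
  proof -
    have "(\<integral>x. g x * ?\<psi> x \<partial>lborel)
        = (\<integral>x. g x * (\<Prod>j\<in>UNIV. bump (k $ j) (x $ j - 2 * pi) + bump (k $ j) (x $ j)) \<partial>cell)"
    proof (rule integral_unfold_tensor[where C = "\<lambda>j. 1 + \<bar>of_int (k $ j)\<bar>"])
      show "- (2 * pi) < t \<and> t < 2 * pi" if "bump (k $ j) t \<noteq> 0" for j t
        using that bump_support[of "k $ j" t] by blast
    qed (use g' in \<open>auto simp: L2_integrable continuous_bump bump_bounded\<close>)
    also have "\<dots> = (\<integral>x. g x * (\<Prod>j\<in>UNIV. wave (k $ j) (x $ j)) \<partial>cell)"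
      by (intro Bochner_Integration.integral_cong) (auto simp: space_cell mem_Omega bump_partition)
    finally show ?thesis .
  qed
  moreover have "(\<integral>x. v x * partial_deriv i ?\<psi> x \<partial>lborel)
      = - (\<i> * of_int (k $ i)) * (\<integral>x. v x * (\<Prod>j\<in>UNIV. wave (k $ j) (x $ j)) \<partial>cell)"
  proof -
    let ?\<tau> = "\<lambda>j. (if j = i then bump' else bump) (k $ j)"
    have "(\<integral>x. v x * partial_deriv i ?\<psi> x \<partial>lborel) = (\<integral>x. v x * (\<Prod>j\<in>UNIV. ?\<tau> j (x $ j)) \<partial>lborel)"
      by (simp only: bump_tensor(3))
    also have "\<dots> = (\<integral>x. v x * (\<Prod>j\<in>UNIV. ?\<tau> j (x $ j - 2 * pi) + ?\<tau> j (x $ j)) \<partial>cell)"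
    proof (rule integral_unfold_tensor[where C = "\<lambda>j. 1 + \<bar>of_int (k $ j)\<bar>"])
      show "- (2 * pi) < t \<and> t < 2 * pi" if "?\<tau> j t \<noteq> 0" for j t
        using that bump_support[of "k $ j" t] by (auto split: if_splits)
    qed (use v' in \<open>auto simp: L2_integrable continuous_bump bump_bounded\<close>)
    also have "\<dots> = (\<integral>x. - (\<i> * of_int (k $ i)) * (v x * (\<Prod>j\<in>UNIV. wave (k $ j) (x $ j))) \<partial>cell)"
    proof (intro Bochner_Integration.integral_cong refl)
      fix x :: "real^'a" assume "x \<in> space cell"
      then have x: "0 < x $ j" "x $ j < 2 * pi" for j by (auto simp: space_cell mem_Omega)
      have "(\<Prod>j\<in>UNIV. ?\<tau> j (x $ j - 2 * pi) + ?\<tau> j (x $ j))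
          = (\<Prod>j\<in>UNIV. (if j = i then - (\<i> * of_int (k $ i)) else 1) * wave (k $ j) (x $ j))"
        by (intro prod.cong) (auto simp: bump_partition[OF x])
      also have "\<dots> = - (\<i> * of_int (k $ i)) * (\<Prod>j\<in>UNIV. wave (k $ j) (x $ j))"
        unfolding prod.distrib by simp
      finally show "v x * (\<Prod>j\<in>UNIV. ?\<tau> j (x $ j - 2 * pi) + ?\<tau> j (x $ j))
          = - (\<i> * of_int (k $ i)) * (v x * (\<Prod>j\<in>UNIV. wave (k $ j) (x $ j)))"
        by simp
    qed
    also have "\<dots> = - (\<i> * of_int (k $ i)) * (\<integral>x. v x * (\<Prod>j\<in>UNIV. wave (k $ j) (x $ j)) \<partial>cell)"
      by (rule integral_mult_right_zero)
    finally show ?thesis .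
  qed
  ultimately have *: "(\<integral>x. g x * (\<Prod>j\<in>UNIV. wave (k $ j) (x $ j)) \<partial>cell)
      = \<i> * of_int (k $ i) * (\<integral>x. v x * (\<Prod>j\<in>UNIV. wave (k $ j) (x $ j)) \<partial>cell)"
    by simp
  have fc: "fcoef w k = complex_of_real ((2 * pi) powr (- (real CARD('a) / 2))) *
      (\<integral>x. w x * (\<Prod>j\<in>UNIV. wave (k $ j) (x $ j)) \<partial>cell)" for w :: "'a fn"
    unfolding fcoef_ip ip_def cnj_phi mult.left_commute[of "w _"] by (rule integral_mult_right_zero)
  show ?thesis unfolding fc * by (simp add: mult_ac)
qed

section \<open>Test functions and the space \<open>H\<^sup>1\<close>\<close>

lemma integral_shift:
  fixes h :: "'d::finite fn"
  assumes h: "h \<in> borel_measurable borel"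
  shows "(\<integral>x. h (x + a) \<partial>lborel) = (\<integral>x. h x \<partial>lborel)"
proof -
  have "(\<integral>x. h x \<partial>lborel) = (\<integral>x. h x \<partial>distr lborel borel ((+) a))"
    by (simp add: lborel_distr_plus)
  also have "\<dots> = (\<integral>x. h (a + x) \<partial>lborel)"
    by (rule integral_distr) (use h in auto)
  finally show ?thesis by (simp add: add.commute)
qed

lemma continuous_bounded_support:
  fixes h :: "'d::finite fn"
  assumes cont: "continuous_on UNIV h" and supp: "bounded {x. h x \<noteq> 0}"
  shows "integrable lborel h" and "\<exists>C. \<forall>x. cmod (h x) \<le> C"
proof -
  let ?K = "closure {x. h x \<noteq> 0}"
  have K: "compact ?K" using supp by (simp add: compact_closure)
  have eq: "indicator ?K x *\<^sub>R h x = h x" for x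
    using closure_subset[of "{x. h x \<noteq> 0}"] by (auto simp: indicator_def)
  show "integrable lborel h"
    using borel_integrable_compact[OF K continuous_on_subset[OF cont]] by (simp add: eq)
  have "bounded (h ` ?K)"
    by (intro compact_imp_bounded compact_continuous_image K continuous_on_subset[OF cont]) simp
  then obtain C where C: "\<And>x. x \<in> ?K \<Longrightarrow> cmod (h x) \<le> C" unfolding bounded_iff by blast
  have "cmod (h x) \<le> \<bar>C\<bar>" for x
  proof (cases "h x = 0")
    case False
    then have "x \<in> ?K" using closure_subset[of "{x. h x \<noteq> 0}"] by auto
    then show ?thesis using C[of x] by simp
  qed simp
  then show "\<exists>C. \<forall>x. cmod (h x) \<le> C" by blast
qed

lemma C1_continuous: "C1 h \<Longrightarrow> continuous_on UNIV h"
  by (simp add: C1_def continuous_on_eq_continuous_at differentiable_imp_continuous_within)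

lemma C1_partial_support:
  fixes h :: "'d::finite fn"
  assumes "bounded {x. h x \<noteq> 0}"
  shows "bounded {x. partial_deriv i h x \<noteq> 0}"
proof (rule bounded_subset[OF bounded_closure[OF assms]])
  show "{x. partial_deriv i h x \<noteq> 0} \<subseteq> closure {x. h x \<noteq> 0}"
  proof
    fix x assume x: "x \<in> {x. partial_deriv i h x \<noteq> 0}"
    show "x \<in> closure {x. h x \<noteq> 0}"
    proof (rule ccontr)
      assume "x \<notin> closure {x. h x \<noteq> 0}"
      then have x': "x \<in> - closure {x. h x \<noteq> 0}" by simp
      have zero: "0 = h y" if "y \<in> - closure {x. h x \<noteq> 0}" for y
        using that closure_subset[of "{x. h x \<noteq> 0}"] by auto
      have "(h has_derivative (\<lambda>_. 0)) (at x)"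
        by (rule has_derivative_transform_within_open[OF has_derivative_const _ x' zero]) auto
      then have "partial_deriv i h x = 0"
        unfolding partial_deriv_def by (simp add: frechet_derivative_at[symmetric])
      then show False using x by simp
    qed
  qed
qed

text \<open>
  By translation invariance, every difference quotient of \<open>h\<close> has integral 0.  The quotients converge
  to the partial derivative, dominated by a constant on a ball that contains their supports.
\<close>

lemma integral_partial_deriv:
  fixes h :: "'d::finite fn"
  assumes C1: "C1 h" and supp: "bounded {x. h x \<noteq> 0}"
  shows "(\<integral>x. partial_deriv i h x \<partial>lborel) = 0"
proof -
  let ?D = "partial_deriv i h"
  let ?e = "axis i 1 :: real^'d"
  have contD: "continuous_on UNIV ?D" and cont: "continuous_on UNIV h"
    using C1 C1_continuous by (auto simp: C1_def)
  note h_meas = borel_measurable_continuous_onI[OF cont]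
  obtain C where C: "\<And>x. cmod (?D x) \<le> C"
    using continuous_bounded_support(2)[OF contD C1_partial_support[OF supp]] by blast
  obtain R where R: "\<And>x. h x \<noteq> 0 \<Longrightarrow> norm x \<le> R"
    using supp unfolding bounded_iff by blast
  have line: "((\<lambda>s. h (x + s *\<^sub>R ?e)) has_vector_derivative ?D (x + s *\<^sub>R ?e)) (at s)" for x s
  proof -
    have "(h has_derivative frechet_derivative h (at (x + s *\<^sub>R ?e))) (at (x + s *\<^sub>R ?e))"
      using C1 by (simp add: C1_def frechet_derivative_works)
    moreover have "((\<lambda>s. x + s *\<^sub>R ?e) has_derivative (\<lambda>r. r *\<^sub>R ?e)) (at s)"
      by (auto intro!: derivative_eq_intros)
    ultimately have "((\<lambda>s. h (x + s *\<^sub>R ?e)) has_derivative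
        (\<lambda>r. frechet_derivative h (at (x + s *\<^sub>R ?e)) (r *\<^sub>R ?e))) (at s)"
      using has_derivative_compose by blast
    moreover have "linear (frechet_derivative h (at (x + s *\<^sub>R ?e)))"
      using C1 by (simp add: C1_def linear_frechet_derivative)
    ultimately show ?thesis
      by (simp add: has_vector_derivative_def partial_deriv_def linear_cmul)
  qed
  have lip: "cmod (h (x + s *\<^sub>R ?e) - h x) \<le> C * \<bar>s\<bar>" for x s
  proof -
    have "cmod (h (x + s *\<^sub>R ?e) - h (x + 0 *\<^sub>R ?e)) \<le> C * norm (s - 0)"
    proof (rule differentiable_bound[where S = UNIV])
      show "((\<lambda>s. h (x + s *\<^sub>R ?e)) has_derivative (\<lambda>r. r *\<^sub>R ?D (x + t *\<^sub>R ?e))) (at t within UNIV)" for t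
        using line[of x t] by (simp add: has_vector_derivative_def)
      show "onorm (\<lambda>r. r *\<^sub>R ?D (x + t *\<^sub>R ?e)) \<le> C" for t
        using C[of "x + t *\<^sub>R ?e"] order_trans[OF norm_ge_zero C]
        by (intro onorm_bound) (auto simp: mult.commute[of C] intro!: mult_left_mono)
    qed auto
    then show ?thesis by simp
  qed
  \<comment> \<open>Difference quotients in direction \<open>i\<close> with step \<open>1 / (n + 1)\<close>.\<close>
  define q where "q n x = of_nat (Suc n) * (h (x + (1 / real (Suc n)) *\<^sub>R ?e) - h x)" for n x
  have q_zero: "(\<integral>x. q n x \<partial>lborel) = 0" for n
  proof -
    let ?a = "(1 / real (Suc n)) *\<^sub>R ?e"
    have "integrable lborel (\<lambda>x. h (?a + x))"
    proof -
      have "integrable (distr lborel borel ((+) ?a)) h"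
        using continuous_bounded_support(1)[OF cont supp] by (simp add: lborel_distr_plus)
      then show ?thesis by (subst (asm) integrable_distr_eq) (use h_meas in auto)
    qed
    then have "integrable lborel (\<lambda>x. h (x + ?a))" by (simp add: add.commute)
    then have "(\<integral>x. h (x + ?a) - h x \<partial>lborel) = 0"
      using continuous_bounded_support(1)[OF cont supp] integral_shift[OF h_meas, of ?a]
      by simp
    then show ?thesis unfolding q_def by simp
  qed
  have "(\<lambda>n. \<integral>x. q n x \<partial>lborel) \<longlonglongrightarrow> (\<integral>x. ?D x \<partial>lborel)"
  proof (rule integral_dominated_convergence[where w = "\<lambda>x. C * indicator (cball 0 (R + 1)) x"])
    show "?D \<in> borel_measurable lborel" using borel_measurable_continuous_onI[OF contD] by simp
    show "q n \<in> borel_measurable lborel" for n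
    proof -
      have "continuous_on UNIV (q n)" unfolding q_def
        by (intro continuous_intros continuous_on_compose2[OF cont] cont) auto
      then show ?thesis using borel_measurable_continuous_onI by simp
    qed
    \<comment> \<open>The radius grows by 1 because the steps have length at most 1.\<close>
    show "integrable lborel (\<lambda>x :: real^'d. C * indicator (cball 0 (R + 1)) x)"
      using emeasure_lborel_cball_finite[of "0 :: real^'d" "R + 1"]
      by (intro integrable_mult_right integrable_real_indicator) simp_all
    show "AE x in lborel. (\<lambda>n. q n x) \<longlonglongrightarrow> ?D x"
    proof (intro AE_I2)
      fix x :: "real^'d"
      let ?r = "\<lambda>s. norm (h (x + s *\<^sub>R ?e) - h x - s *\<^sub>R ?D x) / norm s"
      have "(?r \<longlongrightarrow> 0) (at 0)"
        using line[of x 0] unfolding has_vector_derivative_def has_derivative_at by simp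
      moreover have "filterlim (\<lambda>n. 1 / real (Suc n)) (at 0) sequentially"
        using LIMSEQ_inverse_real_of_nat by (simp add: filterlim_at inverse_eq_divide)
      ultimately have lim: "(\<lambda>n. ?r (1 / real (Suc n))) \<longlonglongrightarrow> 0" by (rule filterlim_compose)
      have r: "?r (1 / real (Suc n)) = cmod (q n x - ?D x)" for n
      proof -
        have "q n x - ?D x = of_nat (Suc n) * (h (x + (1 / real (Suc n)) *\<^sub>R ?e) - h x - (1 / real (Suc n)) *\<^sub>R ?D x)"
          unfolding q_def scaleR_conv_of_real right_diff_distrib[of "of_nat (Suc n)" _ "_ * ?D x"]
            mult.assoc[symmetric] by (simp del: of_nat_Suc)
        then have "cmod (q n x - ?D x)
            = real (Suc n) * cmod (h (x + (1 / real (Suc n)) *\<^sub>R ?e) - h x - (1 / real (Suc n)) *\<^sub>R ?D x)"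
          by (simp only: norm_mult norm_of_nat)
        then show ?thesis by simp
      qed
      show "(\<lambda>n. q n x) \<longlonglongrightarrow> ?D x"
        using lim unfolding r by (rule Lim_null[THEN iffD2, OF tendsto_norm_zero_cancel])
    qed
    show "AE x in lborel. norm (q n x) \<le> C * indicator (cball 0 (R + 1)) x" for n
    proof (intro AE_I2)
      fix x :: "real^'d"
      let ?a = "(1 / real (Suc n)) *\<^sub>R ?e"
      show "norm (q n x) \<le> C * indicator (cball 0 (R + 1)) x"
      proof (cases "x \<in> cball 0 (R + 1)")
        case True
        have "norm (q n x) = real (Suc n) * cmod (h (x + ?a) - h x)"
          unfolding q_def norm_mult norm_of_nat ..
        also have "\<dots> \<le> real (Suc n) * (C * \<bar>1 / real (Suc n)\<bar>)"
          by (intro mult_left_mono lip) simp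
        also have "\<dots> = C" by simp
        finally show ?thesis using True by simp
      next
        case False
        have "norm ?a \<le> 1" by (simp add: norm_axis_1)
        moreover have "R + 1 < norm x" using False by simp
        ultimately have "R < norm x" "R < norm (x + ?a)"
          using norm_diff_ineq[of x ?a] by linarith+
        then have "\<not> norm x \<le> R" "\<not> norm (x + ?a) \<le> R" by simp_all
        then have "h x = 0" "h (x + ?a) = 0" using R[of x] R[of "x + ?a"] by argo+
        then show ?thesis using False by (simp add: q_def)
      qed
    qed
  qed
  then show ?thesis using q_zero by (simp add: LIMSEQ_const_iff)
qed

lemma phi_has_derivative: "(phi k has_derivative (\<lambda>y. \<i> * of_real (rvec k \<bullet> y) * phi k x)) (at x)"
proof -
  have "((\<lambda>x. \<i> * complex_of_real (rvec k \<bullet> x)) has_derivative (\<lambda>y. \<i> * of_real (rvec k \<bullet> y))) (at x)"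
    by (intro derivative_intros)
  from has_derivative_compose[OF this DERIV_exp[unfolded has_field_derivative_def]]
  show ?thesis
    unfolding phi_def[abs_def] by (auto intro!: derivative_eq_intros simp: mult_ac)
qed

lemma C1_phi_mult:
  fixes \<psi> :: "'d::finite fn"
  assumes \<psi>: "C1 \<psi>"
  shows "C1 (\<lambda>x. phi k x * \<psi> x)"
    and "partial_deriv i (\<lambda>x. phi k x * \<psi> x) x
          = phi k x * partial_deriv i \<psi> x + \<i> * of_int (k $ i) * phi k x * \<psi> x"
proof -
  have "(\<psi> has_derivative frechet_derivative \<psi> (at x)) (at x)" for x
    using \<psi> by (simp add: C1_def frechet_derivative_works)
  from has_derivative_mult[OF phi_has_derivative this]
  have deriv: "((\<lambda>x. phi k x * \<psi> x) has_derivative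
      (\<lambda>y. phi k x * frechet_derivative \<psi> (at x) y + \<i> * of_real (rvec k \<bullet> y) * phi k x * \<psi> x)) (at x)" for x .
  show partial: "partial_deriv i (\<lambda>x. phi k x * \<psi> x) x
      = phi k x * partial_deriv i \<psi> x + \<i> * of_int (k $ i) * phi k x * \<psi> x" for i x
    unfolding partial_deriv_def frechet_derivative_at[OF deriv, symmetric]
    by (simp add: inner_axis rvec_def)
  have "continuous_on UNIV (partial_deriv i (\<lambda>x. phi k x * \<psi> x))" for i
    unfolding partial[abs_def]
    using \<psi> C1_continuous[OF \<psi>] by (intro continuous_intros continuous_phi) (auto simp: C1_def)
  then show "C1 (\<lambda>x. phi k x * \<psi> x)"
    unfolding C1_def differentiable_def using deriv by blast
qed

lemma phi_periodic: "periodic (phi k)"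
proof -
  have "rvec k \<bullet> axis i (2 * pi) = real_of_int (k $ i) * (2 * pi)" for i
    by (simp add: inner_axis rvec_def)
  moreover have "exp (\<i> * complex_of_real (real_of_int n * (2 * pi))) = 1" for n
    using exp_integer_2pi[of "of_int n"] by (simp add: mult_ac)
  ultimately show ?thesis
    unfolding periodic_def phi_def by (simp only: inner_add_right of_real_add distrib_left exp_add) simp
qed

lemma phi_L2p: "phi k \<in> L2p"
  unfolding L2p_iff by (simp add: phi_periodic phi_L2 borel_measurable_continuous_onI continuous_phi)

lemma L2p_add: "u \<in> L2p \<Longrightarrow> v \<in> L2p \<Longrightarrow> (\<lambda>x. u x + v x) \<in> L2p"
  unfolding L2p_iff by (auto simp: periodic_def intro: L2.add_mem)

lemma L2p_scale: "u \<in> L2p \<Longrightarrow> (\<lambda>x. c * u x) \<in> L2p"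
  unfolding L2p_iff by (auto simp: periodic_def intro: L2.scale_mem)

lemma weak_partial_phi: "weak_partial i (phi k) (\<lambda>x. \<i> * of_int (k $ i) * phi k x)"
  unfolding weak_partial_def
proof (intro conjI allI impI)
  show "(\<lambda>x. \<i> * of_int (k $ i) * phi k x) \<in> L2p" by (rule L2p_scale[OF phi_L2p])
  fix \<psi> :: "'a fn" assume "C1 \<psi> \<and> bounded {x. \<psi> x \<noteq> 0}"
  then have \<psi>: "C1 \<psi>" "bounded {x. \<psi> x \<noteq> 0}" by auto
  have cont: "continuous_on UNIV (partial_deriv i \<psi>)" using \<psi> by (simp add: C1_def)
  have int1: "integrable lborel (\<lambda>x. phi k x * partial_deriv i \<psi> x)"
    by (intro continuous_bounded_support continuous_intros continuous_phi cont
        bounded_subset[OF C1_partial_support[OF \<psi>(2), of i]]) auto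
  have int2: "integrable lborel (\<lambda>x. \<i> * of_int (k $ i) * phi k x * \<psi> x)"
    by (intro continuous_bounded_support continuous_intros continuous_phi C1_continuous \<psi>(1)
        bounded_subset[OF \<psi>(2)]) auto
  have "bounded {x. phi k x * \<psi> x \<noteq> 0}" by (rule bounded_subset[OF \<psi>(2)]) auto
  from integral_partial_deriv[OF C1_phi_mult(1)[OF \<psi>(1)] this, of i]
  have "(\<integral>x. phi k x * partial_deriv i \<psi> x \<partial>lborel) + (\<integral>x. \<i> * of_int (k $ i) * phi k x * \<psi> x \<partial>lborel) = 0"
    unfolding C1_phi_mult(2)[OF \<psi>(1)] Bochner_Integration.integral_add[OF int1 int2] .
  then show "(\<integral>x. phi k x * partial_deriv i \<psi> x \<partial>lborel) = - (\<integral>x. \<i> * of_int (k $ i) * phi k x * \<psi> x \<partial>lborel)"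
    by (simp add: eq_neg_iff_add_eq_0)
qed

text \<open>
  Elements of \<open>L2p\<close> are locally integrable on the whole space, which is needed for the linearity of weak
  differentiation.
\<close>

lemma test_integrable:
  assumes v: "v \<in> L2p" and cont: "continuous_on UNIV w" and supp: "bounded {x. w x \<noteq> 0}"
  shows "integrable lborel (\<lambda>x. v x * w x)"
proof -
  obtain C where C: "\<And>x. cmod (w x) \<le> C" using continuous_bounded_support(2)[OF cont supp] by blast
  show ?thesis
  proof (rule integral_unfold(1)[OF _ _ _ borel_measurable_continuous_onI[OF cont] C finite_tiles[OF supp]])
    show "periodic v" "v \<in> borel_measurable borel" "integrable cell v"
      using v by (simp_all add: L2p_iff L2_integrable)
  qed simp
qed

lemma weak_partial_add:
  assumes g: "weak_partial i u g" and h: "weak_partial i v h" and u: "u \<in> L2p" and v: "v \<in> L2p"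
  shows "weak_partial i (\<lambda>x. u x + v x) (\<lambda>x. g x + h x)"
  unfolding weak_partial_def
proof (intro conjI allI impI)
  have gh: "g \<in> L2p" "h \<in> L2p" using g h by (auto simp: weak_partial_def)
  then show "(\<lambda>x. g x + h x) \<in> L2p" by (rule L2p_add)
  fix \<psi> :: "'a fn" assume \<psi>: "C1 \<psi> \<and> bounded {x. \<psi> x \<noteq> 0}"
  have "continuous_on UNIV (partial_deriv i \<psi>)" using \<psi> by (simp add: C1_def)
  note int = test_integrable[OF _ this C1_partial_support] test_integrable[OF _ C1_continuous]
  have "integrable lborel (\<lambda>x. w x * partial_deriv i \<psi> x)" "integrable lborel (\<lambda>x. w x * \<psi> x)"
    if "w \<in> L2p" for w
    by (rule int; use that \<psi> in simp)+
  then show "(\<integral>x. (u x + v x) * partial_deriv i \<psi> x \<partial>lborel) = - (\<integral>x. (g x + h x) * \<psi> x \<partial>lborel)"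
    using u v gh g[unfolded weak_partial_def, THEN conjunct2, rule_format, OF \<psi>]
      h[unfolded weak_partial_def, THEN conjunct2, rule_format, OF \<psi>]
    by (simp add: distrib_right)
qed

lemma weak_partial_scale:
  assumes g: "weak_partial i u g"
  shows "weak_partial i (\<lambda>x. c * u x) (\<lambda>x. c * g x)"
  using assms unfolding weak_partial_def
  by (auto simp: mult.assoc intro: L2p_scale)

lemma H1p_I: "v \<in> L2p \<Longrightarrow> (\<And>i. weak_partial i v (g i)) \<Longrightarrow> v \<in> H1p"
  unfolding H1p_def by blast

lemma phi_H1p: "phi k \<in> H1p"
  by (rule H1p_I[OF phi_L2p weak_partial_phi])

lemma H1p_L2p: "v \<in> H1p \<Longrightarrow> v \<in> L2p"
  by (simp add: H1p_def)

lemma wderiv: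
  assumes "v \<in> H1p" shows "weak_partial i v (wderiv i v)"
proof -
  have "\<exists>g. weak_partial i v g" using assms by (simp add: H1p_def)
  then show ?thesis unfolding wderiv_def by (rule someI_ex)
qed

lemma H1p_add: "u \<in> H1p \<Longrightarrow> v \<in> H1p \<Longrightarrow> (\<lambda>x. u x + v x) \<in> H1p"
  by (rule H1p_I[OF L2p_add weak_partial_add[OF wderiv wderiv]]) (auto intro: H1p_L2p)

lemma H1p_scale: "u \<in> H1p \<Longrightarrow> (\<lambda>x. c * u x) \<in> H1p"
  by (rule H1p_I[OF L2p_scale weak_partial_scale[OF wderiv]]) (auto intro: H1p_L2p)

lemma wderiv_L2: "v \<in> H1p \<Longrightarrow> wderiv i v \<in> L2"
  using wderiv[of v i] by (simp add: weak_partial_def L2p_iff)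

lemma H1p_L2: "v \<in> H1p \<Longrightarrow> v \<in> L2"
  by (simp add: H1p_def L2p_iff)

lemma fcoef_wderiv: "v \<in> H1p \<Longrightarrow> fcoef (wderiv i v) k = \<i> * of_int (k $ i) * fcoef v k"
  by (rule fcoef_weak_partial[OF H1p_L2p wderiv])

section \<open>Orthonormality and completeness of the exponentials\<close>

text \<open>
  For different indices the integral need not be computed: evaluating the coefficient of the derivative
  of \<open>phi k\<close> at \<open>l\<close> in two ways shows that its product with \<open>k $ i - l $ i\<close> vanishes.
\<close>

lemma phi_orthonormal: "ip (phi k) (phi l) = (if k = l then 1 else 0)"
proof (cases "k = l")
  case True
  let ?c = "(2 * pi) powr (- (real CARD('a) / 2)) :: real"
  have "ip (phi k) (phi k) = (\<integral>x. of_real (?c\<^sup>2) \<partial>(cell :: (real^'a) measure))"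
    unfolding ip_def complex_norm_square[symmetric] cmod_phi by simp
  also have "\<dots> = of_real ((2 * pi) ^ CARD('a) * ?c\<^sup>2)"
    using measure_cell[where 'd = 'a] by (simp add: space_cell scaleR_conv_of_real)
  also have "(2 * pi) ^ CARD('a) * ?c\<^sup>2 = 1"
  proof -
    have "?c\<^sup>2 = (2 * pi) powr (- real CARD('a))"
      unfolding power2_eq_square powr_add[symmetric] by simp
    also have "\<dots> = inverse ((2 * pi) ^ CARD('a))"
      unfolding powr_minus by (subst powr_realpow) simp_all
    finally show ?thesis by (simp only: right_inverse power_not_zero mult_eq_0_iff pi_neq_zero zero_neq_numeral[symmetric] simp_thms)
  qed
  finally show ?thesis using True by simp
next
  case False
  then obtain i where i: "k $ i \<noteq> l $ i" by (auto simp: vec_eq_iff)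
  have "fcoef (\<lambda>x. \<i> * of_int (k $ i) * phi k x) l = \<i> * of_int (l $ i) * fcoef (phi k) l"
    by (rule fcoef_weak_partial[OF phi_L2p weak_partial_phi])
  then have "\<i> * of_int (k $ i) * ip (phi k) (phi l) = \<i> * of_int (l $ i) * ip (phi k) (phi l)"
    unfolding fcoef_ip by (simp only: L2.scale_left[OF phi_L2 phi_L2])
  then have "ip (phi k) (phi l) = 0" using i by simp
  then show ?thesis using False by simp
qed

interpretation L2: orthogonal_family "L2 :: 'd::finite fn set" ip phi "\<lambda>_. 1"
  by standard (auto simp: phi_L2 phi_orthonormal)

theorem Parseval:
  assumes "g \<in> L2"
  shows "((\<lambda>k. (cmod (fcoef g k))\<^sup>2) has_sum (\<integral>x. (cmod (g x))\<^sup>2 \<partial>cell)) UNIV"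
proof -
  have "\<exists>F c. finite F \<and> (L2.nrm (\<lambda>x. g x - (\<Sum>k\<in>F. c k * phi k x)))\<^sup>2 < \<epsilon>" if "0 < \<epsilon>" for \<epsilon>
  proof -
    have "\<exists>p\<in>Vspan UNIV. L2.nrm (\<lambda>x. g x - p x) < sqrt \<epsilon>"
      using trig_dense[OF assms] that by (simp add: trig_approx_def)
    then obtain p where p: "p \<in> Vspan UNIV" "L2.nrm (\<lambda>x. g x - p x) < sqrt \<epsilon>" by (rule bexE)
    from p(1) obtain F c where F: "finite F" "p = (\<lambda>x. \<Sum>k\<in>F. c k * phi k x)"
      unfolding Vspan_def by blast
    have "0 \<le> L2.nrm (\<lambda>x. g x - p x)" by (intro L2.nrm_nonneg L2.diff_mem assms Vspan_L2[OF p(1)])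
    then have "(L2.nrm (\<lambda>x. g x - p x))\<^sup>2 < \<epsilon>"
      using power_strict_mono[OF p(2), of 2] that by simp
    then show ?thesis using F by blast
  qed
  from L2.Parseval[OF assms this] show ?thesis
    by (simp add: L2_nrm_sq[OF assms] fcoef_ip)
qed

text \<open>
  This yields the uniqueness of weak derivatives: two of them have the same Fourier coefficients.
\<close>

theorem fcoef_complete:
  assumes "g \<in> L2" "h \<in> L2" "\<And>k. fcoef g k = fcoef h k"
  shows "AE x in cell. g x = h x"
proof -
  let ?d = "\<lambda>x. g x - h x"
  have d: "?d \<in> L2" using assms by (intro L2.diff_mem)
  have "fcoef ?d k = 0" for k
    using assms(3)[of k] by (simp add: fcoef_ip L2.diff_left[OF assms(1,2) phi_L2])
  then have "((\<lambda>k :: 'a idx. 0) has_sum (\<integral>x. (cmod (?d x))\<^sup>2 \<partial>cell)) UNIV"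
    using Parseval[OF d] by simp
  then have "(\<integral>x. (cmod (?d x))\<^sup>2 \<partial>cell) = 0"
    by (rule has_sum_unique[OF _ has_sum_0_simp])
  then have "AE x in cell. (cmod (?d x))\<^sup>2 = 0"
    using d by (subst (asm) integral_nonneg_eq_0_iff_AE) (auto simp: L2_def)
  then show ?thesis by eventually_elim simp
qed

section \<open>The energy form\<close>

lemma ip_cong_AE:
  assumes "f \<in> borel_measurable cell" "f' \<in> borel_measurable cell"
    "g \<in> borel_measurable cell" "g' \<in> borel_measurable cell"
    and "AE x in cell. f x = f' x" "AE x in cell. g x = g' x"
  shows "ip f g = ip f' g'"
  unfolding ip_def
proof (rule integral_cong_AE)
  show "AE x in cell. f x * cnj (g x) = f' x * cnj (g' x)"
    using assms(5,6) by eventually_elim simp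
qed (use assms(1-4) in \<open>auto intro!: borel_measurable_times borel_measurable_cnj\<close>)

text \<open>
  The representative \<open>wderiv i\<close> is an arbitrary choice, so it is linear only almost everywhere.
\<close>

lemma wderiv_add: "u \<in> H1p \<Longrightarrow> v \<in> H1p \<Longrightarrow>
    AE x in cell. wderiv i (\<lambda>x. u x + v x) x = wderiv i u x + wderiv i v x"
proof -
  assume uv: "u \<in> H1p" "v \<in> H1p"
  show ?thesis
  proof (rule fcoef_complete)
    show "wderiv i (\<lambda>x. u x + v x) \<in> L2" by (intro wderiv_L2 H1p_add uv)
    show "(\<lambda>x. wderiv i u x + wderiv i v x) \<in> L2" by (intro L2.add_mem wderiv_L2 uv)
    fix k
    have "fcoef (\<lambda>x. u x + v x) k = fcoef u k + fcoef v k"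
      unfolding fcoef_ip by (intro L2.add_left H1p_L2 uv phi_L2)
    moreover have "fcoef (\<lambda>x. wderiv i u x + wderiv i v x) k = fcoef (wderiv i u) k + fcoef (wderiv i v) k"
      unfolding fcoef_ip by (intro L2.add_left wderiv_L2 uv phi_L2)
    ultimately show "fcoef (wderiv i (\<lambda>x. u x + v x)) k = fcoef (\<lambda>x. wderiv i u x + wderiv i v x) k"
      by (simp add: fcoef_wderiv H1p_add uv distrib_left)
  qed
qed

lemma wderiv_scale: "u \<in> H1p \<Longrightarrow> AE x in cell. wderiv i (\<lambda>x. c * u x) x = c * wderiv i u x"
proof -
  assume u: "u \<in> H1p"
  show ?thesis
  proof (rule fcoef_complete)
    show "wderiv i (\<lambda>x. c * u x) \<in> L2" by (intro wderiv_L2 H1p_scale u)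
    show "(\<lambda>x. c * wderiv i u x) \<in> L2" by (intro L2.scale_mem wderiv_L2 u)
    fix k
    have "fcoef (\<lambda>x. c * u x) k = c * fcoef u k"
      unfolding fcoef_ip by (intro L2.scale_left H1p_L2 u phi_L2)
    moreover have "fcoef (\<lambda>x. c * wderiv i u x) k = c * fcoef (wderiv i u) k"
      unfolding fcoef_ip by (intro L2.scale_left wderiv_L2 u phi_L2)
    ultimately show "fcoef (wderiv i (\<lambda>x. c * u x)) k = fcoef (\<lambda>x. c * wderiv i u x) k"
      by (simp add: fcoef_wderiv H1p_scale u)
  qed
qed

text \<open>
  One bound from below and one from above serve for both coefficients.  With both coefficients equal to
  1, the energy norm of this locale is the norm of \<open>H\<^sup>1\<close>.
\<close>

locale elliptic =
  fixes \<nu> \<sigma> :: "real^'d::finite \<Rightarrow> real" and lo hi :: real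
  assumes \<nu>_meas: "\<nu> \<in> borel_measurable borel" and \<sigma>_meas: "\<sigma> \<in> borel_measurable borel"
    and lo_pos: "0 < lo"
    and \<nu>_bounds: "lo \<le> \<nu> x" "\<nu> x \<le> hi" and \<sigma>_bounds: "lo \<le> \<sigma> x" "\<sigma> x \<le> hi"
begin

lemma lo_le_hi: "lo \<le> hi"
  using \<nu>_bounds order_trans by blast

lemma hi_pos: "0 < hi"
  using lo_pos lo_le_hi by simp

lemma \<nu>_mult_L2: "g \<in> L2 \<Longrightarrow> (\<lambda>x. complex_of_real (\<nu> x) * g x) \<in> L2"
  using \<nu>_meas order_trans[OF less_imp_le[OF lo_pos] \<nu>_bounds(1)] \<nu>_bounds(2)
  by (intro L2_bounded_mult[where C = hi] borel_measurable_of_real borel_measurable_cell) auto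

lemma \<sigma>_mult_L2: "g \<in> L2 \<Longrightarrow> (\<lambda>x. complex_of_real (\<sigma> x) * g x) \<in> L2"
  using \<sigma>_meas order_trans[OF less_imp_le[OF lo_pos] \<sigma>_bounds(1)] \<sigma>_bounds(2)
  by (intro L2_bounded_mult[where C = hi] borel_measurable_of_real borel_measurable_cell) auto

lemma bform_ip:
  assumes u: "u \<in> H1p" and v: "v \<in> H1p"
  shows "bform \<nu> \<sigma> u v = (\<Sum>i\<in>UNIV. ip (\<lambda>x. of_real (\<nu> x) * wderiv i u x) (wderiv i v))
      + ip (\<lambda>x. of_real (\<sigma> x) * u x) v"
proof -
  have "(LINT x:Omega|lborel. complex_of_real (\<nu> x) * (\<Sum>i\<in>UNIV. wderiv i u x * cnj (wderiv i v x)))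
      = (\<integral>x. (\<Sum>i\<in>UNIV. (of_real (\<nu> x) * wderiv i u x) * cnj (wderiv i v x)) \<partial>cell)"
    unfolding integral_cell sum_distrib_left mult.assoc ..
  also have "\<dots> = (\<Sum>i\<in>UNIV. ip (\<lambda>x. of_real (\<nu> x) * wderiv i u x) (wderiv i v))"
    unfolding ip_def
    by (intro Bochner_Integration.integral_sum L2_mult_integrable \<nu>_mult_L2 L2_cnj wderiv_L2 u v)
  finally show ?thesis by (simp only: bform_def integral_cell ip_def)
qed

lemma weighted_ip_hermitian:
  "ip (\<lambda>x. of_real (\<kappa> x) * g x) h = cnj (ip (\<lambda>x. of_real (\<kappa> x) * h x) g)"
proof -
  have "cnj (ip (\<lambda>x. of_real (\<kappa> x) * h x) g) = (\<integral>x. cnj ((of_real (\<kappa> x) * h x) * cnj (g x)) \<partial>cell)"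
    unfolding ip_def by (rule Bochner_Integration.integral_cnj[symmetric])
  also have "\<dots> = ip (\<lambda>x. of_real (\<kappa> x) * g x) h"
    unfolding ip_def by (intro Bochner_Integration.integral_cong) (auto simp: mult_ac)
  finally show ?thesis by simp
qed

lemma weighted_ip_bounds:
  assumes g: "g \<in> L2" and m: "(\<lambda>x. complex_of_real (\<kappa> x) * g x) \<in> L2"
    and bd: "\<And>x. a \<le> \<kappa> x" "\<And>x. \<kappa> x \<le> b"
  shows "a * (L2.nrm g)\<^sup>2 \<le> Re (ip (\<lambda>x. of_real (\<kappa> x) * g x) g)"
    and "Re (ip (\<lambda>x. of_real (\<kappa> x) * g x) g) \<le> b * (L2.nrm g)\<^sup>2"
proof -
  have int: "integrable cell (\<lambda>x. \<kappa> x * (cmod (g x))\<^sup>2)"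
  proof -
    have "integrable cell (\<lambda>x. Re (of_real (\<kappa> x) * g x * cnj (g x)))"
      by (intro integrable_Re L2_mult_integrable m L2_cnj g)
    then show ?thesis by (simp add: mult.assoc complex_norm_square[symmetric] del: of_real_power)
  qed
  have int_g: "integrable cell (\<lambda>x. (cmod (g x))\<^sup>2)" using g by (simp add: L2_def)
  have "ip (\<lambda>x. of_real (\<kappa> x) * g x) g = (\<integral>x. of_real (\<kappa> x * (cmod (g x))\<^sup>2) \<partial>cell)"
    unfolding ip_def of_real_mult complex_norm_square mult.assoc ..
  then have eq: "Re (ip (\<lambda>x. of_real (\<kappa> x) * g x) g) = (\<integral>x. \<kappa> x * (cmod (g x))\<^sup>2 \<partial>cell)"
    by (simp only: integral_complex_of_real Re_complex_of_real)
  have "(\<integral>x. a * (cmod (g x))\<^sup>2 \<partial>cell) \<le> (\<integral>x. \<kappa> x * (cmod (g x))\<^sup>2 \<partial>cell)"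
    by (intro integral_mono integrable_mult_right int int_g mult_right_mono bd) simp
  then show "a * (L2.nrm g)\<^sup>2 \<le> Re (ip (\<lambda>x. of_real (\<kappa> x) * g x) g)"
    by (simp add: eq L2_nrm_sq[OF g])
  have "(\<integral>x. \<kappa> x * (cmod (g x))\<^sup>2 \<partial>cell) \<le> (\<integral>x. b * (cmod (g x))\<^sup>2 \<partial>cell)"
    by (intro integral_mono integrable_mult_right int int_g mult_right_mono bd) simp
  then show "Re (ip (\<lambda>x. of_real (\<kappa> x) * g x) g) \<le> b * (L2.nrm g)\<^sup>2"
    by (simp add: eq L2_nrm_sq[OF g])
qed

lemma bform_bounds:
  assumes v: "v \<in> H1p"
  shows "lo * ((\<Sum>i\<in>UNIV. (L2.nrm (wderiv i v))\<^sup>2) + (L2.nrm v)\<^sup>2) \<le> Re (bform \<nu> \<sigma> v v)"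
    and "Re (bform \<nu> \<sigma> v v) \<le> hi * ((\<Sum>i\<in>UNIV. (L2.nrm (wderiv i v))\<^sup>2) + (L2.nrm v)\<^sup>2)"
  unfolding bform_ip[OF v v] distrib_left sum_distrib_left plus_complex.sel Re_sum
  by (intro add_mono sum_mono weighted_ip_bounds(1)[where b = hi] \<nu>_bounds \<sigma>_bounds \<nu>_mult_L2 \<sigma>_mult_L2
      wderiv_L2 H1p_L2 v)
    (intro add_mono sum_mono weighted_ip_bounds(2)[where a = lo] \<nu>_bounds \<sigma>_bounds \<nu>_mult_L2 \<sigma>_mult_L2
      wderiv_L2 H1p_L2 v)

end

sublocale elliptic \<subseteq> hermitian_form H1p "bform \<nu> \<sigma>"
proof
  have "(\<lambda>x. 0 * phi 0 x) \<in> H1p" by (rule H1p_scale[OF phi_H1p])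
  then show "(\<lambda>x. 0) \<in> H1p" by simp
next
  fix u v w :: "'d fn" assume u: "u \<in> H1p" and v: "v \<in> H1p" and w: "w \<in> H1p"
  have uv: "(\<lambda>x. u x + v x) \<in> H1p" by (rule H1p_add[OF u v])
  have "ip (\<lambda>x. of_real (\<nu> x) * wderiv i (\<lambda>x. u x + v x) x) (wderiv i w)
      = ip (\<lambda>x. of_real (\<nu> x) * wderiv i u x) (wderiv i w) + ip (\<lambda>x. of_real (\<nu> x) * wderiv i v x) (wderiv i w)" for i
  proof -
    have "ip (\<lambda>x. of_real (\<nu> x) * wderiv i (\<lambda>x. u x + v x) x) (wderiv i w)
        = ip (\<lambda>x. of_real (\<nu> x) * wderiv i u x + of_real (\<nu> x) * wderiv i v x) (wderiv i w)"
    proof (rule ip_cong_AE)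
      show "AE x in cell. complex_of_real (\<nu> x) * wderiv i (\<lambda>x. u x + v x) x
          = of_real (\<nu> x) * wderiv i u x + of_real (\<nu> x) * wderiv i v x"
        using wderiv_add[OF u v, of i] by eventually_elim (simp add: distrib_left)
    qed (auto intro!: L2_measurable L2.add_mem \<nu>_mult_L2 wderiv_L2 u v w uv)
    then show ?thesis by (simp only: L2.add_left \<nu>_mult_L2 wderiv_L2 u v w)
  qed
  moreover have "ip (\<lambda>x. of_real (\<sigma> x) * (u x + v x)) w
      = ip (\<lambda>x. of_real (\<sigma> x) * u x) w + ip (\<lambda>x. of_real (\<sigma> x) * v x) w"
    unfolding distrib_left by (intro L2.add_left \<sigma>_mult_L2 H1p_L2 u v w)
  ultimately show "bform \<nu> \<sigma> (\<lambda>x. u x + v x) w = bform \<nu> \<sigma> u w + bform \<nu> \<sigma> v w"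
    by (simp add: bform_ip uv u v w sum.distrib)
next
  fix u w :: "'d fn" and c assume u: "u \<in> H1p" and w: "w \<in> H1p"
  have cu: "(\<lambda>x. c * u x) \<in> H1p" by (rule H1p_scale[OF u])
  have "ip (\<lambda>x. of_real (\<nu> x) * wderiv i (\<lambda>x. c * u x) x) (wderiv i w)
      = c * ip (\<lambda>x. of_real (\<nu> x) * wderiv i u x) (wderiv i w)" for i
  proof -
    have "ip (\<lambda>x. of_real (\<nu> x) * wderiv i (\<lambda>x. c * u x) x) (wderiv i w)
        = ip (\<lambda>x. c * (of_real (\<nu> x) * wderiv i u x)) (wderiv i w)"
    proof (rule ip_cong_AE)
      show "AE x in cell. complex_of_real (\<nu> x) * wderiv i (\<lambda>x. c * u x) x
          = c * (of_real (\<nu> x) * wderiv i u x)"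
        using wderiv_scale[OF u, of i c] by eventually_elim simp
    qed (auto intro!: L2_measurable L2.scale_mem \<nu>_mult_L2 wderiv_L2 u w cu)
    then show ?thesis by (simp only: L2.scale_left \<nu>_mult_L2 wderiv_L2 u w)
  qed
  moreover have "ip (\<lambda>x. of_real (\<sigma> x) * (c * u x)) w = c * ip (\<lambda>x. of_real (\<sigma> x) * u x) w"
    unfolding mult.left_commute[of _ c] by (intro L2.scale_left \<sigma>_mult_L2 H1p_L2 u w)
  ultimately show "bform \<nu> \<sigma> (\<lambda>x. c * u x) w = c * bform \<nu> \<sigma> u w"
    by (simp add: bform_ip cu u w sum_distrib_left distrib_left)
next
  fix u v :: "'d fn" assume u: "u \<in> H1p" and v: "v \<in> H1p"
  show "bform \<nu> \<sigma> v u = cnj (bform \<nu> \<sigma> u v)"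
    unfolding bform_ip[OF u v] bform_ip[OF v u] complex_cnj_add cnj_sum
    by (simp only: weighted_ip_hermitian[symmetric])
next
  fix v :: "'d fn" assume v: "v \<in> H1p"
  have "0 \<le> lo * ((\<Sum>i\<in>UNIV. (L2.nrm (wderiv i v))\<^sup>2) + (L2.nrm v)\<^sup>2)"
    using lo_pos by (intro mult_nonneg_nonneg add_nonneg_nonneg sum_nonneg) auto
  then show "0 \<le> Re (bform \<nu> \<sigma> v v)" using bform_bounds(1)[OF v] by linarith
qed (auto intro: H1p_add H1p_scale)

section \<open>The norms of \<open>H\<^sup>1\<close> and of its antidual\<close>

text \<open>
  The squared \<open>H\<^sup>1\<close> norm of the exponential of index \<open>k\<close>.
\<close>

definition weight :: "'d::finite idx \<Rightarrow> real" where
  "weight k = 1 + (norm (rvec k))\<^sup>2"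

lemma weight_pos: "0 < weight k"
  by (simp add: weight_def add_pos_nonneg)

lemma weight_sum: "weight k = (\<Sum>i\<in>UNIV. (real_of_int (k $ i))\<^sup>2) + 1"
  unfolding weight_def power2_norm_eq_inner inner_vec_def rvec_def by (simp add: power2_eq_square)

lemma weight_nonzero: "weight k \<noteq> 0"
  using weight_pos[of k] by simp

lemma fcoef_phi: "fcoef (phi l) k = (if k = l then 1 else 0)"
  by (auto simp: fcoef_ip phi_orthonormal)


interpretation H1: elliptic "\<lambda>_. 1" "\<lambda>_. 1" 1 1
  by standard auto

lemma H1_nrm_sq:
  assumes v: "v \<in> H1p"
  shows "(H1.nrm v)\<^sup>2 = (\<Sum>i\<in>UNIV. (L2.nrm (wderiv i v))\<^sup>2) + (L2.nrm v)\<^sup>2"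
  using H1.bform_bounds[OF v] by (simp add: H1.nrm_sq[OF v])

lemma H1_bform_phi:
  assumes v: "v \<in> H1p"
  shows "bform (\<lambda>_. 1) (\<lambda>_. 1) v (phi k) = of_real (weight k) * fcoef v k"
proof -
  have "ip (wderiv i v) (wderiv i (phi k)) = of_real ((real_of_int (k $ i))\<^sup>2) * fcoef v k" for i
  proof -
    have "AE x in cell. wderiv i (phi k) x = (\<i> * of_int (k $ i)) * phi k x"
    proof (rule fcoef_complete)
      show "fcoef (wderiv i (phi k)) l = fcoef (\<lambda>x. \<i> * of_int (k $ i) * phi k x) l" for l
      proof -
        have "fcoef (\<lambda>x. \<i> * of_int (k $ i) * phi k x) l = \<i> * of_int (k $ i) * fcoef (phi k) l"
          unfolding fcoef_ip by (rule L2.scale_left[OF phi_L2 phi_L2])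
        then show ?thesis by (simp add: fcoef_wderiv[OF phi_H1p] fcoef_phi)
      qed
    qed (intro wderiv_L2 phi_H1p L2.scale_mem phi_L2)+
    then have "ip (wderiv i v) (wderiv i (phi k)) = ip (wderiv i v) (\<lambda>x. (\<i> * of_int (k $ i)) * phi k x)"
      by (intro ip_cong_AE) (auto intro!: L2_measurable wderiv_L2 phi_H1p L2.scale_mem phi_L2 v)
    also have "\<dots> = cnj (\<i> * of_int (k $ i)) * fcoef (wderiv i v) k"
      unfolding fcoef_ip by (intro L2.scale_right phi_L2 wderiv_L2 v)
    also have "\<dots> = (cnj (\<i> * of_int (k $ i)) * (\<i> * of_int (k $ i))) * fcoef v k"
      by (simp add: fcoef_wderiv[OF v] mult.assoc)
    also have "cnj (\<i> * of_int (k $ i)) * (\<i> * of_int (k $ i)) = of_real ((real_of_int (k $ i))\<^sup>2)"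
      by (simp add: complex_eq_iff power2_eq_square)
    finally show ?thesis .
  qed
  then show ?thesis
    by (simp add: H1.bform_ip[OF v phi_H1p] weight_sum fcoef_ip sum_distrib_right distrib_right)
qed

interpretation H1: orthogonal_family "H1p :: 'd::finite fn set" "bform (\<lambda>_. 1) (\<lambda>_. 1)" phi weight
  by standard (auto simp: phi_H1p weight_pos H1_bform_phi fcoef_ip phi_orthonormal)

lemma has_sum_finite_sum:
  fixes f :: "'i \<Rightarrow> 'k \<Rightarrow> real"
  assumes "finite I" "\<And>i. i \<in> I \<Longrightarrow> (f i has_sum s i) A"
  shows "((\<lambda>k. \<Sum>i\<in>I. f i k) has_sum (\<Sum>i\<in>I. s i)) A"
  using assms by (induction I rule: finite_induct) (auto intro: has_sum_add)

text \<open>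
  Parseval's identity for \<open>v\<close> and for each of its weak derivatives; the squares of the factors
  \<open>\<i> k\<close> add up to the weight.
\<close>

theorem H1_Parseval:
  assumes v: "v \<in> H1p"
  shows "((\<lambda>k. weight k * (cmod (fcoef v k))\<^sup>2) has_sum (H1.nrm v)\<^sup>2) UNIV"
proof -
  have "((\<lambda>k. (\<Sum>i\<in>UNIV. (cmod (fcoef (wderiv i v) k))\<^sup>2) + (cmod (fcoef v k))\<^sup>2) has_sum (H1.nrm v)\<^sup>2) UNIV"
    unfolding H1_nrm_sq[OF v] L2_nrm_sq[OF wderiv_L2[OF v]] L2_nrm_sq[OF H1p_L2[OF v]]
    by (intro has_sum_add has_sum_finite_sum Parseval wderiv_L2 H1p_L2 v) simp
  then show ?thesis
    by (simp add: fcoef_wderiv[OF v] norm_mult power_mult_distrib weight_sum sum_distrib_right distrib_right)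
qed

lemma H1norm_nrm: "v \<in> H1p \<Longrightarrow> H1norm v = H1.nrm v"
  unfolding H1norm_def weight_def[symmetric]
  by (simp add: infsumI[OF H1_Parseval] H1.nrm_nonneg)

lemma proj_comb: "v \<in> H1p \<Longrightarrow> proj F v = (\<lambda>x. \<Sum>k\<in>F. bform (\<lambda>_. 1) (\<lambda>_. 1) v (phi k) / of_real (weight k) * phi k x)"
  by (simp add: proj_def H1_bform_phi weight_nonzero)

lemma proj_mem: "proj F v \<in> H1p"
  unfolding proj_def by (rule H1.sum_mem) (rule phi_H1p)

text \<open>
  Truncated Fourier series converge in \<open>H\<^sup>1\<close>: the truncations are the orthogonal projections of the
  \<open>H\<^sup>1\<close> inner product, and the error is the tail of Parseval's series.
\<close>

lemma proj_converges:
  assumes v: "v \<in> H1p" and \<epsilon>: "0 < \<epsilon>"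
  shows "\<exists>F. finite F \<and> H1norm (\<lambda>x. v x - proj F v x) < \<epsilon>"
proof -
  have "0 < \<epsilon>\<^sup>2 / 2" using \<epsilon> by simp
  from has_sum_finite_approximation[OF H1_Parseval[OF v] this]
  obtain F where F: "finite F" "dist (\<Sum>k\<in>F. weight k * (cmod (fcoef v k))\<^sup>2) ((H1.nrm v)\<^sup>2) \<le> \<epsilon>\<^sup>2 / 2"
    by blast
  have "(cmod (bform (\<lambda>_. 1) (\<lambda>_. 1) v (phi k)))\<^sup>2 / weight k = weight k * (cmod (fcoef v k))\<^sup>2" for k
    using weight_pos[of k] by (simp add: H1_bform_phi[OF v] norm_mult power2_eq_square)
  then have "(H1.nrm (\<lambda>x. v x - proj F v x))\<^sup>2 = (H1.nrm v)\<^sup>2 - (\<Sum>k\<in>F. weight k * (cmod (fcoef v k))\<^sup>2)"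
    using H1.nrm_sq_diff_proj[OF F(1) v] by (simp add: proj_comb[OF v])
  also have "\<dots> \<le> \<epsilon>\<^sup>2 / 2" using F(2) unfolding dist_real_def by linarith
  also have "\<dots> < \<epsilon>\<^sup>2" using \<epsilon> by simp
  finally have "H1.nrm (\<lambda>x. v x - proj F v x) < \<epsilon>" by (rule power2_less_imp_less) (use \<epsilon> in simp)
  then show ?thesis using F(1) by (auto simp: H1norm_nrm H1.diff_mem v proj_mem)
qed

lemma Hm1p_add: "F \<in> Hm1p \<Longrightarrow> v \<in> H1p \<Longrightarrow> w \<in> H1p \<Longrightarrow> F (\<lambda>x. v x + w x) = F v + F w"
  by (simp add: Hm1p_def)

lemma Hm1p_scale: "F \<in> Hm1p \<Longrightarrow> v \<in> H1p \<Longrightarrow> F (\<lambda>x. c * v x) = cnj c * F v"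
  by (simp add: Hm1p_def)

lemma Hm1p_zero: "F \<in> Hm1p \<Longrightarrow> F (\<lambda>x. 0) = 0"
  using Hm1p_scale[OF _ H1.zero_mem, of F 0] by simp

lemma Hm1p_comb:
  assumes F: "F \<in> Hm1p"
  shows "F (\<lambda>x. \<Sum>k\<in>A. c k * phi k x) = (\<Sum>k\<in>A. cnj (c k) * F (phi k))"
proof (induction A rule: infinite_finite_induct)
  case (insert k A)
  have "F (\<lambda>x. \<Sum>k\<in>insert k A. c k * phi k x) = F (\<lambda>x. c k * phi k x) + F (\<lambda>x. \<Sum>k\<in>A. c k * phi k x)"
    using insert Hm1p_add[OF F H1p_scale[OF phi_H1p] H1.comb_mem, of "c k" k c A] by simp
  moreover have "F (\<lambda>x. c k * phi k x) = cnj (c k) * F (phi k)" by (rule Hm1p_scale[OF F phi_H1p])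
  ultimately show ?case using insert by simp
qed (auto simp: Hm1p_zero[OF F])

text \<open>
  The functional is tested with its own Riesz representative on \<open>A\<close>; both the value of the functional and
  the squared norm of the representative equal the sum in question.
\<close>

lemma dual_coefficients_bound:
  assumes F: "F \<in> Hm1p" and A: "finite A"
    and bd: "\<And>v. v \<in> Vspan A \<Longrightarrow> cmod (F v) \<le> C * H1norm v"
  shows "(\<Sum>k\<in>A. (cmod (F (phi k)))\<^sup>2 / weight k) \<le> C\<^sup>2"
proof -
  let ?T = "\<Sum>k\<in>A. (cmod (F (phi k)))\<^sup>2 / weight k"
  let ?v = "\<lambda>x. \<Sum>k\<in>A. F (phi k) / of_real (weight k) * phi k x"
  have T: "0 \<le> ?T" by (intro sum_nonneg divide_nonneg_pos weight_pos) simp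
  have "F ?v = (\<Sum>k\<in>A. cnj (F (phi k) / of_real (weight k)) * F (phi k))"
    by (rule Hm1p_comb[OF F])
  also have "\<dots> = of_real ?T"
    unfolding of_real_sum by (intro sum.cong) (simp_all add: complex_norm_square mult.commute del: of_real_power)
  finally have "cmod (F ?v) = cmod (of_real ?T)" by (rule arg_cong)
  then have Fv: "cmod (F ?v) = ?T" unfolding norm_of_real using T by (simp only: abs_of_nonneg)
  have "(H1.nrm ?v)\<^sup>2 = ?T"
    unfolding H1.nrm_sq_comb[OF A]
  proof (intro sum.cong refl)
    show "weight k * (cmod (F (phi k) / of_real (weight k)))\<^sup>2 = (cmod (F (phi k)))\<^sup>2 / weight k" for k
      using weight_pos[of k] by (simp add: norm_divide power2_eq_square)
  qed
  then have "sqrt ?T = H1.nrm ?v" by (rule real_sqrt_unique) (rule H1.nrm_nonneg[OF H1.comb_mem])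
  then have nrm: "H1norm ?v = sqrt ?T" by (simp only: H1norm_nrm[OF H1.comb_mem])
  have "?T \<le> C * sqrt ?T"
    using bd[OF Vspan_comb[OF A order_refl, of "\<lambda>k. F (phi k) / of_real (weight k)"]] unfolding Fv nrm .
  then have le: "sqrt ?T * sqrt ?T \<le> C * sqrt ?T" using T by simp
  show ?thesis
  proof (cases "?T = 0")
    case False
    then have "0 < sqrt ?T" using T by simp
    with le have "sqrt ?T \<le> C" by (rule mult_right_le_imp_le)
    then have "(sqrt ?T)\<^sup>2 \<le> C\<^sup>2" by (rule power_mono) (use T in simp)
    then show ?thesis using T by simp
  qed simp
qed

lemma Hm1p_bound: "F \<in> Hm1p \<Longrightarrow> \<exists>B\<ge>0. \<forall>v\<in>H1p. cmod (F v) \<le> B * H1norm v"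
proof -
  assume "F \<in> Hm1p"
  then obtain B where B: "\<And>v. v \<in> H1p \<Longrightarrow> cmod (F v) \<le> B * H1norm v" unfolding Hm1p_def by blast
  have "cmod (F v) \<le> \<bar>B\<bar> * H1norm v" if "v \<in> H1p" for v
    using B[OF that] mult_right_mono[OF abs_ge_self, of "H1norm v" B] H1.nrm_nonneg[OF that]
    by (simp add: H1norm_nrm[OF that])
  then show ?thesis by (intro exI[of _ "\<bar>B\<bar>"]) simp
qed

lemma Vspan_H1p: "v \<in> Vspan A \<Longrightarrow> v \<in> H1p"
  unfolding Vspan_def by (auto intro: H1.comb_mem)

lemma Hm1norm_le:
  assumes F: "F \<in> Hm1p" and C: "0 \<le> C" and bd: "\<And>v. v \<in> H1p \<Longrightarrow> cmod (F v) \<le> C * H1norm v"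
  shows "(\<lambda>k. (cmod (F (phi k)))\<^sup>2 / weight k) summable_on UNIV" and "Hm1norm F \<le> C"
proof -
  have le: "(\<Sum>k\<in>A. (cmod (F (phi k)))\<^sup>2 / weight k) \<le> C\<^sup>2" if "finite A" for A
    by (rule dual_coefficients_bound[OF F that bd[OF Vspan_H1p]])
  show sum: "(\<lambda>k. (cmod (F (phi k)))\<^sup>2 / weight k) summable_on UNIV"
    by (rule nonneg_bdd_above_summable_on)
       (auto intro!: divide_nonneg_pos weight_pos bdd_aboveI[of _ "C\<^sup>2"] le)
  have "infsum (\<lambda>k. (cmod (F (phi k)))\<^sup>2 / weight k) UNIV \<le> C\<^sup>2"
    by (rule infsum_le_finite_sums[OF sum]) (rule le)
  then have "Hm1norm F \<le> sqrt (C\<^sup>2)"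
    unfolding Hm1norm_def weight_def[symmetric] by (rule real_sqrt_le_mono)
  then show "Hm1norm F \<le> C" using C by simp
qed

lemma Hm1norm_nonneg: "0 \<le> Hm1norm F"
  unfolding Hm1norm_def weight_def[symmetric]
  by (intro real_sqrt_ge_zero infsum_nonneg divide_nonneg_pos weight_pos) simp

lemma dual_pairing_comb:
  assumes F: "F \<in> Hm1p" and A: "finite A"
  shows "cmod (F (\<lambda>x. \<Sum>k\<in>A. c k * phi k x)) \<le> Hm1norm F * H1norm (\<lambda>x. \<Sum>k\<in>A. c k * phi k x)"
proof -
  obtain B where B: "0 \<le> B" "\<And>v. v \<in> H1p \<Longrightarrow> cmod (F v) \<le> B * H1norm v"
    using Hm1p_bound[OF F] by blast
  let ?a = "\<lambda>k. cmod (F (phi k)) / sqrt (weight k)"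
  let ?b = "\<lambda>k. sqrt (weight k) * cmod (c k)"
  have "cmod (F (\<lambda>x. \<Sum>k\<in>A. c k * phi k x)) \<le> (\<Sum>k\<in>A. cmod (cnj (c k) * F (phi k)))"
    unfolding Hm1p_comb[OF F] by (rule norm_sum)
  also have "\<dots> = (\<Sum>k\<in>A. \<bar>?a k\<bar> * \<bar>?b k\<bar>)"
  proof (intro sum.cong refl)
    fix k
    have "sqrt (weight k) \<noteq> 0" "0 \<le> ?a k" "0 \<le> ?b k" using weight_pos[of k] by simp_all
    then have "\<bar>?a k\<bar> * \<bar>?b k\<bar> = cmod (F (phi k)) * cmod (c k)"
      unfolding abs_of_nonneg[OF \<open>0 \<le> ?a k\<close>] abs_of_nonneg[OF \<open>0 \<le> ?b k\<close>] by simp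
    then show "cmod (cnj (c k) * F (phi k)) = \<bar>?a k\<bar> * \<bar>?b k\<bar>"
      by (simp only: norm_mult complex_mod_cnj mult.commute[of "cmod (c k)"])
  qed
  also have "\<dots> \<le> L2_set ?a A * L2_set ?b A" by (rule L2_set_mult_ineq)
  also have "\<dots> \<le> Hm1norm F * H1norm (\<lambda>x. \<Sum>k\<in>A. c k * phi k x)"
  proof (rule mult_mono)
    have "(\<Sum>k\<in>A. (?a k)\<^sup>2) = (\<Sum>k\<in>A. (cmod (F (phi k)))\<^sup>2 / weight k)"
      by (intro sum.cong) (simp_all add: power_divide less_imp_le[OF weight_pos])
    also have "\<dots> \<le> infsum (\<lambda>k. (cmod (F (phi k)))\<^sup>2 / weight k) UNIV"
      by (intro finite_sum_le_infsum Hm1norm_le(1)[OF F B] A divide_nonneg_pos weight_pos) auto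
    finally show "L2_set ?a A \<le> Hm1norm F"
      unfolding L2_set_def Hm1norm_def weight_def[symmetric] by (rule real_sqrt_le_mono)
    have "(\<Sum>k\<in>A. (?b k)\<^sup>2) = (H1.nrm (\<lambda>x. \<Sum>k\<in>A. c k * phi k x))\<^sup>2"
      unfolding H1.nrm_sq_comb[OF A]
      by (intro sum.cong) (simp_all add: power_mult_distrib less_imp_le[OF weight_pos])
    then show "L2_set ?b A \<le> H1norm (\<lambda>x. \<Sum>k\<in>A. c k * phi k x)"
      unfolding L2_set_def by (simp add: H1norm_nrm H1.comb_mem H1.nrm_nonneg)
  qed (auto simp: Hm1norm_nonneg L2_set_nonneg)
  finally show ?thesis .
qed

text \<open>
  For trigonometric polynomials this is the Cauchy-Schwarz inequality for sums.  The functional is bounded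
  in the \<open>H\<^sup>1\<close> norm, and truncated Fourier series converge in it, which gives the general case.
\<close>

theorem dual_pairing:
  assumes F: "F \<in> Hm1p" and v: "v \<in> H1p"
  shows "cmod (F v) \<le> Hm1norm F * H1norm v"
proof (rule field_le_epsilon)
  fix \<epsilon> :: real assume \<epsilon>: "0 < \<epsilon>"
  obtain B where B: "0 \<le> B" "\<And>v. v \<in> H1p \<Longrightarrow> cmod (F v) \<le> B * H1norm v"
    using Hm1p_bound[OF F] by blast
  define M where "M = B + Hm1norm F + 1"
  have M: "0 < M" using B(1) Hm1norm_nonneg[of F] by (simp add: M_def)
  obtain A where A: "finite A" "H1norm (\<lambda>x. v x - proj A v x) < \<epsilon> / M"
    using proj_converges[OF v, of "\<epsilon> / M"] \<epsilon> M by auto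
  let ?p = "proj A v" and ?d = "\<lambda>x. v x - proj A v x"
  have p: "?p \<in> H1p" and d: "?d \<in> H1p" by (intro proj_mem H1.diff_mem v)+
  have "F (\<lambda>x. ?d x + ?p x) = F ?d + F ?p" by (rule Hm1p_add[OF F d p])
  then have "cmod (F v) \<le> cmod (F ?d) + cmod (F ?p)" using norm_triangle_ineq[of "F ?d" "F ?p"] by simp
  also have "\<dots> \<le> B * H1norm ?d + Hm1norm F * H1norm ?p"
    using B(2)[OF d] dual_pairing_comb[OF F A(1), of "fcoef v"] by (intro add_mono) (auto simp: proj_def)
  also have "H1norm ?p \<le> H1norm ?d + H1norm v"
  proof -
    have neg: "(\<lambda>x. (- 1) * ?d x) \<in> H1p" by (rule H1p_scale[OF d])
    have "(H1.nrm (\<lambda>x. (- 1) * ?d x))\<^sup>2 = (H1.nrm ?d)\<^sup>2"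
      unfolding H1.nrm_sq_scale[OF d] by simp
    then have nd: "H1.nrm (\<lambda>x. (- 1) * ?d x) = H1.nrm ?d"
      unfolding power2_eq_iff_nonneg[OF H1.nrm_nonneg[OF neg] H1.nrm_nonneg[OF d]] .
    have "(\<lambda>x. (- 1) * ?d x + v x) = ?p" by auto
    then show ?thesis
      using H1.nrm_triangle[OF neg v] unfolding nd by (simp only: H1norm_nrm p d v)
  qed
  then have "B * H1norm ?d + Hm1norm F * H1norm ?p \<le> B * H1norm ?d + Hm1norm F * (H1norm ?d + H1norm v)"
    by (intro add_left_mono mult_left_mono Hm1norm_nonneg)
  also have "\<dots> \<le> M * H1norm ?d + Hm1norm F * H1norm v"
    using H1.nrm_nonneg[OF d] by (simp add: M_def algebra_simps H1norm_nrm d)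
  also have "M * H1norm ?d \<le> \<epsilon>" using A(2) M by (simp add: pos_less_divide_eq mult.commute less_imp_le)
  finally show "cmod (F v) \<le> Hm1norm F * H1norm v + \<epsilon>" by simp
qed

lemma Hm1norm_projd:
  assumes "finite \<Lambda>"
  shows "(Hm1norm (projd \<Lambda> F))\<^sup>2 = (\<Sum>k\<in>\<Lambda>. (cmod (F (phi k)))\<^sup>2 / weight k)"
proof -
  have "projd \<Lambda> F (phi l) = (if l \<in> \<Lambda> then F (phi l) else 0)" for l
    using assms by (simp add: projd_def fcoef_phi if_distrib cong: if_cong)
  then have "infsum (\<lambda>k. (cmod (projd \<Lambda> F (phi k)))\<^sup>2 / weight k) UNIV
      = infsum (\<lambda>k. (cmod (F (phi k)))\<^sup>2 / weight k) \<Lambda>"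
    by (intro infsum_cong_neutral) auto
  then show ?thesis
    using assms unfolding Hm1norm_def weight_def[symmetric]
    by (simp add: sum_nonneg divide_nonneg_pos weight_pos)
qed

section \<open>Residuals and the energy error\<close>

context elliptic
begin

lemma energy_norm_nrm: "energy_norm \<nu> \<sigma> v = nrm v"
  by (simp add: energy_norm_def nrm_def)

lemma nrm_bounds:
  assumes v: "v \<in> H1p"
  shows "sqrt lo * H1norm v \<le> nrm v" and "nrm v \<le> sqrt hi * H1norm v"
proof -
  have H: "0 \<le> H1norm v" by (simp add: H1norm_nrm v H1.nrm_nonneg)
  have "lo * (H1norm v)\<^sup>2 \<le> (nrm v)\<^sup>2" "(nrm v)\<^sup>2 \<le> hi * (H1norm v)\<^sup>2"
    using bform_bounds[OF v] by (simp_all add: H1norm_nrm v H1_nrm_sq nrm_sq)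
  then have "(sqrt lo * H1norm v)\<^sup>2 \<le> (nrm v)\<^sup>2" "(nrm v)\<^sup>2 \<le> (sqrt hi * H1norm v)\<^sup>2"
    using lo_pos hi_pos by (simp_all add: power_mult_distrib)
  then show "sqrt lo * H1norm v \<le> nrm v" "nrm v \<le> sqrt hi * H1norm v"
    using H hi_pos by (auto intro: power2_le_imp_le nrm_nonneg v)
qed

text \<open>
  \<open>represents r e\<close> relates a residual to the error: \<open>r = f - L w\<close> is represented by \<open>e = u - w\<close>.
  Equality is required on \<open>H\<^sup>1\<close> only, which covers the initial residual \<open>f\<close> as well.
\<close>

definition represents :: "'d dual \<Rightarrow> 'd fn \<Rightarrow> bool" where
  "represents r e \<longleftrightarrow> e \<in> H1p \<and> (\<forall>v\<in>H1p. r v = bform \<nu> \<sigma> e v)"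

lemma represents_bound:
  assumes r: "represents r e" and v: "v \<in> H1p"
  shows "cmod (r v) \<le> (sqrt hi * nrm e) * H1norm v"
proof -
  have e: "e \<in> H1p" and rv: "r v = bform \<nu> \<sigma> e v" using r v by (auto simp: represents_def)
  have "cmod (r v) \<le> nrm e * nrm v" unfolding rv by (rule Cauchy_Schwarz[OF e v])
  also have "\<dots> \<le> nrm e * (sqrt hi * H1norm v)"
    by (intro mult_left_mono nrm_bounds v nrm_nonneg e)
  finally show ?thesis by (simp add: mult_ac)
qed

lemma represents_Hm1p:
  assumes r: "represents r e" shows "r \<in> Hm1p"
proof -
  have e: "e \<in> H1p" and rv: "\<And>v. v \<in> H1p \<Longrightarrow> r v = bform \<nu> \<sigma> e v" using r by (auto simp: represents_def)
  show ?thesis unfolding Hm1p_def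
  proof (intro CollectI conjI ballI allI)
    show "r (\<lambda>x. v x + w x) = r v + r w" if "v \<in> H1p" "w \<in> H1p" for v w
      using that by (simp add: rv H1p_add add_right e)
    show "r (\<lambda>x. c * v x) = cnj c * r v" if "v \<in> H1p" for c v
      using that by (simp add: rv H1p_scale scale_right e)
    show "\<exists>B. \<forall>v\<in>H1p. cmod (r v) \<le> B * H1norm v" using represents_bound[OF r] by (intro exI ballI)
  qed
qed

text \<open>
  The upper bound is the Cauchy-Schwarz inequality of the form.  For the lower bound, the residual is
  applied to the error itself.
\<close>

lemma represents_norm:
  assumes r: "represents r e"
  shows "Hm1norm r \<le> sqrt hi * nrm e" and "sqrt lo * nrm e \<le> Hm1norm r"
proof -
  have e: "e \<in> H1p" and re: "r e = bform \<nu> \<sigma> e e" using r by (auto simp: represents_def)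
  have ne: "0 \<le> nrm e" by (rule nrm_nonneg[OF e])
  show "Hm1norm r \<le> sqrt hi * nrm e"
    by (rule Hm1norm_le(2)[OF represents_Hm1p[OF r] _ represents_bound[OF r]]) (use ne hi_pos in simp_all)
  have "(nrm e)\<^sup>2 = cmod (r e)" unfolding re diag_real[OF e] norm_of_real by simp
  also have "\<dots> \<le> Hm1norm r * H1norm e" by (rule dual_pairing[OF represents_Hm1p[OF r] e])
  finally have le: "(nrm e)\<^sup>2 \<le> Hm1norm r * H1norm e" .
  show "sqrt lo * nrm e \<le> Hm1norm r"
  proof (cases "nrm e = 0")
    case False
    have "(sqrt lo * nrm e) * nrm e \<le> sqrt lo * (Hm1norm r * H1norm e)"
      using mult_left_mono[OF le, of "sqrt lo"] lo_pos by (simp add: power2_eq_square mult.assoc)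
    also have "\<dots> = Hm1norm r * (sqrt lo * H1norm e)" by simp
    also have "\<dots> \<le> Hm1norm r * nrm e" by (intro mult_left_mono nrm_bounds(1) e Hm1norm_nonneg)
    finally show ?thesis by (rule mult_right_le_imp_le) (use False ne in simp)
  qed (simp add: Hm1norm_nonneg)
qed

end

section \<open>The inner and the outer loop\<close>

locale adaptive = elliptic \<nu> \<sigma> lo hi for \<nu> \<sigma> :: "real^'d::finite \<Rightarrow> real" and lo hi +
  fixes f :: "'d dual" and u :: "'d fn" and gal :: "'d idx set \<Rightarrow> 'd fn"
    and doerfler :: "'d dual \<Rightarrow> 'd idx set"
    and coarse :: "'d idx set \<Rightarrow> 'd fn \<Rightarrow> real \<Rightarrow> 'd idx set" and \<theta> :: real
  assumes u: "u \<in> H1p" and u_eq: "\<And>v. v \<in> H1p \<Longrightarrow> bform \<nu> \<sigma> u v = f v"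
    and gal: "\<And>\<Lambda>. finite \<Lambda> \<Longrightarrow> galerkin_solution \<nu> \<sigma> f \<Lambda> (gal \<Lambda>)"
    and \<theta>: "0 < \<theta>" "\<theta> < 1"
    and doerfler: "is_doerfler \<theta> doerfler" and coarse: "is_coarse u coarse"
begin

abbreviation res :: "'d fn \<Rightarrow> 'd dual" where "res \<equiv> residual \<nu> \<sigma> f"

definition err :: "'d state \<Rightarrow> real" where
  "err s = nrm (\<lambda>x. u x - fst (snd s) x)"

text \<open>
  The invariant of both loops: the approximation is the Galerkin solution on its index set, and the
  third component is its residual.
\<close>

definition consistent :: "'d state \<Rightarrow> bool" where
  "consistent s \<longleftrightarrow> (case s of (\<Lambda>, w, r) \<Rightarrow>
     finite \<Lambda> \<and> galerkin_solution \<nu> \<sigma> f \<Lambda> w \<and> represents r (\<lambda>x. u x - w x))"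

lemma galerkin_H1p: "galerkin_solution \<nu> \<sigma> f \<Lambda> w \<Longrightarrow> w \<in> H1p"
  by (auto simp: galerkin_solution_def intro: Vspan_H1p)

lemma galerkin_orthogonal:
  assumes w: "galerkin_solution \<nu> \<sigma> f \<Lambda> w" and v: "v \<in> Vspan \<Lambda>"
  shows "bform \<nu> \<sigma> (\<lambda>x. u x - w x) v = 0"
proof -
  have "bform \<nu> \<sigma> w v = f v" using w v by (simp add: galerkin_solution_def)
  then show ?thesis
    using v by (simp add: diff_left[OF u galerkin_H1p[OF w] Vspan_H1p] u_eq Vspan_H1p)
qed

text \<open>
  The error \<open>u - w\<close> is orthogonal to the trial space, which contains \<open>w - v\<close>.
\<close>

lemma galerkin_Pythagoras:
  assumes w: "galerkin_solution \<nu> \<sigma> f \<Lambda> w" and v: "v \<in> Vspan \<Lambda>"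
  shows "(nrm (\<lambda>x. u x - v x))\<^sup>2 = (nrm (\<lambda>x. u x - w x))\<^sup>2 + (nrm (\<lambda>x. w x - v x))\<^sup>2"
proof -
  have wv: "(\<lambda>x. w x - v x) \<in> Vspan \<Lambda>" using w v by (intro Vspan_diff) (simp_all add: galerkin_solution_def)
  have "(\<lambda>x. u x - w x) \<in> H1p" by (intro diff_mem u galerkin_H1p[OF w])
  from nrm_sq_add[OF this Vspan_H1p[OF wv]] show ?thesis
    by (simp add: galerkin_orthogonal[OF w wv])
qed

lemma galerkin_best:
  assumes w: "galerkin_solution \<nu> \<sigma> f \<Lambda> w" and v: "v \<in> Vspan \<Lambda>"
  shows "nrm (\<lambda>x. u x - w x) \<le> nrm (\<lambda>x. u x - v x)"
proof (rule power2_le_imp_le)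
  show "(nrm (\<lambda>x. u x - w x))\<^sup>2 \<le> (nrm (\<lambda>x. u x - v x))\<^sup>2"
    unfolding galerkin_Pythagoras[OF w v] by simp
  show "0 \<le> nrm (\<lambda>x. u x - v x)" by (intro nrm_nonneg diff_mem u Vspan_H1p[OF v])
qed

lemma residual_represents:
  assumes w: "w \<in> H1p" shows "represents (res w) (\<lambda>x. u x - w x)"
  using u w by (simp add: represents_def residual_def Lop_def u_eq[symmetric] diff_left diff_mem)

lemma consistent_gal: "finite \<Lambda> \<Longrightarrow> consistent (\<Lambda>, gal \<Lambda>, res (gal \<Lambda>))"
  using gal[of \<Lambda>] by (simp add: consistent_def residual_represents galerkin_H1p)

text \<open>
  The initial residual is \<open>f\<close> by definition, and 0 is the Galerkin solution on the empty index set.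
\<close>

lemma consistent_initial: "consistent ({}, (\<lambda>x. 0), f)"
proof -
  have Vspan_empty: "Vspan {} = {\<lambda>x :: real^'d. 0}" by (auto simp: Vspan_def)
  have "bform \<nu> \<sigma> (\<lambda>x. 0) (\<lambda>x. 0) = f (\<lambda>x. 0)"
    using scale_right[OF zero_mem u, of 0] by (simp add: zero_left zero_mem u_eq[symmetric])
  then show ?thesis
    using u u_eq by (simp add: consistent_def galerkin_solution_def Vspan_empty represents_def)
qed

lemma consistent_bounds:
  assumes "consistent s"
  shows "0 \<le> err s" "sqrt lo * err s \<le> Hm1norm (state_res s)" "Hm1norm (state_res s) \<le> sqrt hi * err s"
proof -
  have "represents (state_res s) (\<lambda>x. u x - fst (snd s) x)"
    using assms by (simp add: consistent_def state_res_def split: prod.splits)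
  then show "0 \<le> err s" "sqrt lo * err s \<le> Hm1norm (state_res s)" "Hm1norm (state_res s) \<le> sqrt hi * err s"
    unfolding err_def by (auto intro: represents_norm nrm_nonneg simp: represents_def)
qed

text \<open>
  The factor by which one inner step reduces the squared energy error.
\<close>

definition q :: real where "q = 1 - \<theta>\<^sup>2 * lo / hi"

lemma q_range: "0 \<le> q" "q < 1"
proof -
  have "\<theta>\<^sup>2 * lo \<le> 1 * hi"
    using \<theta> lo_le_hi lo_pos by (intro mult_mono) (auto intro: power_le_one)
  then show "0 \<le> q" using hi_pos by (simp add: q_def)
  show "q < 1" using \<theta> lo_pos hi_pos by (simp add: q_def)
qed

text \<open>
  By the theorem of Pythagoras the squared error drops by the squared energy norm of the update \<open>d\<close>.
  On the marked set the coefficients of the old residual are those of \<open>a(d, \<cdot>)\<close>, because the new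
  error is orthogonal to the marked exponentials; hence the marked part of the residual, and with it the
  error, is bounded by the update.
\<close>

theorem inner_step_contraction:
  assumes s: "consistent s"
  shows "consistent (inner_step res gal doerfler s)"
    and "(err (inner_step res gal doerfler s))\<^sup>2 \<le> q * (err s)\<^sup>2"
proof -
  obtain \<Lambda> w r where s_eq: "s = (\<Lambda>, w, r)" by (cases s)
  have fin: "finite \<Lambda>" and w: "galerkin_solution \<nu> \<sigma> f \<Lambda> w" and r: "represents r (\<lambda>x. u x - w x)"
    using s by (simp_all add: consistent_def s_eq)
  let ?D = "doerfler r" and ?\<Lambda>' = "\<Lambda> \<union> doerfler r"
  let ?w' = "gal ?\<Lambda>'"
  have D: "finite ?D" "\<theta> * Hm1norm r \<le> Hm1norm (projd ?D r)"
    using doerfler represents_Hm1p[OF r] by (simp_all add: is_doerfler_def min_card_def)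
  have fin': "finite ?\<Lambda>'" using fin D by simp
  have step: "inner_step res gal doerfler s = (?\<Lambda>', ?w', res ?w')"
    by (simp add: inner_step_def s_eq Let_def)
  show "consistent (inner_step res gal doerfler s)"
    unfolding step by (rule consistent_gal[OF fin'])
  have w': "galerkin_solution \<nu> \<sigma> f ?\<Lambda>' ?w'" by (rule gal[OF fin'])
  have w_mem: "w \<in> Vspan ?\<Lambda>'"
    using w Vspan_mono[of \<Lambda> ?\<Lambda>'] by (auto simp: galerkin_solution_def)
  define d where "d x = ?w' x - w x" for x
  have d: "d \<in> H1p" unfolding d_def by (intro diff_mem galerkin_H1p[OF w'] galerkin_H1p[OF w])
  have Pyth: "(err s)\<^sup>2 = (err (inner_step res gal doerfler s))\<^sup>2 + (nrm d)\<^sup>2"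
    unfolding err_def step using galerkin_Pythagoras[OF w' w_mem] by (simp add: s_eq d_def[abs_def])
  have coef: "r (phi k) = bform \<nu> \<sigma> d (phi k)" if "k \<in> ?D" for k
  proof -
    have k: "phi k \<in> Vspan ?\<Lambda>'" using that by (intro phi_Vspan) simp
    have "r (phi k) = bform \<nu> \<sigma> u (phi k) - bform \<nu> \<sigma> w (phi k)"
      using r by (simp add: represents_def phi_H1p diff_left u galerkin_H1p[OF w])
    also have "bform \<nu> \<sigma> u (phi k) = bform \<nu> \<sigma> ?w' (phi k)"
      using galerkin_orthogonal[OF w' k] by (simp add: diff_left u galerkin_H1p[OF w'] phi_H1p)
    finally show ?thesis
      unfolding d_def[abs_def] by (simp add: diff_left galerkin_H1p[OF w] galerkin_H1p[OF w'] phi_H1p)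
  qed
  have rep_d: "represents (bform \<nu> \<sigma> d) d" using d by (simp add: represents_def)
  have "(Hm1norm (projd ?D r))\<^sup>2 = (\<Sum>k\<in>?D. (cmod (bform \<nu> \<sigma> d (phi k)))\<^sup>2 / weight k)"
    unfolding Hm1norm_projd[OF D(1)] by (intro sum.cong) (simp_all add: coef)
  also have "\<dots> \<le> (sqrt hi * nrm d)\<^sup>2"
    by (rule dual_coefficients_bound[OF represents_Hm1p[OF rep_d] D(1) represents_bound[OF rep_d Vspan_H1p]])
  also have "\<dots> = hi * (nrm d)\<^sup>2" using hi_pos by (simp add: power_mult_distrib)
  finally have upper: "(Hm1norm (projd ?D r))\<^sup>2 \<le> hi * (nrm d)\<^sup>2" .
  have "\<theta> * (sqrt lo * err s) \<le> \<theta> * Hm1norm r"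
    using consistent_bounds(2)[OF s] \<theta> by (simp add: s_eq state_res_def)
  also note D(2)
  finally have "(\<theta> * (sqrt lo * err s))\<^sup>2 \<le> (Hm1norm (projd ?D r))\<^sup>2"
    using \<theta> lo_pos consistent_bounds(1)[OF s] by (intro power_mono) simp_all
  with upper have "\<theta>\<^sup>2 * lo * (err s)\<^sup>2 \<le> hi * (nrm d)\<^sup>2"
    using lo_pos by (simp add: power_mult_distrib)
  then have "\<theta>\<^sup>2 * lo / hi * (err s)\<^sup>2 \<le> (nrm d)\<^sup>2" using hi_pos by (simp add: field_simps)
  then show "(err (inner_step res gal doerfler s))\<^sup>2 \<le> q * (err s)\<^sup>2"
    using Pyth by (simp add: q_def left_diff_distrib)
qed

lemma inner_state_contraction:
  assumes s: "consistent s"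
  shows "consistent (inner_state res gal doerfler s k)"
    and "(err (inner_state res gal doerfler s k))\<^sup>2 \<le> q ^ k * (err s)\<^sup>2"
proof (induction k)
  case (Suc k)
  {
    case 1
    show ?case using inner_step_contraction(1)[OF Suc(1)] by (simp add: inner_state_def)
  next
    case 2
    have "(err (inner_state res gal doerfler s (Suc k)))\<^sup>2 \<le> q * (err (inner_state res gal doerfler s k))\<^sup>2"
      using inner_step_contraction(2)[OF Suc(1)] by (simp add: inner_state_def)
    also have "\<dots> \<le> q * (q ^ k * (err s)\<^sup>2)" by (intro mult_left_mono Suc(2) q_range)
    finally show ?case by (simp add: mult.assoc)
  }
qed (simp_all add: inner_state_def s)

text \<open>
  The squared residual after \<open>k\<close> steps is at most \<open>hi / lo * q ^ k\<close> times the initial one, and this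
  factor does not depend on the state from which the loop starts.
\<close>

theorem inner_loop_bounded:
  "\<exists>K. \<forall>s. consistent s \<longrightarrow> inner_exit res gal doerfler \<theta> s K"
proof -
  have \<theta>2: "0 < 1 - \<theta>\<^sup>2" using \<theta> by (simp add: power_less_one_iff abs_square_less_1)
  have "0 < (1 - \<theta>\<^sup>2) * lo / hi" using \<theta>2 lo_pos hi_pos by simp
  then obtain m where m: "q ^ m < (1 - \<theta>\<^sup>2) * lo / hi"
    using real_arch_pow_inv[OF _ q_range(2)] by blast
  \<comment> \<open>The successor guarantees the one iteration that precedes the first exit test.\<close>
  have "inner_exit res gal doerfler \<theta> s (Suc m)" if s: "consistent s" for s
  proof -
    let ?t = "inner_state res gal doerfler s (Suc m)"
    note t = inner_state_contraction[OF s, of "Suc m"]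
    have "hi * q ^ Suc m \<le> hi * q ^ m"
      using q_range hi_pos by (intro mult_left_mono power_decreasing) auto
    moreover have "hi * q ^ m < (1 - \<theta>\<^sup>2) * lo"
      using m hi_pos by (simp only: pos_less_divide_eq mult.commute[of hi])
    ultimately have qm: "hi * q ^ Suc m \<le> (1 - \<theta>\<^sup>2) * lo" by linarith
    have "(Hm1norm (state_res ?t))\<^sup>2 \<le> (sqrt hi * err ?t)\<^sup>2"
      by (intro power_mono consistent_bounds t Hm1norm_nonneg)
    also have "\<dots> = hi * (err ?t)\<^sup>2" using hi_pos by (simp add: power_mult_distrib)
    also have "\<dots> \<le> hi * (q ^ Suc m * (err s)\<^sup>2)" using hi_pos by (intro mult_left_mono t) simp
    also have "\<dots> = (hi * q ^ Suc m) * (err s)\<^sup>2" by simp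
    also have "\<dots> \<le> ((1 - \<theta>\<^sup>2) * lo) * (err s)\<^sup>2" by (intro mult_right_mono qm) simp
    also have "\<dots> = (1 - \<theta>\<^sup>2) * (sqrt lo * err s)\<^sup>2" using lo_pos by (simp add: power_mult_distrib)
    also have "\<dots> \<le> (1 - \<theta>\<^sup>2) * (Hm1norm (state_res s))\<^sup>2"
      using \<theta>2 lo_pos consistent_bounds(1,2)[OF s] by (intro mult_left_mono power_mono) simp_all
    also have "\<dots> = (sqrt (1 - \<theta>\<^sup>2) * Hm1norm (state_res s))\<^sup>2"
      using \<theta>2 by (simp add: power_mult_distrib)
    finally have "Hm1norm (state_res ?t) \<le> sqrt (1 - \<theta>\<^sup>2) * Hm1norm (state_res s)"
      by (rule power2_le_imp_le) (use \<theta>2 Hm1norm_nonneg[of "state_res s"] in simp)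
    then show ?thesis by (simp add: inner_exit_def)
  qed
  then show ?thesis by blast
qed

text \<open>
  The inner error and the coarsening error add up to three times the tolerance handed to the coarsening,
  and the Galerkin solution on the coarsened set is at least as good in the energy norm as the
  coarsened function.
\<close>

lemma coarse_error:
  assumes fin: "finite \<Lambda>" and w: "galerkin_solution \<nu> \<sigma> f \<Lambda> w" and r: "represents r (\<lambda>x. u x - w x)"
  defines "\<Lambda>' \<equiv> coarse \<Lambda> w (1 / lo * Hm1norm r)"
  shows "finite \<Lambda>'" and "nrm (\<lambda>x. u x - gal \<Lambda>' x) \<le> 3 * sqrt hi / lo * Hm1norm r"
proof -
  let ?\<epsilon> = "1 / lo * Hm1norm r" and ?e = "\<lambda>x. u x - w x"
  have e: "?e \<in> H1p" by (intro diff_mem u galerkin_H1p[OF w])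
  have "lo * H1norm ?e = sqrt lo * (sqrt lo * H1norm ?e)" using lo_pos by simp
  also have "\<dots> \<le> sqrt lo * nrm ?e" using lo_pos by (intro mult_left_mono nrm_bounds e) simp
  also have "\<dots> \<le> Hm1norm r" by (rule represents_norm(2)[OF r])
  finally have near: "H1norm ?e \<le> ?\<epsilon>" using lo_pos by (simp add: field_simps)
  have "w \<in> Vspan \<Lambda>" using w by (simp add: galerkin_solution_def)
  then have c: "\<Lambda>' \<subseteq> \<Lambda>" "H1norm (\<lambda>x. w x - proj \<Lambda>' w x) \<le> 2 * ?\<epsilon>"
    using coarse fin near unfolding \<Lambda>'_def is_coarse_def min_card_def by blast+
  show fin': "finite \<Lambda>'" using c(1) fin by (rule finite_subset)
  let ?p = "proj \<Lambda>' w" and ?d = "\<lambda>x. w x - proj \<Lambda>' w x"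
  have p: "?p \<in> Vspan \<Lambda>'" unfolding proj_def by (rule Vspan_comb[OF fin' order_refl])
  have d: "?d \<in> H1p" by (intro diff_mem galerkin_H1p[OF w] proj_mem)
  have up: "(\<lambda>x. u x - ?p x) \<in> H1p" by (intro diff_mem u proj_mem)
  have "H1norm (\<lambda>x. ?e x + ?d x) \<le> H1norm ?e + H1norm ?d"
    using H1.nrm_triangle[OF e d] by (simp only: H1norm_nrm e d H1p_add)
  then have tri: "H1norm (\<lambda>x. u x - ?p x) \<le> 3 * ?\<epsilon>" using near c(2) by simp
  have "nrm (\<lambda>x. u x - gal \<Lambda>' x) \<le> nrm (\<lambda>x. u x - ?p x)" by (rule galerkin_best[OF gal[OF fin'] p])
  also have "\<dots> \<le> sqrt hi * H1norm (\<lambda>x. u x - ?p x)" by (rule nrm_bounds(2)[OF up])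
  also have "\<dots> \<le> sqrt hi * (3 * ?\<epsilon>)" using hi_pos by (intro mult_left_mono tri) simp
  finally show "nrm (\<lambda>x. u x - gal \<Lambda>' x) \<le> 3 * sqrt hi / lo * Hm1norm r" by (simp add: mult_ac)
qed

definition \<rho> :: real where "\<rho> = 3 * (hi / lo) * sqrt (1 - \<theta>\<^sup>2)"

lemma \<rho>_nonneg: "0 \<le> \<rho>"
  using lo_pos hi_pos \<theta> by (simp add: \<rho>_def power_le_one)

text \<open>
  The coarsening bound is combined with the exit criterion of the inner loop.  One more factor
  \<open>sqrt hi\<close> arises on either side: from the new error to the new residual for the first estimate, and
  from the old residual to the old error for the second.
\<close>

theorem outer_step_contraction:
  assumes s: "consistent s"
  defines "s' \<equiv> outer_step res gal doerfler coarse lo \<theta> s"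
  shows "consistent s'" and "Hm1norm (state_res s') \<le> \<rho> * Hm1norm (state_res s)" and "err s' \<le> \<rho> * err s"
proof -
  let ?n = "inner_iterations res gal doerfler \<theta> s"
  obtain \<Lambda> w r where t: "inner_state res gal doerfler s ?n = (\<Lambda>, w, r)" by (metis prod_cases3)
  have ct: "consistent (\<Lambda>, w, r)" using inner_state_contraction(1)[OF s, of ?n] t by simp
  then have fin: "finite \<Lambda>" and w: "galerkin_solution \<nu> \<sigma> f \<Lambda> w" and r: "represents r (\<lambda>x. u x - w x)"
    by (simp_all add: consistent_def)
  obtain K where "inner_exit res gal doerfler \<theta> s K" using inner_loop_bounded s by blast
  then have "inner_exit res gal doerfler \<theta> s ?n" unfolding inner_iterations_def by (rule LeastI)
  then have exit: "Hm1norm r \<le> sqrt (1 - \<theta>\<^sup>2) * Hm1norm (state_res s)"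
    using t by (simp add: inner_exit_def state_res_def)
  define \<Lambda>' where "\<Lambda>' = coarse \<Lambda> w (1 / lo * Hm1norm r)"
  have s': "s' = (\<Lambda>', gal \<Lambda>', res (gal \<Lambda>'))"
    unfolding s'_def outer_step_def t by (simp add: Let_def \<Lambda>'_def)
  note c = coarse_error[OF fin w r, folded \<Lambda>'_def]
  show cs': "consistent s'" unfolding s' by (rule consistent_gal[OF c(1)])
  have "err s' \<le> 3 * sqrt hi / lo * Hm1norm r" using c(2) by (simp add: err_def s')
  also have "\<dots> \<le> 3 * sqrt hi / lo * (sqrt (1 - \<theta>\<^sup>2) * Hm1norm (state_res s))"
    using lo_pos hi_pos by (intro mult_left_mono exit) simp
  finally have err: "err s' \<le> 3 * sqrt hi / lo * (sqrt (1 - \<theta>\<^sup>2) * Hm1norm (state_res s))" .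
  have hi: "sqrt hi * sqrt hi = hi" using hi_pos by simp
  have "Hm1norm (state_res s') \<le> sqrt hi * err s'" by (rule consistent_bounds(3)[OF cs'])
  also have "\<dots> \<le> sqrt hi * (3 * sqrt hi / lo * (sqrt (1 - \<theta>\<^sup>2) * Hm1norm (state_res s)))"
    using hi_pos by (intro mult_left_mono err) simp
  also have "\<dots> = 3 * ((sqrt hi * sqrt hi) / lo) * sqrt (1 - \<theta>\<^sup>2) * Hm1norm (state_res s)" by (simp add: mult_ac)
  finally show "Hm1norm (state_res s') \<le> \<rho> * Hm1norm (state_res s)" unfolding hi \<rho>_def .
  note err
  also have "3 * sqrt hi / lo * (sqrt (1 - \<theta>\<^sup>2) * Hm1norm (state_res s))
      \<le> 3 * sqrt hi / lo * (sqrt (1 - \<theta>\<^sup>2) * (sqrt hi * err s))"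
    using lo_pos hi_pos \<theta> by (intro mult_left_mono consistent_bounds(3)[OF s]) (simp_all add: power_le_one)
  also have "\<dots> = 3 * ((sqrt hi * sqrt hi) / lo) * sqrt (1 - \<theta>\<^sup>2) * err s" by (simp add: mult_ac)
  finally show "err s' \<le> \<rho> * err s" unfolding hi \<rho>_def .
qed

lemma H1norm_le_err:
  assumes s: "consistent s"
  shows "0 \<le> H1norm (\<lambda>x. u x - fst (snd s) x)" "H1norm (\<lambda>x. u x - fst (snd s) x) \<le> err s / sqrt lo"
proof -
  have e: "(\<lambda>x. u x - fst (snd s) x) \<in> H1p"
    using s by (simp add: consistent_def represents_def split: prod.splits)
  show "0 \<le> H1norm (\<lambda>x. u x - fst (snd s) x)" by (simp add: H1norm_nrm e H1.nrm_nonneg)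
  show "H1norm (\<lambda>x. u x - fst (snd s) x) \<le> err s / sqrt lo"
    using nrm_bounds(1)[OF e] lo_pos by (simp add: err_def pos_le_divide_eq mult.commute)
qed

context
  fixes tol :: real and S
  defines "S \<equiv> cadfour f res gal doerfler coarse lo \<theta> tol"
begin

lemma S_Suc: "S (Suc n) = (if iterates_at tol n (S n) then outer_step res gal doerfler coarse lo \<theta> (S n) else S n)"
  by (simp add: S_def Let_def)

lemma S_consistent: "consistent (S n)"
proof (induction n)
  case 0 then show ?case by (simp add: S_def consistent_initial)
next
  case (Suc n) then show ?case by (simp add: S_Suc outer_step_contraction(1))
qed

lemma S_step:
  assumes "iterates_at tol n (S n)"
  shows "Hm1norm (state_res (S (Suc n))) \<le> \<rho> * Hm1norm (state_res (S n))"
    and "err (S (Suc n)) \<le> \<rho> * err (S n)"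
  using outer_step_contraction(2,3)[OF S_consistent[of n]] assms by (simp_all add: S_Suc)

lemma S_geometric:
  assumes "\<And>m. m < n \<Longrightarrow> iterates_at tol m (S m)"
  shows "Hm1norm (state_res (S n)) \<le> \<rho> ^ n * Hm1norm (state_res (S 0)) \<and> err (S n) \<le> \<rho> ^ n * err (S 0)"
  using assms
proof (induction n)
  case (Suc n)
  note step = S_step[OF Suc.prems[OF lessI]]
  have IH: "Hm1norm (state_res (S n)) \<le> \<rho> ^ n * Hm1norm (state_res (S 0))" "err (S n) \<le> \<rho> ^ n * err (S 0)"
    using Suc by simp_all
  show ?case
    using order_trans[OF step(1) mult_left_mono[OF IH(1) \<rho>_nonneg]]
      order_trans[OF step(2) mult_left_mono[OF IH(2) \<rho>_nonneg]] by (simp add: mult.assoc)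
qed simp

lemma S_terminates:
  assumes \<rho>: "\<rho> < 1" and tol_pos: "0 < tol"
  shows "\<exists>n. \<not> iterates_at tol n (S n)"
proof (rule ccontr)
  assume "\<not> ?thesis"
  then have it: "\<And>n. iterates_at tol n (S n)" by simp
  have "(\<lambda>n. \<rho> ^ n * Hm1norm (state_res (S 0))) \<longlonglongrightarrow> 0 * Hm1norm (state_res (S 0))"
    using \<rho> \<rho>_nonneg by (intro tendsto_mult_right LIMSEQ_realpow_zero)
  then have "\<forall>\<^sub>F n in sequentially. \<rho> ^ n * Hm1norm (state_res (S 0)) < tol"
    using tol_pos by (intro order_tendstoD) simp_all
  then obtain N where N: "\<And>n. N \<le> n \<Longrightarrow> \<rho> ^ n * Hm1norm (state_res (S 0)) < tol"
    unfolding eventually_sequentially by blast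
  have "Hm1norm (state_res (S (Suc N))) < tol"
    using S_geometric[of "Suc N"] it N[of "Suc N"] by simp
  then show False using it[of "Suc N"] by (simp add: iterates_at_def)
qed

text \<open>
  If the loop stops at some index, then the residual there is 0, hence so is the error, and the sequence
  stays constant.
\<close>

lemma S_converges:
  assumes \<rho>: "\<rho> < 1" and tol0: "tol = 0"
  shows "(\<lambda>n. H1norm (\<lambda>x. u x - fst (snd (S n)) x)) \<longlonglongrightarrow> 0"
proof (cases "\<forall>n. iterates_at tol n (S n)")
  case True
  have "(\<lambda>n. \<rho> ^ n * err (S 0) / sqrt lo) \<longlonglongrightarrow> 0 * err (S 0) / sqrt lo"
    using \<rho> \<rho>_nonneg lo_pos by (intro tendsto_intros LIMSEQ_realpow_zero) simp_all
  then have lim: "(\<lambda>n. \<rho> ^ n * err (S 0) / sqrt lo) \<longlonglongrightarrow> 0" by simp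
  show ?thesis
  proof (rule tendsto_sandwich[OF _ _ tendsto_const lim])
    show "\<forall>\<^sub>F n in sequentially. 0 \<le> H1norm (\<lambda>x. u x - fst (snd (S n)) x)"
      by (simp add: H1norm_le_err(1)[OF S_consistent])
    have "H1norm (\<lambda>x. u x - fst (snd (S n)) x) \<le> \<rho> ^ n * err (S 0) / sqrt lo" for n
    proof -
      have "err (S n) / sqrt lo \<le> \<rho> ^ n * err (S 0) / sqrt lo"
        using S_geometric[of n] True lo_pos by (intro divide_right_mono) simp_all
      then show ?thesis using H1norm_le_err(2)[OF S_consistent[of n]] by linarith
    qed
    then show "\<forall>\<^sub>F n in sequentially. H1norm (\<lambda>x. u x - fst (snd (S n)) x) \<le> \<rho> ^ n * err (S 0) / sqrt lo"
      by simp
  qed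
next
  case False
  then obtain N where N: "\<not> iterates_at tol N (S N)" by blast
  then have N0: "N \<noteq> 0" and res0: "Hm1norm (state_res (S N)) \<le> 0" using tol0 by (simp_all add: iterates_at_def)
  have stay: "S (N + m) = S N" for m
  proof (induction m)
    case (Suc m)
    have "\<not> iterates_at tol (N + m) (S (N + m))"
      using N0 res0 tol0 by (simp add: Suc.IH iterates_at_def)
    then show ?case using S_Suc[of "N + m"] Suc.IH by simp
  qed simp
  have "sqrt lo * err (S N) \<le> 0" using consistent_bounds(2)[OF S_consistent[of N]] res0 by linarith
  then have "err (S N) \<le> 0" using lo_pos by (simp add: mult_le_0_iff)
  then have "err (S N) / sqrt lo \<le> 0" using lo_pos by (simp add: divide_le_0_iff)
  then have "H1norm (\<lambda>x. u x - fst (snd (S N)) x) = 0"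
    using H1norm_le_err[OF S_consistent[of N]] by linarith
  then have "H1norm (\<lambda>x. u x - fst (snd (S n)) x) = 0" if "N \<le> n" for n
    using stay[of "n - N"] that by simp
  then have "\<forall>\<^sub>F n in sequentially. H1norm (\<lambda>x. u x - fst (snd (S n)) x) = 0"
    unfolding eventually_sequentially by blast
  then show ?thesis by (rule tendsto_eventually)
qed

end

end

theorem theorem3p4:
  fixes \<nu> \<sigma> :: "real^'d::finite \<Rightarrow> real"
    and \<nu>lo \<nu>hi \<sigma>lo \<sigma>hi \<alpha>lo \<alpha>hi \<theta> tol \<rho> :: real
    and f :: "'d dual"
    and u :: "'d fn"
    and gal :: "'d idx set \<Rightarrow> 'd fn"
    and doerfler :: "'d dual \<Rightarrow> 'd idx set"
    and coarse :: "'d idx set \<Rightarrow> 'd fn \<Rightarrow> real \<Rightarrow> 'd idx set"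
    and res :: "'d fn \<Rightarrow> 'd dual"
    and S :: "nat \<Rightarrow> 'd state"
    and \<Lambda>s :: "nat \<Rightarrow> 'd idx set"
    and us :: "nat \<Rightarrow> 'd fn"
    and rs :: "nat \<Rightarrow> 'd dual"
  assumes nu_smooth: "periodic \<nu>" "C1 \<nu>"
    and sigma_smooth: "periodic \<sigma>" "continuous_on UNIV \<sigma>"
    and nu_bounds: "0 < \<nu>lo" "\<And>x. \<nu>lo \<le> \<nu> x \<and> \<nu> x \<le> \<nu>hi"
    and sigma_bounds: "0 < \<sigma>lo" "\<And>x. \<sigma>lo \<le> \<sigma> x \<and> \<sigma> x \<le> \<sigma>hi"
    and alpha: "\<alpha>lo = min \<nu>lo \<sigma>lo" "\<alpha>hi = max \<nu>hi \<sigma>hi"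
    and f: "f \<in> Hm1p"
    and u: "u \<in> H1p" "\<And>v. v \<in> H1p \<Longrightarrow> bform \<nu> \<sigma> u v = f v"
    and gal: "\<And>\<Lambda>. finite \<Lambda> \<Longrightarrow> galerkin_solution \<nu> \<sigma> f \<Lambda> (gal \<Lambda>)"
    and res: "res = residual \<nu> \<sigma> f"
    and theta: "0 < \<theta>" "\<theta> < 1"
    and tol: "0 \<le> tol" "tol < 1"
    and doerfler: "is_doerfler \<theta> doerfler"
    and coarse: "is_coarse u coarse"
    and S: "S = cadfour f res gal doerfler coarse \<alpha>lo \<theta> tol"
    and components: "\<And>n. S n = (\<Lambda>s n, us n, rs n)"
    and rho: "\<rho> = 3 * (\<alpha>hi / \<alpha>lo) * sqrt (1 - \<theta>\<^sup>2)"
  shows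
    "(\<exists>K. \<forall>n. iterates_at tol n (S n) \<longrightarrow>
         inner_terminates res gal doerfler \<theta> (S n) \<and>
         inner_iterations res gal doerfler \<theta> (S n) \<le> K)
   \<and> (\<forall>n. iterates_at tol n (S n) \<longrightarrow>
         Hm1norm (rs (Suc n)) \<le> \<rho> * Hm1norm (rs n) \<and>
         energy_norm \<nu> \<sigma> (\<lambda>x. u x - us (Suc n) x) \<le> \<rho> * energy_norm \<nu> \<sigma> (\<lambda>x. u x - us n x))
   \<and> (\<rho> < 1 \<longrightarrow>
         (0 < tol \<longrightarrow> (\<exists>n. \<not> iterates_at tol n (S n))) \<and>
         (tol = 0 \<longrightarrow> (\<lambda>n. H1norm (\<lambda>x. u x - us n x)) \<longlonglongrightarrow> 0))"
proof -
  have cont: "continuous_on UNIV \<nu>" by (rule C1_continuous[OF nu_smooth(2)])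
  have bounds: "\<alpha>lo \<le> \<nu> x" "\<nu> x \<le> \<alpha>hi" "\<alpha>lo \<le> \<sigma> x" "\<sigma> x \<le> \<alpha>hi" for x
    using nu_bounds(2)[of x] sigma_bounds(2)[of x] unfolding alpha by linarith+
  interpret adaptive \<nu> \<sigma> \<alpha>lo \<alpha>hi f u gal doerfler coarse \<theta>
  proof
    show "0 < \<alpha>lo" using nu_bounds(1) sigma_bounds(1) by (simp add: alpha)
  qed (use cont sigma_smooth(2) bounds u gal theta doerfler coarse in
      \<open>auto intro: borel_measurable_continuous_onI\<close>)
  have S_eq: "S = cadfour f (residual \<nu> \<sigma> f) gal doerfler coarse \<alpha>lo \<theta> tol" using S res by simp
  note consistent = S_consistent[of tol, folded S_eq]
    and step = S_step[of tol, folded S_eq]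
    and terminates = S_terminates[of tol, folded S_eq]
    and converges = S_converges[of tol, folded S_eq]
  have us: "us n = fst (snd (S n))" and rs: "rs n = state_res (S n)" for n
    by (simp_all add: components state_res_def)
  have energy: "energy_norm \<nu> \<sigma> (\<lambda>x. u x - us n x) = err (S n)" for n
    by (simp add: energy_norm_nrm err_def us)
  have rho_eq: "\<rho> = local.\<rho>"
    using rho by (simp add: \<rho>_def)
  obtain K where K: "\<And>s. consistent s \<Longrightarrow> inner_exit (residual \<nu> \<sigma> f) gal doerfler \<theta> s K"
    using inner_loop_bounded by blast
  have "inner_terminates res gal doerfler \<theta> (S n) \<and> inner_iterations res gal doerfler \<theta> (S n) \<le> K" for n
    using K[OF consistent[of n]] unfolding res inner_terminates_def inner_iterations_def
    by (auto intro: Least_le)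
  moreover have "Hm1norm (rs (Suc n)) \<le> \<rho> * Hm1norm (rs n) \<and>
      energy_norm \<nu> \<sigma> (\<lambda>x. u x - us (Suc n) x) \<le> \<rho> * energy_norm \<nu> \<sigma> (\<lambda>x. u x - us n x)"
    if "iterates_at tol n (S n)" for n
    unfolding rs energy rho_eq using step[OF that] by simp
  moreover have "\<exists>n. \<not> iterates_at tol n (S n)" if "\<rho> < 1" "0 < tol"
    using terminates that unfolding rho_eq by simp
  moreover have "(\<lambda>n. H1norm (\<lambda>x. u x - us n x)) \<longlonglongrightarrow> 0" if "\<rho> < 1" "tol = 0"
    using converges that unfolding rho_eq us by simp
  ultimately show ?thesis by blast
qed

end
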